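(* Let $d\ge1$, $\delta>0$, and $N\ge d+2$. Let $\varphi_1,\dots,\varphi_N$ be i.i.d. random vectors uniformly distributed on $\mathbb{S}^{d-1}$, and $\epsilon_1,\dots,\epsilon_N$ i.i.d. uniform on $[-\delta,\delta]$, independent of the $\varphi_n$. Let $P_N=\bigcap_{n=1}^N\{u\in\mathbb{R}^d:|\langle u,\varphi_n\rangle-\epsilon_n|\le\delta\}$ and $W_N=\sup\{\|u\|:u\in P_N\}$. Then $$\mathbb{E}|W_N|^2\le\frac{2e^{12}\delta^2d^3}{(N+1)(N+2)}+26\delta^2d^{3/2}\Big(\frac{11}{12}\Big)^{N/2}e^{\frac{d\ln(1024d)}{2}}.$$ In particular, writing $W_N=W_N^{(d)}$ to indicate the dimension, $$\limsup_{d\to\infty}\mathbb{E}|W^{(d)}_{\lceil d^{3/2}\rceil}|^2\le2e^{12}\delta^2\qquad\text{and}\qquad\lim_{d\to\infty}\mathbb{E}|W^{(d)}_{\lceil d^{3/2}\ln d\rceil}|^2=0.$$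
   Context: $\mathbb{S}^{d-1}$ is the unit sphere of $\mathbb{R}^d$ with normalized surface measure. $W_N$ is the worst case error of consistent reconstruction from measurements $q_n=\langle x,\varphi_n\rangle+\epsilon_n$. *)

theory Defs
  imports "HOL-Probability.Probability"
begin

text \<open>Vectors of R^d are represented as extensional functions nat => real on {..<d}
  (the space of the product measure), so that the dimension d can vary.\<close>

definition lebesgue_d :: "nat \<Rightarrow> (nat \<Rightarrow> real) measure" where
  "lebesgue_d d = PiM {..<d} (\<lambda>_. lborel)"

definition inner_d :: "nat \<Rightarrow> (nat \<Rightarrow> real) \<Rightarrow> (nat \<Rightarrow> real) \<Rightarrow> real" where
  "inner_d d u v = (\<Sum>i<d. u i * v i)"

definition norm_d :: "nat \<Rightarrow> (nat \<Rightarrow> real) \<Rightarrow> real" where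
  "norm_d d u = sqrt (\<Sum>i<d. (u i)\<^sup>2)"

definition sphere_d :: "nat \<Rightarrow> (nat \<Rightarrow> real) set" where
  "sphere_d d = {x \<in> space (lebesgue_d d). norm_d d x = 1}"

definition cone_d :: "nat \<Rightarrow> (nat \<Rightarrow> real) set \<Rightarrow> (nat \<Rightarrow> real) set" where
  "cone_d d A = {restrict (\<lambda>i. t * x i) {..<d} | t x. 0 < t \<and> t \<le> 1 \<and> x \<in> A}"

text \<open>Normalized surface measure on S^{d-1}: sigma(A) = vol(cone A) / vol(unit ball).\<close>
definition sphere_measure :: "nat \<Rightarrow> (nat \<Rightarrow> real) measure" where
  "sphere_measure d = measure_of (sphere_d d)
      {A. A \<subseteq> sphere_d d \<and> cone_d d A \<in> sets (lebesgue_d d)}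
      (\<lambda>A. emeasure (lebesgue_d d) (cone_d d A) / emeasure (lebesgue_d d) (cone_d d (sphere_d d)))"

definition noise_measure :: "real \<Rightarrow> real measure" where
  "noise_measure \<delta> = uniform_measure lborel {-\<delta>..\<delta>}"

definition joint_measure :: "nat \<Rightarrow> nat \<Rightarrow> real \<Rightarrow> ((nat \<Rightarrow> nat \<Rightarrow> real) \<times> (nat \<Rightarrow> real)) measure" where
  "joint_measure d N \<delta> = PiM {..<N} (\<lambda>_. sphere_measure d) \<Otimes>\<^sub>M PiM {..<N} (\<lambda>_. noise_measure \<delta>)"

definition P_set :: "nat \<Rightarrow> nat \<Rightarrow> real \<Rightarrow> (nat \<Rightarrow> nat \<Rightarrow> real) \<Rightarrow> (nat \<Rightarrow> real) \<Rightarrow> (nat \<Rightarrow> real) set" where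
  "P_set d N \<delta> \<phi> \<epsilon> = {u \<in> space (lebesgue_d d). \<forall>n<N. \<bar>inner_d d u (\<phi> n) - \<epsilon> n\<bar> \<le> \<delta>}"

definition W :: "nat \<Rightarrow> nat \<Rightarrow> real \<Rightarrow> (nat \<Rightarrow> nat \<Rightarrow> real) \<times> (nat \<Rightarrow> real) \<Rightarrow> ennreal" where
  "W d N \<delta> \<omega> = (SUP u \<in> P_set d N \<delta> (fst \<omega>) (snd \<omega>). ennreal (norm_d d u))"

definition EW2 :: "nat \<Rightarrow> nat \<Rightarrow> real \<Rightarrow> ennreal" where
  "EW2 d N \<delta> = (\<integral>\<^sup>+ \<omega>. (W d N \<delta> \<omega>)\<^sup>2 \<partial>joint_measure d N \<delta>)"

end

theory Submission
  imports Defs "HOL-Real_Asymp.Real_Asymp"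
begin

text \<open>If a polytope contains u with norm l, then it meets the constraints only slightly worse at all points
  of a box around u. Integrating a random product over l-sized vectors v and applying Markov's inequality
  therefore bounds P(W > l) by (volume of the l-ball / volume of the box) times the N-th power of a
  one-step expectation, without the logarithm that a net at scale l / sqrt d would cost.
  For l below a multiple of \<delta> sqrt d the box has side proportional to l / sqrt d, the factors of the product
  penalise the amount of violation exponentially, and P(W > l) is at most C^d exp(-c N l / (\<delta> sqrt d)). This
  yields the term of order \<delta>^2 d^3 / N^2. For larger l the box has side \<delta> / sqrt d, the factors are indicator
  functions, and the bound decays like l^(d - 1 - N), which yields the second term.
  Both rest on P(|<v, phi>| <= m) <= 2.08 sqrt d m / |v| for phi uniform on the sphere: writing phi = g / |g|
  with g Gaussian, |g| and phi are independent, |g|^2 <= 3 d with probability at least 2/3, and <v, g> is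
  Gaussian.\<close>

section \<open>Lebesgue measure in dimension d\<close>

text \<open>A measurement excludes a point v of norm l only if its noise lies within about |<v,
  phi>|, typically l / sqrt d, of an end of the noise interval. So one measurement removes a share
  of order l / (\<delta> sqrt d), and C^d exp(-c N l / (\<delta> sqrt d)) starts to be small at l of
  order \<delta> d^(3/2) / N, the square root of the first term. This share is capped by a constant,
  so beyond l of order \<delta> sqrt d that argument stops improving with l, while a second moment
  needs decay in l. There the noise is ignored: a feasible v has |<v, phi>| \<le> 2 \<delta>, an
  event of probability of order sqrt d \<delta> / l. The N factors 1 / l compete with the number of
  boxes in a shell, of order l^(d - 1); with the weight l^2 of the second moment, the dyadic sum
  converges from N = d + 2 on. In the second term exp (d ln (1024 d) / 2) is (32 sqrt d)^d. Its
  decay sqrt (11/12)^N is much weaker than what the far range yields; the room left is spent on the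
  levels between the two regimes.\<close>

definition ball_d :: "nat \<Rightarrow> real \<Rightarrow> (nat \<Rightarrow> real) set" where
  "ball_d d R = {x \<in> space (lebesgue_d d). norm_d d x \<le> R}"

text \<open>Restricting keeps the result extensional, hence a point of the space, and gives exactly
  the shape of the points in \<open>cone_d\<close>.\<close>

definition scale_d :: "nat \<Rightarrow> real \<Rightarrow> (nat \<Rightarrow> real) \<Rightarrow> (nat \<Rightarrow> real)" where
  "scale_d d c x = (\<lambda>i\<in>{..<d}. c * x i)"

lemma sets_lebesgue_d [measurable_cong]: "sets (lebesgue_d d) = sets (PiM {..<d} (\<lambda>_. borel))"
  unfolding lebesgue_d_def by (intro sets_PiM_cong) auto

lemma space_lebesgue_d: "space (lebesgue_d d) = {..<d} \<rightarrow>\<^sub>E UNIV"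
  unfolding lebesgue_d_def by (simp add: space_PiM)

lemma sigma_finite_lebesgue_d: "sigma_finite_measure (lebesgue_d d)"
proof -
  interpret product_sigma_finite "\<lambda>_::nat. lborel" by standard
  show ?thesis unfolding lebesgue_d_def by (rule sigma_finite) simp
qed

lemma measurable_component_borel:
  "f \<in> measurable M (PiM I (\<lambda>_. borel)) \<Longrightarrow> i \<in> I \<Longrightarrow> (\<lambda>x. f x i) \<in> borel_measurable M"
  by (rule measurable_compose[OF _ measurable_component_singleton])

lemma measurable_inner_d:
  "f \<in> measurable M (PiM {..<d} (\<lambda>_. borel)) \<Longrightarrow> g \<in> measurable M (PiM {..<d} (\<lambda>_. borel))
    \<Longrightarrow> (\<lambda>x. inner_d d (f x) (g x)) \<in> borel_measurable M"
  unfolding inner_d_def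
  by (rule borel_measurable_sum borel_measurable_times measurable_component_borel; simp?)+

lemma measurable_inner_d_const [measurable (raw)]:
  "f \<in> measurable M (PiM {..<d} (\<lambda>_. borel)) \<Longrightarrow> (\<lambda>x. inner_d d u (f x)) \<in> borel_measurable M"
  unfolding inner_d_def by measurable (auto intro: measurable_component_borel)

lemma measurable_norm_d [measurable (raw)]:
  "f \<in> measurable M (PiM {..<d} (\<lambda>_. borel)) \<Longrightarrow> (\<lambda>x. norm_d d (f x)) \<in> borel_measurable M"
  unfolding norm_d_def
  by measurable (auto intro: measurable_component_borel)

lemma measurable_scale_d [measurable (raw)]:
  "f \<in> measurable M (PiM {..<d} (\<lambda>_. borel)) \<Longrightarrow> c \<in> borel_measurable M
    \<Longrightarrow> (\<lambda>x. scale_d d (c x) (f x)) \<in> measurable M (PiM {..<d} (\<lambda>_. borel))"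
  unfolding scale_d_def
  by (rule measurable_restrict borel_measurable_times measurable_component_borel; simp?)+

lemma sets_ball_d [measurable]: "ball_d d R \<in> sets (lebesgue_d d)"
  unfolding ball_d_def by measurable

lemma norm_d_nonneg [simp]: "0 \<le> norm_d d x"
  by (simp add: norm_d_def sum_nonneg)

lemma norm_d_power2: "(norm_d d x)\<^sup>2 = (\<Sum>i<d. (x i)\<^sup>2)"
  by (simp add: norm_d_def sum_nonneg)

lemma norm_d_L2_set: "norm_d d x = L2_set x {..<d}"
  by (simp add: norm_d_def L2_set_def)

lemma scale_d_in_space [simp]: "scale_d d c x \<in> space (lebesgue_d d)"
  by (simp add: space_lebesgue_d scale_d_def)

lemma norm_scale_d: "norm_d d (scale_d d c x) = \<bar>c\<bar> * norm_d d x"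
proof -
  have "(\<Sum>i<d. (scale_d d c x i)\<^sup>2) = c\<^sup>2 * (\<Sum>i<d. (x i)\<^sup>2)"
    unfolding sum_distrib_left by (intro sum.cong) (auto simp: scale_d_def power_mult_distrib)
  then show ?thesis by (simp add: norm_d_def real_sqrt_mult)
qed

lemma inner_scale_d_right: "inner_d d u (scale_d d c x) = c * inner_d d u x"
  unfolding inner_d_def sum_distrib_left by (intro sum.cong) (auto simp: scale_d_def)

lemma inner_scale_d_left: "inner_d d (scale_d d c u) x = c * inner_d d u x"
  unfolding inner_d_def sum_distrib_left by (intro sum.cong) (auto simp: scale_d_def)

lemma scale_d_scale_d: "scale_d d a (scale_d d b x) = scale_d d (a * b) x"
  by (auto simp: scale_d_def restrict_def)

lemma scale_d_1: "x \<in> space (lebesgue_d d) \<Longrightarrow> scale_d d 1 x = x"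
  by (auto simp: scale_d_def space_lebesgue_d PiE_restrict)

lemma abs_inner_d_le: "\<bar>inner_d d u v\<bar> \<le> norm_d d u * norm_d d v"
proof -
  have "\<bar>inner_d d u v\<bar> \<le> (\<Sum>i<d. \<bar>u i\<bar> * \<bar>v i\<bar>)"
    unfolding inner_d_def by (rule order_trans[OF sum_abs]) (simp add: abs_mult)
  also have "\<dots> \<le> norm_d d u * norm_d d v"
    unfolding norm_d_L2_set by (rule L2_set_mult_ineq)
  finally show ?thesis .
qed

lemma emeasure_lebesgue_d_box:
  "(\<And>i. i < d \<Longrightarrow> A i \<in> sets borel) \<Longrightarrow>
    emeasure (lebesgue_d d) (Pi\<^sub>E {..<d} A) = (\<Prod>i<d. emeasure lborel (A i))"
proof -
  interpret product_sigma_finite "\<lambda>_::nat. lborel" by standard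
  show "(\<And>i. i < d \<Longrightarrow> A i \<in> sets borel) \<Longrightarrow> ?thesis"
    unfolding lebesgue_d_def by (subst emeasure_PiM) auto
qed

text \<open>Boxes determine a product measure, and on a box the integral of a product weight
  factors. This serves twice: for the Gaussian and for the uniform law on a box.\<close>

lemma density_lebesgue_d:
  fixes f :: "nat \<Rightarrow> real \<Rightarrow> ennreal"
  assumes [measurable]: "\<And>i. f i \<in> borel_measurable borel"
    and prob: "\<And>i. prob_space (density lborel (f i))"
  shows "density (lebesgue_d d) (\<lambda>x. \<Prod>i<d. f i (x i)) = PiM {..<d} (\<lambda>i. density lborel (f i))"
proof -
  interpret L: product_sigma_finite "\<lambda>_::nat. lborel" by standard
  interpret product_prob_space "\<lambda>i. density lborel (f i)"
    by (rule product_prob_spaceI) (rule prob)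
  show ?thesis
  proof (rule PiM_eqI)
    show "sets (density (lebesgue_d d) (\<lambda>x. \<Prod>i<d. f i (x i))) = sets (PiM {..<d} (\<lambda>i. density lborel (f i)))"
      by (simp add: sets_lebesgue_d cong: sets_PiM_cong)
  next
    fix A :: "nat \<Rightarrow> real set" assume "\<And>i. i \<in> {..<d} \<Longrightarrow> A i \<in> sets (density lborel (f i))"
    then have A [measurable]: "\<And>i. i \<in> {..<d} \<Longrightarrow> A i \<in> sets borel" by simp
    have [measurable]: "Pi\<^sub>E {..<d} A \<in> sets (lebesgue_d d)"
      unfolding lebesgue_d_def using A by (intro sets_PiM_I_finite) auto
    have "emeasure (density (lebesgue_d d) (\<lambda>x. \<Prod>i<d. f i (x i))) (Pi\<^sub>E {..<d} A)
        = (\<integral>\<^sup>+x. (\<Prod>i<d. f i (x i)) * indicator (Pi\<^sub>E {..<d} A) x \<partial>lebesgue_d d)"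
      by (subst emeasure_density) auto
    also have "\<dots> = (\<integral>\<^sup>+x. (\<Prod>i<d. f i (x i) * indicator (A i) (x i)) \<partial>lebesgue_d d)"
    proof (intro nn_integral_cong)
      fix x assume x: "x \<in> space (lebesgue_d d)"
      have "indicator (Pi\<^sub>E {..<d} A) x = (\<Prod>i<d. indicator (A i) (x i) :: ennreal)"
        using x by (auto simp: indicator_def space_lebesgue_d PiE_def Pi_def prod_zero_iff split: if_splits)
      then show "(\<Prod>i<d. f i (x i)) * indicator (Pi\<^sub>E {..<d} A) x
          = (\<Prod>i<d. f i (x i) * indicator (A i) (x i))"
        by (simp add: prod.distrib)
    qed
    also have "\<dots> = (\<Prod>i<d. \<integral>\<^sup>+x. f i x * indicator (A i) x \<partial>lborel)"
      unfolding lebesgue_d_def using A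
      by (subst L.product_nn_integral_prod) auto
    also have "\<dots> = (\<Prod>i<d. emeasure (density lborel (f i)) (A i))"
      using A by (intro prod.cong) (auto simp: emeasure_density)
    finally show "emeasure (density (lebesgue_d d) (\<lambda>x. \<Prod>i<d. f i (x i))) (Pi\<^sub>E {..<d} A)
      = (\<Prod>i<d. emeasure (density lborel (f i)) (A i))" .
  qed simp
qed

section \<open>Dilations, cones and radial weights\<close>

lemma distr_scale_d:
  assumes c: "c > 0"
  shows "distr (lebesgue_d d) (lebesgue_d d) (scale_d d c)
    = density (lebesgue_d d) (\<lambda>_. ennreal ((1/c) ^ d))"
proof -
  interpret L: product_sigma_finite "\<lambda>_::nat. lborel" by standard
  have dist1: "distr (PiM {..<d} (\<lambda>_. lborel)) (PiM {..<d} (\<lambda>_. lborel)) (scale_d d c)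
    = density (PiM {..<d} (\<lambda>_. lborel)) (\<lambda>_. ennreal ((1/c) ^ d))" (is "?D = ?E")
  proof -
    interpret S: product_sigma_finite "\<lambda>_::nat. density (lborel :: real measure) (\<lambda>_. ennreal (1/c))"
    proof (unfold_locales, goal_cases)
      case (1 i)
      have "sigma_finite_measure (density lborel (\<lambda>_::real. ennreal (1/c)))"
        by (subst sigma_finite_measure.sigma_finite_iff_density_finite) (auto intro: sigma_finite_lborel)
      then show ?case by (rule sigma_finite_measure.sigma_finite_countable)
    qed
    have s: "sets (PiM {..<d} (\<lambda>_. density lborel (\<lambda>_. ennreal (1/c)))) = sets (PiM {..<d} (\<lambda>_. lborel::real measure))"
      by (intro sets_PiM_cong) auto
    have [measurable]: "scale_d d c \<in> measurable (PiM {..<d} (\<lambda>_. lborel)) (PiM {..<d} (\<lambda>_. lborel))"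
      unfolding scale_d_def by measurable
    \<comment> \<open>Both \<open>?D\<close> and \<open>?E\<close> are identified with the product
      of the one-dimensional measures of constant density 1/c, to which multiplication by c maps
      \<open>lborel\<close>.\<close>
    have "?D = PiM {..<d} (\<lambda>_. density lborel (\<lambda>_. ennreal (1/c)))"
    proof (rule S.PiM_eqI)
      fix A :: "nat \<Rightarrow> real set" assume "\<And>i. i \<in> {..<d} \<Longrightarrow> A i \<in> sets (density lborel (\<lambda>_. ennreal (1/c)))"
      then have A [measurable]: "\<And>i. i \<in> {..<d} \<Longrightarrow> A i \<in> sets borel" by simp
      have [measurable]: "Pi\<^sub>E {..<d} A \<in> sets (PiM {..<d} (\<lambda>_. lborel))"
        using A by (intro sets_PiM_I_finite) auto
      have "emeasure ?D (Pi\<^sub>E {..<d} A)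
          = emeasure (PiM {..<d} (\<lambda>_. lborel)) (scale_d d c -` (Pi\<^sub>E {..<d} A) \<inter> space (PiM {..<d} (\<lambda>_. lborel)))"
        by (subst emeasure_distr) auto
      also have "scale_d d c -` (Pi\<^sub>E {..<d} A) \<inter> space (PiM {..<d} (\<lambda>_. lborel))
          = Pi\<^sub>E {..<d} (\<lambda>i. (\<lambda>x. c * x) -` A i)"
        by (auto simp: space_PiM scale_d_def PiE_def Pi_def)
      also have "emeasure (PiM {..<d} (\<lambda>_. lborel)) \<dots> = (\<Prod>i<d. emeasure lborel ((\<lambda>x. c * x) -` A i))"
        using A by (subst L.emeasure_PiM) (auto intro!: measurable_sets_borel[of _ borel])
      also have "\<dots> = (\<Prod>i<d. emeasure (density lborel (\<lambda>_. ennreal (1/c))) (A i))"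
      proof (intro prod.cong refl)
        fix i assume i: "i \<in> {..<d}"
        have "emeasure lborel ((\<lambda>x. c * x) -` A i) = emeasure (distr lborel borel ((*) c)) (A i)"
          using A[OF i] by (subst emeasure_distr) auto
        also have "distr lborel borel ((*) c) = density lborel (\<lambda>_. ennreal (1/c))"
          using c by (subst lborel_distr_mult) (auto simp: field_simps)
        finally show "emeasure lborel ((\<lambda>x. c * x) -` A i) = emeasure (density lborel (\<lambda>_. ennreal (1/c))) (A i)" .
      qed
      finally show "emeasure ?D (Pi\<^sub>E {..<d} A) = (\<Prod>i<d. emeasure (density lborel (\<lambda>_. ennreal (1/c))) (A i))" .
    qed (auto simp: s)
    moreover have "?E = PiM {..<d} (\<lambda>_. density lborel (\<lambda>_. ennreal (1/c)))"
    proof (rule S.PiM_eqI)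
      fix A :: "nat \<Rightarrow> real set" assume "\<And>i. i \<in> {..<d} \<Longrightarrow> A i \<in> sets (density lborel (\<lambda>_. ennreal (1/c)))"
      then have A [measurable]: "\<And>i. i \<in> {..<d} \<Longrightarrow> A i \<in> sets borel" by simp
      have [measurable]: "Pi\<^sub>E {..<d} A \<in> sets (PiM {..<d} (\<lambda>_. lborel))"
        using A by (intro sets_PiM_I_finite) auto
      have "emeasure ?E (Pi\<^sub>E {..<d} A) = ennreal ((1/c)^d) * (\<Prod>i<d. emeasure lborel (A i))"
        using A by (subst emeasure_density_const) (auto simp: L.emeasure_PiM)
      also have "\<dots> = (\<Prod>i<d. ennreal (1/c) * emeasure lborel (A i))"
        using c by (simp add: prod.distrib ennreal_power)
      also have "\<dots> = (\<Prod>i<d. emeasure (density lborel (\<lambda>_. ennreal (1/c))) (A i))"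
        using A by (intro prod.cong) (auto simp: emeasure_density_const)
      finally show "emeasure ?E (Pi\<^sub>E {..<d} A) = (\<Prod>i<d. emeasure (density lborel (\<lambda>_. ennreal (1/c))) (A i))" .
    qed (auto simp: s)
    ultimately show ?thesis by simp
  qed
  then show ?thesis by (simp add: lebesgue_d_def)
qed

lemma emeasure_scale_d_vimage:
  assumes c: "c > 0" and S: "S \<in> sets (lebesgue_d d)"
  shows "emeasure (lebesgue_d d) {x \<in> space (lebesgue_d d). scale_d d c x \<in> S}
    = ennreal ((1/c) ^ d) * emeasure (lebesgue_d d) S"
proof -
  have m: "scale_d d c \<in> measurable (lebesgue_d d) (lebesgue_d d)" by measurable
  have "emeasure (distr (lebesgue_d d) (lebesgue_d d) (scale_d d c)) S
     = emeasure (lebesgue_d d) (scale_d d c -` S \<inter> space (lebesgue_d d))"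
    by (rule emeasure_distr[OF m S])
  also have "scale_d d c -` S \<inter> space (lebesgue_d d) = {x \<in> space (lebesgue_d d). scale_d d c x \<in> S}"
    by auto
  finally show ?thesis
    using S unfolding distr_scale_d[OF c] by (simp add: emeasure_density_const)
qed

lemma norm_d_eq_0_iff: "x \<in> space (lebesgue_d d) \<Longrightarrow> norm_d d x = 0 \<longleftrightarrow> x \<in> Pi\<^sub>E {..<d} (\<lambda>_. {0})"
  by (auto simp: norm_d_def sum_nonneg_eq_0_iff space_lebesgue_d PiE_def Pi_def extensional_def fun_eq_iff)

text \<open>The origin has no direction and is missing from \<open>cone_d\<close>, whose factors t
  are positive. Its being null makes punctured and full balls interchangeable; in dimension 0 it
  would be the whole space, of measure 1.\<close>

lemma null_origin:
  assumes "d \<ge> 1"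
  shows "{x \<in> space (lebesgue_d d). norm_d d x = 0} \<in> null_sets (lebesgue_d d)"
proof -
  have "Pi\<^sub>E {..<d} (\<lambda>_. {0}) \<subseteq> space (lebesgue_d d)"
    unfolding space_lebesgue_d by (rule PiE_mono) simp
  then have "{x \<in> space (lebesgue_d d). norm_d d x = 0} = Pi\<^sub>E {..<d} (\<lambda>_. {0})"
    using norm_d_eq_0_iff[of _ d] by blast
  moreover have "emeasure (lebesgue_d d) (Pi\<^sub>E {..<d} (\<lambda>_. {0})) = 0"
    using assms by (subst emeasure_lebesgue_d_box) auto
  moreover have "{x \<in> space (lebesgue_d d). norm_d d x = 0} \<in> sets (lebesgue_d d)" by measurable
  ultimately show ?thesis by (simp add: null_sets_def)
qed

text \<open>A cone is invariant under dilation, so its part in the ball of radius R is the dilate of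
  its part in the unit ball. For R = 0 there is no inverse dilation, but both sides vanish because
  the origin is null and d \<ge> 1.\<close>

lemma emeasure_cone_ball:
  assumes d: "d \<ge> 1" and S [measurable]: "S \<in> sets (lebesgue_d d)"
    and cone: "\<And>x t. x \<in> space (lebesgue_d d) \<Longrightarrow> t > 0 \<Longrightarrow> scale_d d t x \<in> S \<longleftrightarrow> x \<in> S"
    and R: "R \<ge> 0"
  shows "emeasure (lebesgue_d d) (S \<inter> ball_d d R) = ennreal (R ^ d) * emeasure (lebesgue_d d) (S \<inter> ball_d d 1)"
proof (cases "R = 0")
  case True
  have "S \<inter> ball_d d 0 \<subseteq> {x \<in> space (lebesgue_d d). norm_d d x = 0}"
    using norm_d_nonneg[of d] by (auto simp: ball_d_def intro: antisym)
  then have "S \<inter> ball_d d 0 \<in> null_sets (lebesgue_d d)"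
    by (rule null_sets_subset[OF null_origin[OF d], rotated]) measurable
  with True d show ?thesis by (simp add: null_sets_def zero_power)
next
  case False
  with R have R: "R > 0" by simp
  have "{x \<in> space (lebesgue_d d). scale_d d (1/R) x \<in> S \<inter> ball_d d 1} = S \<inter> ball_d d R"
    using R sets.sets_into_space[OF S] by (auto simp: ball_d_def cone norm_scale_d field_simps)
  with emeasure_scale_d_vimage[of "1/R" "S \<inter> ball_d d 1" d] R show ?thesis by simp
qed

lemma emeasure_ball_d:
  assumes d: "d \<ge> 1" and R: "R \<ge> 0"
  shows "emeasure (lebesgue_d d) (ball_d d R) = ennreal (R ^ d) * emeasure (lebesgue_d d) (ball_d d 1)"
proof -
  have "space (lebesgue_d d) \<inter> ball_d d R = ball_d d R" for R by (auto simp: ball_d_def)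
  then show ?thesis using emeasure_cone_ball[OF d sets.top _ R] by simp
qed

text \<open>The superlevel sets of a radially decreasing weight are balls, so by the layer cake formula
  its integral over a cone is proportional to the volume of the unit piece of the cone.\<close>

lemma cone_radial_integral:
  fixes w :: "(nat \<Rightarrow> real) \<Rightarrow> real"
  assumes d: "d \<ge> 1" and S [measurable]: "S \<in> sets (lebesgue_d d)" "T \<in> sets (lebesgue_d d)"
    and coneS: "\<And>x t. x \<in> space (lebesgue_d d) \<Longrightarrow> t > 0 \<Longrightarrow> scale_d d t x \<in> S \<longleftrightarrow> x \<in> S"
    and coneT: "\<And>x t. x \<in> space (lebesgue_d d) \<Longrightarrow> t > 0 \<Longrightarrow> scale_d d t x \<in> T \<longleftrightarrow> x \<in> T"
    and w [measurable]: "w \<in> borel_measurable (lebesgue_d d)" and w0: "\<And>x. w x \<ge> 0"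
    and lev: "\<And>y. y > 0 \<Longrightarrow> \<exists>r\<ge>0. {x \<in> space (lebesgue_d d). y \<le> w x} = ball_d d r
        \<or> {x \<in> space (lebesgue_d d). y \<le> w x} = {}"
  shows "(\<integral>\<^sup>+x. ennreal (w x) * indicator S x \<partial>lebesgue_d d) * emeasure (lebesgue_d d) (T \<inter> ball_d d 1)
    = (\<integral>\<^sup>+x. ennreal (w x) * indicator T x \<partial>lebesgue_d d) * emeasure (lebesgue_d d) (S \<inter> ball_d d 1)"
proof -
  let ?L = "lebesgue_d d"
  interpret L: sigma_finite_measure ?L by (rule sigma_finite_lebesgue_d)
  interpret P: pair_sigma_finite ?L "lborel :: real measure" ..
  have layer: "(\<integral>\<^sup>+x. ennreal (w x) * indicator S x \<partial>?L)
      = (\<integral>\<^sup>+y. indicator {0<..} y * emeasure ?L (S \<inter> {x \<in> space ?L. y \<le> w x}) \<partial>lborel)"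
    if [measurable]: "S \<in> sets ?L" for S
  proof -
    have "(\<integral>\<^sup>+x. ennreal (w x) * indicator S x \<partial>?L)
      = (\<integral>\<^sup>+x. (\<integral>\<^sup>+y. indicator {0<..} y * (indicator S x * (if y \<le> w x then 1 else 0)) \<partial>lborel) \<partial>?L)"
    proof (intro nn_integral_cong)
      fix x
      have "(\<integral>\<^sup>+y. indicator {0<..} y * (indicator S x * (if y \<le> w x then 1 else 0)) \<partial>lborel)
        = (\<integral>\<^sup>+y. indicator S x * indicator {0<..w x} y \<partial>lborel)"
        by (intro nn_integral_cong) (auto simp: indicator_def)
      also have "\<dots> = indicator S x * ennreal (w x)"
        using w0[of x] by (subst nn_integral_cmult) auto
      finally show "ennreal (w x) * indicator S x = (\<integral>\<^sup>+y. indicator {0<..} y * (indicator S x * (if y \<le> w x then 1 else 0)) \<partial>lborel)"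
        by (simp add: mult.commute)
    qed
    also have "\<dots> = (\<integral>\<^sup>+y. (\<integral>\<^sup>+x. indicator {0<..} y * (indicator S x * (if y \<le> w x then 1 else 0)) \<partial>?L) \<partial>lborel)"
      by (rule P.Fubini'[symmetric]) measurable
    also have "\<dots> = (\<integral>\<^sup>+y. indicator {0<..} y * emeasure ?L (S \<inter> {x \<in> space ?L. y \<le> w x}) \<partial>lborel)"
    proof (intro nn_integral_cong)
      fix y :: real
      have "(\<integral>\<^sup>+x. indicator {0<..} y * (indicator S x * (if y \<le> w x then 1 else 0)) \<partial>?L)
         = indicator {0<..} y * (\<integral>\<^sup>+x. (indicator S x * (if y \<le> w x then 1 else 0)) \<partial>?L)"
        by (rule nn_integral_cmult) measurable
      also have "(\<integral>\<^sup>+x. (indicator S x * (if y \<le> w x then 1 else 0)) \<partial>?L)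
         = (\<integral>\<^sup>+x. indicator (S \<inter> {x \<in> space ?L. y \<le> w x}) x \<partial>?L)"
        by (intro nn_integral_cong) (auto simp: indicator_def)
      also have "\<dots> = emeasure ?L (S \<inter> {x \<in> space ?L. y \<le> w x})"
        by (rule nn_integral_indicator) measurable
      finally show "(\<integral>\<^sup>+x. indicator {0<..} y * (indicator S x * (if y \<le> w x then 1 else 0)) \<partial>?L)
        = indicator {0<..} y * emeasure ?L (S \<inter> {x \<in> space ?L. y \<le> w x})" .
    qed
    finally show ?thesis .
  qed
  \<comment> \<open>These sets are the sections of one measurable subset of the product of the line
    with \<open>?L\<close>, so their measure depends measurably on the level.\<close>
  have meas: "(\<lambda>y. emeasure ?L (S \<inter> {x \<in> space ?L. y \<le> w x})) \<in> borel_measurable borel"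
    if [measurable]: "S \<in> sets ?L" for S
  proof -
    have "(\<lambda>y. emeasure ?L (Pair y -` {p \<in> space (borel \<Otimes>\<^sub>M ?L). snd p \<in> S \<and> fst p \<le> w (snd p)}))
        \<in> borel_measurable (borel::real measure)"
      by (rule L.measurable_emeasure_Pair) measurable
    also have "(\<lambda>y. Pair y -` {p \<in> space (borel \<Otimes>\<^sub>M ?L). snd p \<in> S \<and> fst p \<le> w (snd p)})
       = (\<lambda>y. S \<inter> {x \<in> space ?L. y \<le> w x})"
      by (auto simp: space_pair_measure fun_eq_iff)
    finally show ?thesis by (simp add: fun_eq_iff)
  qed
  note [measurable] = meas[OF S(1)] meas[OF S(2)]
  \<comment> \<open>The equality of two ratios is kept in cross-multiplied form, which avoids any
    division in \<open>ennreal\<close>.\<close>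
  have "(\<integral>\<^sup>+x. ennreal (w x) * indicator S x \<partial>?L) * emeasure ?L (T \<inter> ball_d d 1)
     = (\<integral>\<^sup>+y. indicator {0<..} y * emeasure ?L (S \<inter> {x \<in> space ?L. y \<le> w x}) * emeasure ?L (T \<inter> ball_d d 1) \<partial>lborel)"
    unfolding layer[OF S(1)] by (rule nn_integral_multc[symmetric]) measurable
  also have "\<dots> = (\<integral>\<^sup>+y. indicator {0<..} y * emeasure ?L (T \<inter> {x \<in> space ?L. y \<le> w x}) * emeasure ?L (S \<inter> ball_d d 1) \<partial>lborel)"
  proof (intro nn_integral_cong)
    fix y :: real
    show "indicator {0<..} y * emeasure ?L (S \<inter> {x \<in> space ?L. y \<le> w x}) * emeasure ?L (T \<inter> ball_d d 1)
      = indicator {0<..} y * emeasure ?L (T \<inter> {x \<in> space ?L. y \<le> w x}) * emeasure ?L (S \<inter> ball_d d 1)"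
    proof (cases "y > 0")
      case True
      from lev[OF this] obtain r where r: "r \<ge> 0"
        "{x \<in> space ?L. y \<le> w x} = ball_d d r \<or> {x \<in> space ?L. y \<le> w x} = {}" by blast
      \<comment> \<open>The radius of the superlevel ball contributes the same factor r^d to both
        sides.\<close>
      have eq: "emeasure ?L (S \<inter> ball_d d r) * emeasure ?L (T \<inter> ball_d d 1)
        = emeasure ?L (T \<inter> ball_d d r) * emeasure ?L (S \<inter> ball_d d 1)"
      proof -
        have "emeasure ?L (S \<inter> ball_d d r) = ennreal (r ^ d) * emeasure ?L (S \<inter> ball_d d 1)"
          by (rule emeasure_cone_ball[OF d S(1) _ r(1)]) (rule coneS)
        moreover have "emeasure ?L (T \<inter> ball_d d r) = ennreal (r ^ d) * emeasure ?L (T \<inter> ball_d d 1)"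
          by (rule emeasure_cone_ball[OF d S(2) _ r(1)]) (rule coneT)
        ultimately show ?thesis by (simp only: mult_ac)
      qed
      from r(2) show ?thesis
      proof
        assume ball: "{x \<in> space ?L. y \<le> w x} = ball_d d r"
        show ?thesis unfolding ball mult.assoc eq ..
      next
        assume empty: "{x \<in> space ?L. y \<le> w x} = {}"
        show ?thesis unfolding empty by simp
      qed
    qed simp
  qed
  also have "\<dots> = (\<integral>\<^sup>+x. ennreal (w x) * indicator T x \<partial>?L) * emeasure ?L (S \<inter> ball_d d 1)"
    unfolding layer[OF S(2)] by (rule nn_integral_multc) measurable
  finally show ?thesis .
qed

section \<open>Sphere measure and small ball probabilities\<close>

text \<open>The untruncated cone over A. Unlike \<open>cone_d\<close> it is invariant under every
  dilation, as \<open>cone_radial_integral\<close> requires, and it turns set operations on the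
  sphere into set operations in space.\<close>

definition dir_cone :: "nat \<Rightarrow> (nat \<Rightarrow> real) set \<Rightarrow> (nat \<Rightarrow> real) set" where
  "dir_cone d A = {x \<in> space (lebesgue_d d). norm_d d x > 0 \<and> scale_d d (1 / norm_d d x) x \<in> A}"

lemma dir_cone_scale:
  assumes "x \<in> space (lebesgue_d d)" "t > 0"
  shows "scale_d d t x \<in> dir_cone d A \<longleftrightarrow> x \<in> dir_cone d A"
  using assms by (auto simp: dir_cone_def norm_scale_d scale_d_scale_d zero_less_mult_iff)

lemma cone_d_eq_dir_cone:
  assumes A: "A \<subseteq> sphere_d d"
  shows "cone_d d A = dir_cone d A \<inter> ball_d d 1"
proof (intro equalityI subsetI)
  fix y assume "y \<in> cone_d d A"
  then obtain t x where y: "y = scale_d d t x" "0 < t" "t \<le> 1" "x \<in> A"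
    by (auto simp: cone_d_def scale_d_def)
  with A have x: "x \<in> space (lebesgue_d d)" "norm_d d x = 1" by (auto simp: sphere_d_def)
  show "y \<in> dir_cone d A \<inter> ball_d d 1"
    using y x by (auto simp: dir_cone_def ball_d_def norm_scale_d scale_d_scale_d scale_d_1)
next
  fix y assume "y \<in> dir_cone d A \<inter> ball_d d 1"
  then have y: "y \<in> space (lebesgue_d d)" "norm_d d y > 0" "norm_d d y \<le> 1"
    "scale_d d (1 / norm_d d y) y \<in> A" by (auto simp: dir_cone_def ball_d_def)
  then have "y = scale_d d (norm_d d y) (scale_d d (1 / norm_d d y) y)"
    by (simp add: scale_d_scale_d scale_d_1)
  with y show "y \<in> cone_d d A"
    unfolding cone_d_def scale_d_def[symmetric] by blast
qed

text \<open>A nonzero point lies in the full cone iff its normalization lies in the truncated one,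
  and normalization is measurable away from the origin.\<close>

lemma sets_dir_cone:
  assumes A: "A \<subseteq> sphere_d d" and m: "cone_d d A \<in> sets (lebesgue_d d)"
  shows "dir_cone d A \<in> sets (lebesgue_d d)"
proof -
  have "dir_cone d A = {x \<in> space (lebesgue_d d). norm_d d x > 0 \<and> scale_d d (1 / norm_d d x) x \<in> cone_d d A}"
    unfolding cone_d_eq_dir_cone[OF A]
    by (auto simp: dir_cone_def ball_d_def norm_scale_d scale_d_scale_d)
  also have "\<dots> \<in> sets (lebesgue_d d)"
    using m by measurable
  finally show ?thesis .
qed

text \<open>The ball lies between the cubes [0, 1/d]^d and [-1, 1]^d. Both bounds are what makes the
  quotient defining \<open>sphere_measure\<close> a genuine normalization.\<close>

lemma emeasure_unit_ball_bounds:
  assumes d: "d \<ge> 1"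
  shows "emeasure (lebesgue_d d) (ball_d d 1) > 0" "emeasure (lebesgue_d d) (ball_d d 1) < \<infinity>"
proof -
  have [measurable]: "Pi\<^sub>E {..<d} (\<lambda>_. {0..1 / real d}) \<in> sets (lebesgue_d d)"
    unfolding lebesgue_d_def by (intro sets_PiM_I_finite) auto
  have [measurable]: "Pi\<^sub>E {..<d} (\<lambda>_. {-1..1::real}) \<in> sets (lebesgue_d d)"
    unfolding lebesgue_d_def by (intro sets_PiM_I_finite) auto
  have "Pi\<^sub>E {..<d} (\<lambda>_. {0..1 / real d}) \<subseteq> ball_d d 1"
  proof
    fix x assume x: "x \<in> Pi\<^sub>E {..<d} (\<lambda>_. {0..1 / real d})"
    have "norm_d d x \<le> (\<Sum>i<d. \<bar>x i\<bar>)" unfolding norm_d_L2_set by (rule L2_set_le_sum_abs)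
    also have "\<dots> \<le> (\<Sum>i<d. 1 / real d)"
      by (rule sum_mono) (use x in \<open>auto simp: PiE_def Pi_def\<close>)
    also have "\<dots> = 1" using d by simp
    finally show "x \<in> ball_d d 1" using x by (auto simp: ball_d_def space_lebesgue_d)
  qed
  then have "emeasure (lebesgue_d d) (Pi\<^sub>E {..<d} (\<lambda>_. {0..1 / real d})) \<le> emeasure (lebesgue_d d) (ball_d d 1)"
    by (rule emeasure_mono) measurable
  moreover have "emeasure (lebesgue_d d) (Pi\<^sub>E {..<d} (\<lambda>_. {0..1 / real d})) > 0"
    using d by (subst emeasure_lebesgue_d_box) (auto simp: ennreal_power)
  ultimately show "emeasure (lebesgue_d d) (ball_d d 1) > 0" by simp
  have "ball_d d 1 \<subseteq> Pi\<^sub>E {..<d} (\<lambda>_. {-1..1::real})"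
  proof
    fix x assume x: "x \<in> ball_d d 1"
    have "\<bar>x i\<bar> \<le> 1" if "i < d" for i
    proof -
      have "\<bar>x i\<bar> \<le> L2_set x {..<d}"
        using member_le_L2_set[of "{..<d}" i "\<lambda>i. \<bar>x i\<bar>"] that by (simp add: L2_set_def)
      also have "\<dots> \<le> 1" using x by (simp add: ball_d_def norm_d_L2_set)
      finally show ?thesis .
    qed
    with x show "x \<in> Pi\<^sub>E {..<d} (\<lambda>_. {-1..1::real})"
      by (auto simp: ball_d_def space_lebesgue_d PiE_def Pi_def abs_le_iff minus_le_iff)
  qed
  then have "emeasure (lebesgue_d d) (ball_d d 1) \<le> emeasure (lebesgue_d d) (Pi\<^sub>E {..<d} (\<lambda>_. {-1..1::real}))"
    by (rule emeasure_mono) measurable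
  also have "\<dots> < \<infinity>"
    by (subst emeasure_lebesgue_d_box) (auto simp: ennreal_power[symmetric] ennreal_prod_eq_top power_less_top_ennreal)
  finally show "emeasure (lebesgue_d d) (ball_d d 1) < \<infinity>" .
qed

lemma cone_sphere:
  shows "dir_cone d (sphere_d d) = {x \<in> space (lebesgue_d d). norm_d d x > 0}"
  by (auto simp: dir_cone_def sphere_d_def norm_scale_d)

lemma emeasure_cone_sphere:
  assumes d: "d \<ge> 1"
  shows "emeasure (lebesgue_d d) (cone_d d (sphere_d d)) = emeasure (lebesgue_d d) (ball_d d 1)"
proof (rule emeasure_eq_AE)
  have "AE x in lebesgue_d d. norm_d d x \<noteq> 0"
    using AE_not_in[OF null_origin[OF d]] by (rule AE_mp) (intro AE_I2, auto)
  then show "AE x in lebesgue_d d. (x \<in> cone_d d (sphere_d d)) = (x \<in> ball_d d 1)"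
    unfolding cone_d_eq_dir_cone[OF subset_refl] cone_sphere
    by eventually_elim (use norm_d_nonneg[of d] in \<open>auto simp: ball_d_def less_le\<close>)
qed (auto simp: cone_d_eq_dir_cone[OF subset_refl] cone_sphere)

section \<open>The sphere as a probability space\<close>

definition sphere_sets :: "nat \<Rightarrow> (nat \<Rightarrow> real) set set" where
  "sphere_sets d = {A. A \<subseteq> sphere_d d \<and> cone_d d A \<in> sets (lebesgue_d d)}"

lemma sphere_setsI:
  assumes "A \<subseteq> sphere_d d" "dir_cone d A \<in> sets (lebesgue_d d)"
  shows "A \<in> sphere_sets d"
  using assms by (auto simp: sphere_sets_def cone_d_eq_dir_cone)

lemma sphere_setsD:
  assumes "A \<in> sphere_sets d"
  shows "A \<subseteq> sphere_d d" "dir_cone d A \<in> sets (lebesgue_d d)"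
  using assms by (auto simp: sphere_sets_def sets_dir_cone)

text \<open>Ensures that \<open>measure_of\<close> adds no sets to the family in the definition of
  \<open>sphere_measure\<close>, so that every measurable set comes with a measurable cone.\<close>

lemma sigma_algebra_sphere_sets: "sigma_algebra (sphere_d d) (sphere_sets d)"
proof (rule sigma_algebra_iff2[THEN iffD2], intro conjI ballI allI impI)
  show "sphere_sets d \<subseteq> Pow (sphere_d d)" by (auto simp: sphere_sets_def)
  show "{} \<in> sphere_sets d" by (rule sphere_setsI) (auto simp: dir_cone_def)
next
  fix A assume A: "A \<in> sphere_sets d"
  have "dir_cone d (sphere_d d - A) = dir_cone d (sphere_d d) - dir_cone d A"
    by (auto simp: dir_cone_def)
  moreover have "dir_cone d (sphere_d d) \<in> sets (lebesgue_d d)"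
    unfolding cone_sphere by measurable
  ultimately show "sphere_d d - A \<in> sphere_sets d"
    using sphere_setsD[OF A] by (intro sphere_setsI) auto
next
  fix A :: "nat \<Rightarrow> (nat \<Rightarrow> real) set" assume A: "range A \<subseteq> sphere_sets d"
  have "dir_cone d (\<Union>i. A i) = (\<Union>i. dir_cone d (A i))"
    by (auto simp: dir_cone_def)
  moreover have "A i \<in> sphere_sets d" for i using A by auto
  note sphere_setsD[OF this]
  ultimately show "(\<Union>i. A i) \<in> sphere_sets d"
    by (intro sphere_setsI) auto
qed

lemma space_sphere_measure [simp]: "space (sphere_measure d) = sphere_d d"
  and sets_sphere_measure: "sets (sphere_measure d) = sphere_sets d"
proof -
  interpret sigma_algebra "sphere_d d" "sphere_sets d" by (rule sigma_algebra_sphere_sets)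
  have "sphere_sets d \<subseteq> Pow (sphere_d d)" by (auto simp: sphere_sets_def)
  then show "space (sphere_measure d) = sphere_d d" "sets (sphere_measure d) = sphere_sets d"
    unfolding sphere_measure_def sphere_sets_def[symmetric]
    by (auto simp: space_measure_of_conv sets_measure_of sigma_sets_eq)
qed

text \<open>\<open>measure_of\<close> falls back to the zero measure unless the given set function
  is countably additive. Additivity is inherited from Lebesgue measure because disjoint sets of
  directions span disjoint cones.\<close>

lemma emeasure_sphere_measure:
  assumes A: "A \<in> sphere_sets d"
  shows "emeasure (sphere_measure d) A
    = emeasure (lebesgue_d d) (cone_d d A) / emeasure (lebesgue_d d) (cone_d d (sphere_d d))"
proof (rule emeasure_measure_of[OF sphere_measure_def])
  show "{A. A \<subseteq> sphere_d d \<and> cone_d d A \<in> sets (lebesgue_d d)} \<subseteq> Pow (sphere_d d)" by auto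
  show "A \<in> sets (sphere_measure d)" using A by (simp add: sets_sphere_measure)
  show "positive (sets (sphere_measure d))
     (\<lambda>A. emeasure (lebesgue_d d) (cone_d d A) / emeasure (lebesgue_d d) (cone_d d (sphere_d d)))"
    by (auto simp: positive_def cone_d_def)
  show "countably_additive (sets (sphere_measure d))
     (\<lambda>A. emeasure (lebesgue_d d) (cone_d d A) / emeasure (lebesgue_d d) (cone_d d (sphere_d d)))"
  proof (rule countably_additiveI)
    fix A :: "nat \<Rightarrow> (nat \<Rightarrow> real) set"
    assume A: "range A \<subseteq> sets (sphere_measure d)" "disjoint_family A" "(\<Union>i. A i) \<in> sets (sphere_measure d)"
    then have "A i \<in> sphere_sets d" for i by (auto simp: sets_sphere_measure)
    note A' = sphere_setsD[OF this]
    have "(\<Sum>i. emeasure (lebesgue_d d) (cone_d d (A i))) = emeasure (lebesgue_d d) (\<Union>i. cone_d d (A i))"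
    proof (rule suminf_emeasure)
      show "disjoint_family (\<lambda>i. cone_d d (A i))"
        using A(2) A' unfolding disjoint_family_on_def cone_d_eq_dir_cone[OF A'(1)]
        by (auto simp: dir_cone_def)
    qed (use A' in \<open>auto simp: cone_d_eq_dir_cone\<close>)
    also have "(\<Union>i. cone_d d (A i)) = cone_d d (\<Union>i. A i)"
      by (auto simp: cone_d_def)
    finally show "(\<Sum>i. emeasure (lebesgue_d d) (cone_d d (A i)) / emeasure (lebesgue_d d) (cone_d d (sphere_d d)))
        = emeasure (lebesgue_d d) (cone_d d (\<Union>i. A i)) / emeasure (lebesgue_d d) (cone_d d (sphere_d d))"
      by (simp add: ennreal_suminf_divide)
  qed
qed

lemma prob_space_sphere_measure:
  assumes d: "d \<ge> 1"
  shows "prob_space (sphere_measure d)"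
proof
  have "sphere_d d \<in> sphere_sets d"
    using sets.top[of "sphere_measure d"] by (simp add: sets_sphere_measure)
  then show "emeasure (sphere_measure d) (space (sphere_measure d)) = 1"
    using emeasure_unit_ball_bounds[OF d]
    by (simp add: emeasure_sphere_measure emeasure_cone_sphere[OF d] ennreal_divide_self)
qed

text \<open>Every Borel set of coordinates meets the sphere in a measurable set, so functions of the
  coordinates can be integrated against \<open>sphere_measure\<close>.\<close>

lemma measurable_id_sphere:
  "(\<lambda>x. x) \<in> measurable (sphere_measure d) (PiM {..<d} (\<lambda>_. borel))"
proof (rule measurableI)
  fix x assume "x \<in> space (sphere_measure d)"
  then show "x \<in> space (PiM {..<d} (\<lambda>_. borel))"
    by (auto simp: sphere_d_def space_lebesgue_d space_PiM)
next
  fix B assume B [measurable]: "B \<in> sets (PiM {..<d} (\<lambda>_. borel :: real measure))"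
  have "dir_cone d (B \<inter> sphere_d d) = {x \<in> space (lebesgue_d d). norm_d d x > 0 \<and> scale_d d (1 / norm_d d x) x \<in> B}"
    by (auto simp: dir_cone_def sphere_d_def norm_scale_d)
  also have "\<dots> \<in> sets (lebesgue_d d)" by measurable
  finally show "(\<lambda>x. x) -` B \<inter> space (sphere_measure d) \<in> sets (sphere_measure d)"
    by (auto simp: sets_sphere_measure intro: sphere_setsI)
qed

section \<open>Comparison with the standard Gaussian\<close>

definition gauss_d :: "nat \<Rightarrow> (nat \<Rightarrow> real) measure" where
  "gauss_d d = PiM {..<d} (\<lambda>_. density lborel (\<lambda>x. ennreal (std_normal_density x)))"

definition gauss_density_d :: "nat \<Rightarrow> (nat \<Rightarrow> real) \<Rightarrow> real" where
  "gauss_density_d d x = (\<Prod>i<d. std_normal_density (x i))"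

lemma prob_std_normal: "prob_space (density lborel (\<lambda>x. ennreal (std_normal_density x)))"
  by (rule prob_space_normal_density) simp

lemma gauss_d_density: "gauss_d d = density (lebesgue_d d) (\<lambda>x. ennreal (gauss_density_d d x))"
  unfolding gauss_d_def gauss_density_d_def
  by (subst density_lebesgue_d[symmetric]) (auto intro: prob_std_normal simp: prod_ennreal)

lemma sets_gauss_d [measurable_cong]: "sets (gauss_d d) = sets (PiM {..<d} (\<lambda>_. borel))"
  by (simp add: gauss_d_density sets_lebesgue_d)

lemma space_gauss_d: "space (gauss_d d) = space (lebesgue_d d)"
  by (simp add: gauss_d_density)

lemma prob_space_gauss_d: "prob_space (gauss_d d)"
  unfolding gauss_d_def by (rule prob_space_PiM) (rule prob_std_normal)

lemma gauss_density_d_eq: "gauss_density_d d x = (1 / sqrt (2 * pi)) ^ d * exp (- (norm_d d x)\<^sup>2 / 2)"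
proof -
  have "gauss_density_d d x = (1 / sqrt (2 * pi)) ^ d * (\<Prod>i<d. exp (- (x i)\<^sup>2 / 2))"
    unfolding gauss_density_d_def std_normal_density_def prod.distrib by simp
  also have "(\<Prod>i<d. exp (- (x i)\<^sup>2 / 2)) = exp (\<Sum>i<d. - (x i)\<^sup>2 / 2)"
    by (simp add: exp_sum)
  also have "(\<Sum>i<d. - (x i)\<^sup>2 / 2) = - (norm_d d x)\<^sup>2 / 2"
    by (simp add: norm_d_power2 sum_negf sum_divide_distrib)
  finally show ?thesis .
qed

lemma measurable_gauss_density_d [measurable]: "gauss_density_d d \<in> borel_measurable (lebesgue_d d)"
  unfolding gauss_density_d_eq by measurable

lemma distributed_component_gauss:
  assumes i: "i < d"
  shows "distributed (gauss_d d) lborel (\<lambda>x. x i) std_normal_density"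
  unfolding distributed_def
proof (intro conjI)
  have "distr (gauss_d d) (density lborel (\<lambda>x. ennreal (std_normal_density x))) (\<lambda>x. x i) = (density lborel (\<lambda>x. ennreal (std_normal_density x)))"
    unfolding gauss_d_def using i by (intro distr_PiM_component prob_std_normal) auto
  moreover have "distr (gauss_d d) lborel (\<lambda>x. x i) = distr (gauss_d d) (density lborel (\<lambda>x. ennreal (std_normal_density x))) (\<lambda>x. x i)"
    by (rule distr_cong) auto
  ultimately show "distr (gauss_d d) lborel (\<lambda>x. x i) = (density lborel (\<lambda>x. ennreal (std_normal_density x)))" by simp
  show "(\<lambda>x. x i) \<in> measurable (gauss_d d) lborel"
    using i unfolding measurable_cong_sets[OF sets_gauss_d sets_lborel]
    by (intro measurable_component_singleton) simp
qed auto

text \<open>The form in which rotation invariance is used: a sum of independent centred normals is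
  normal, and the variances add up to the squared norm of \<theta>, which is 1.\<close>

lemma distributed_inner_gauss:
  assumes \<theta>: "norm_d d \<theta> = 1"
  shows "distributed (gauss_d d) lborel (\<lambda>x. inner_d d \<theta> x) std_normal_density"
proof -
  interpret prob_space "gauss_d d" by (rule prob_space_gauss_d)
  let ?N = "density lborel (\<lambda>x. ennreal (std_normal_density x))"
  \<comment> \<open>Vanishing coefficients are dropped because \<open>sum_indep_normal\<close> asks
    for positive standard deviations.\<close>
  define I where "I = {i \<in> {..<d}. \<theta> i \<noteq> 0}"
  have fin: "finite I" by (simp add: I_def)
  have ss: "(\<Sum>i\<in>I. (\<theta> i)\<^sup>2) = 1"
  proof -
    have "(\<Sum>i\<in>I. (\<theta> i)\<^sup>2) = (\<Sum>i<d. (\<theta> i)\<^sup>2)"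
      by (rule sum.mono_neutral_left) (auto simp: I_def)
    then show ?thesis using norm_d_power2[of d \<theta>] \<theta> by simp
  qed
  then have ne: "I \<noteq> {}" by auto
  note comp = distributed_component_gauss
  have indep0: "indep_vars (\<lambda>i. borel) (\<lambda>i x. x i) I"
  proof (subst indep_vars_iff_distr_eq_PiM'[OF ne])
    have "distr (gauss_d d) (PiM I (\<lambda>_. borel)) (\<lambda>x. \<lambda>i\<in>I. x i) = distr (gauss_d d) (PiM I (\<lambda>_. ?N)) (\<lambda>x. restrict x I)"
      by (intro distr_cong sets_PiM_cong) auto
    also have "\<dots> = PiM I (\<lambda>_. ?N)"
      unfolding gauss_d_def
      by (rule product_prob_space.distr_PiM_restrict_finite)
         (auto simp: I_def prob_std_normal intro: product_prob_spaceI)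
    also have "\<dots> = PiM I (\<lambda>i. distr (gauss_d d) borel (\<lambda>x. x i))"
    proof (rule PiM_cong)
      fix i assume "i \<in> I"
      then show "?N = distr (gauss_d d) borel (\<lambda>x. x i)"
        using comp[of i] by (auto simp: I_def distributed_def cong: distr_cong)
    qed simp
    finally show "distr (gauss_d d) (PiM I (\<lambda>_. borel)) (\<lambda>x. \<lambda>i\<in>I. x i) = PiM I (\<lambda>i. distr (gauss_d d) borel (\<lambda>x. x i))" .
  qed (use comp in \<open>auto simp: I_def distributed_def\<close>)
  have indep: "indep_vars (\<lambda>i. borel) (\<lambda>i x. \<theta> i * x i) I"
    by (rule indep_vars_compose2[OF indep0]) auto
  have "distributed (gauss_d d) lborel (\<lambda>x. \<Sum>i\<in>I. \<theta> i * x i)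
      (normal_density (\<Sum>i\<in>I. 0) (sqrt (\<Sum>i\<in>I. \<bar>\<theta> i\<bar>\<^sup>2)))"
  proof (rule sum_indep_normal[OF fin ne indep])
    fix i assume i: "i \<in> I"
    show "0 < \<bar>\<theta> i\<bar>" using i by (simp add: I_def)
    show "distributed (gauss_d d) lborel (\<lambda>x. \<theta> i * x i) (normal_density 0 \<bar>\<theta> i\<bar>)"
      using normal_density_affine[OF comp[of i], of "\<theta> i" 0] i by (simp add: I_def)
  qed
  moreover have "inner_d d \<theta> x = (\<Sum>i\<in>I. \<theta> i * x i)" for x
    unfolding inner_d_def by (rule sum.mono_neutral_right) (auto simp: I_def)
  ultimately show ?thesis using ss by simp
qed

lemma gauss_slab:
  assumes \<theta>: "norm_d d \<theta> = 1" and z: "z \<ge> 0"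
  shows "emeasure (gauss_d d) {x \<in> space (gauss_d d). \<bar>inner_d d \<theta> x\<bar> \<le> z} \<le> ennreal (2 * z / sqrt (2 * pi))"
proof -
  have "{x \<in> space (gauss_d d). \<bar>inner_d d \<theta> x\<bar> \<le> z} = (\<lambda>x. inner_d d \<theta> x) -` {-z..z} \<inter> space (gauss_d d)"
    by auto
  then have "emeasure (gauss_d d) {x \<in> space (gauss_d d). \<bar>inner_d d \<theta> x\<bar> \<le> z}
      = (\<integral>\<^sup>+x. ennreal (std_normal_density x) * indicator {-z..z} x \<partial>lborel)"
    using distributed_emeasure[OF distributed_inner_gauss[OF \<theta>], of "{-z..z}"] by simp
  also have "\<dots> \<le> (\<integral>\<^sup>+x. ennreal (1 / sqrt (2 * pi)) * indicator {-z..z} x \<partial>lborel)"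
    by (intro nn_integral_mono mult_right_mono ennreal_leI)
       (auto simp: std_normal_density_def divide_right_mono)
  also have "\<dots> = ennreal (2 * z / sqrt (2 * pi))"
    using z by (subst nn_integral_cmult_indicator) (auto simp: ennreal_mult[symmetric])
  finally show ?thesis .
qed

text \<open>Markov's inequality for the squared norm, whose mean is d: exceeding 3 d has probability
  at most 1/3.\<close>

lemma gauss_ball:
  assumes d: "d \<ge> 1"
  shows "emeasure (gauss_d d) (ball_d d (sqrt (3 * real d))) \<ge> ennreal (2/3)"
proof -
  interpret prob_space "gauss_d d" by (rule prob_space_gauss_d)
  have one: "(\<integral>\<^sup>+x. ennreal ((x i)\<^sup>2) \<partial>gauss_d d) = 1" if "i < d" for i
  proof -
    have "(\<integral>\<^sup>+x. ennreal ((x i)\<^sup>2) \<partial>gauss_d d) = (\<integral>\<^sup>+x. ennreal (std_normal_density x) * ennreal (x\<^sup>2) \<partial>lborel)"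
      by (rule distributed_nn_integral[OF distributed_component_gauss[OF that], symmetric]) simp
    also have "\<dots> = (\<integral>\<^sup>+x. ennreal (std_normal_density x * x\<^sup>2) \<partial>lborel)"
      by (simp add: ennreal_mult)
    also have "\<dots> = ennreal 1"
      using std_normal_moment_even[of 1]
      by (intro nn_integral_eq_integral[THEN trans]) (auto simp: has_bochner_integral_iff fact_numeral numeral_2_eq_2)
    finally show ?thesis by simp
  qed
  have "(\<integral>\<^sup>+x. ennreal ((norm_d d x)\<^sup>2) \<partial>gauss_d d) = (\<integral>\<^sup>+x. (\<Sum>i<d. ennreal ((x i)\<^sup>2)) \<partial>gauss_d d)"
    by (simp add: norm_d_power2)
  also have "\<dots> = (\<Sum>i<d. \<integral>\<^sup>+x. ennreal ((x i)\<^sup>2) \<partial>gauss_d d)"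
    by (rule nn_integral_sum) (auto intro: measurable_component_borel)
  also have "\<dots> = ennreal (real d)" using one by (simp add: ennreal_of_nat_eq_real_of_nat)
  finally have E: "(\<integral>\<^sup>+x. ennreal ((norm_d d x)\<^sup>2) \<partial>gauss_d d) = ennreal (real d)" .
  let ?B = "ball_d d (sqrt (3 * real d))"
  have B: "?B \<in> events" by (simp add: sets_gauss_d sets_lebesgue_d[symmetric])
  have "emeasure (gauss_d d) (space (gauss_d d) - ?B)
      \<le> emeasure (gauss_d d) {x \<in> space (gauss_d d). 1 \<le> ennreal (1 / (3 * real d)) * ennreal ((norm_d d x)\<^sup>2)}"
  proof (rule emeasure_mono)
    show "space (gauss_d d) - ?B \<subseteq> {x \<in> space (gauss_d d). 1 \<le> ennreal (1 / (3 * real d)) * ennreal ((norm_d d x)\<^sup>2)}"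
    proof safe
      fix x assume x: "x \<in> space (gauss_d d)" "x \<notin> ?B"
      then have "sqrt (3 * real d) \<le> norm_d d x" by (simp add: ball_d_def space_gauss_d)
      then have "3 * real d \<le> (norm_d d x)\<^sup>2" using power_mono[of "sqrt (3 * real d)" "norm_d d x" 2] by simp
      then show "1 \<le> ennreal (1 / (3 * real d)) * ennreal ((norm_d d x)\<^sup>2)"
        using d by (simp add: ennreal_mult[symmetric] ennreal_1[symmetric] field_simps del: ennreal_1)
    qed
  qed measurable
  also have "\<dots> \<le> ennreal (1 / (3 * real d)) * (\<integral>\<^sup>+x. ennreal ((norm_d d x)\<^sup>2) * indicator (space (gauss_d d)) x \<partial>gauss_d d)"
    by (rule order_trans[OF _ nn_integral_Markov_inequality]) (auto simp: Int_def)
  also have "(\<integral>\<^sup>+x. ennreal ((norm_d d x)\<^sup>2) * indicator (space (gauss_d d)) x \<partial>gauss_d d) = ennreal (real d)"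
    unfolding E[symmetric] by (rule nn_integral_cong) simp
  also have "ennreal (1 / (3 * real d)) * ennreal (real d) = ennreal (1/3)"
    using d by (simp add: ennreal_mult[symmetric])
  finally have "prob (space (gauss_d d) - ?B) \<le> 1/3" by (simp add: emeasure_eq_measure)
  with prob_compl[OF B] have "2/3 \<le> prob ?B" by simp
  then show ?thesis by (simp add: emeasure_eq_measure)
qed

text \<open>Under a radially decreasing weight, the cone over a set of directions carries a share of
  the mass equal to the sphere measure of that set. The Gaussian truncated at radius R has mass at
  least 2/3, and there the cone over A lies in a slab of half-width t R, so a quotient of two
  Gaussian masses bounds the probability.\<close>

lemma sphere_small_ball_unit:
  assumes d: "d \<ge> 1" and \<theta>: "norm_d d \<theta> = 1" and t: "t \<ge> 0"
  shows "emeasure (sphere_measure d) {\<phi> \<in> sphere_d d. \<bar>inner_d d \<theta> \<phi>\<bar> \<le> t} \<le> ennreal ((52/25) * sqrt (real d) * t)"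
proof -
  interpret G: prob_space "gauss_d d" by (rule prob_space_gauss_d)
  interpret Sp: prob_space "sphere_measure d" by (rule prob_space_sphere_measure[OF d])
  let ?L = "lebesgue_d d"
  define A where "A = {\<phi> \<in> sphere_d d. \<bar>inner_d d \<theta> \<phi>\<bar> \<le> t}"
  define R where "R = sqrt (3 * real d)"
  \<comment> \<open>Truncation takes the place of independence of norm and direction: w is still
    radially decreasing, and on its support |<\<theta>, x>| \<le> t |x| implies |<\<theta>, x>|
    \<le> t R.\<close>
  define w where "w x = gauss_density_d d x * indicator (ball_d d R) x" for x
  define c where "c = (1 / sqrt (2 * pi)) ^ d"
  have c: "c > 0" by (simp add: c_def)
  have R: "R > 0" using d by (simp add: R_def)
  have sub: "A \<subseteq> sphere_d d" by (auto simp: A_def)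
  have S: "dir_cone d A = {x \<in> space ?L. norm_d d x > 0 \<and> \<bar>inner_d d \<theta> x\<bar> \<le> t * norm_d d x}"
    by (auto simp: dir_cone_def A_def sphere_d_def norm_scale_d inner_scale_d_right abs_mult field_simps)
  have T: "dir_cone d (sphere_d d) = {x \<in> space ?L. norm_d d x > 0}" by (rule cone_sphere)
  have "{x \<in> space ?L. norm_d d x > 0} \<inter> {x \<in> space ?L. \<bar>inner_d d \<theta> x\<bar> \<le> t * norm_d d x} \<in> sets ?L"
    by measurable
  also have "{x \<in> space ?L. norm_d d x > 0} \<inter> {x \<in> space ?L. \<bar>inner_d d \<theta> x\<bar> \<le> t * norm_d d x} = dir_cone d A"
    unfolding S by auto
  finally have Sm [measurable]: "dir_cone d A \<in> sets ?L" .
  have Tm [measurable]: "dir_cone d (sphere_d d) \<in> sets ?L" unfolding T by measurable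
  have A: "A \<in> sphere_sets d" by (rule sphere_setsI[OF sub Sm])
  have wm [measurable]: "w \<in> borel_measurable ?L" unfolding w_def by measurable
  \<comment> \<open>The peak value of w is c. Up to c the superlevel set is the ball of radius min R
    q, where q solves c exp (- q^2 / 2) = y; above c it is empty.\<close>
  have lev: "\<exists>r\<ge>0. {x \<in> space ?L. y \<le> w x} = ball_d d r \<or> {x \<in> space ?L. y \<le> w x} = {}" if y: "y > 0" for y
  proof (cases "y \<le> c")
    case True
    define q where "q = sqrt (2 * ln (c / y))"
    have pos: "ln (c / y) \<ge> 0" using True y c by simp
    have "y \<le> w x \<longleftrightarrow> norm_d d x \<le> min R q" if x: "x \<in> space ?L" for x
    proof (cases "norm_d d x \<le> R")
      case nR: True
      have "y \<le> w x \<longleftrightarrow> y \<le> c * exp (- (norm_d d x)\<^sup>2 / 2)"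
        using nR x by (simp add: w_def ball_d_def gauss_density_d_eq c_def)
      also have "\<dots> \<longleftrightarrow> exp ((norm_d d x)\<^sup>2 / 2) \<le> c / y"
        using y by (simp add: exp_minus field_simps)
      also have "\<dots> \<longleftrightarrow> (norm_d d x)\<^sup>2 / 2 \<le> ln (c / y)"
        using y c by (subst ln_ge_iff[symmetric]) auto
      also have "\<dots> \<longleftrightarrow> norm_d d x \<le> q"
        using real_sqrt_le_iff[of "(norm_d d x)\<^sup>2" "2 * ln (c / y)"] unfolding q_def by auto
      finally show ?thesis using nR by simp
    next
      case False
      then show ?thesis using x y by (simp add: w_def ball_d_def)
    qed
    then have "{x \<in> space ?L. y \<le> w x} = ball_d d (min R q)" by (auto simp: ball_d_def)
    moreover have "min R q \<ge> 0" using R pos by (simp add: q_def)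
    ultimately show ?thesis by blast
  next
    case False
    have "w x < y" for x
    proof -
      have "w x \<le> c * 1"
        unfolding w_def gauss_density_d_eq c_def[symmetric]
        using c by (auto simp: indicator_def)
      then show ?thesis using False by simp
    qed
    then have "{x \<in> space ?L. y \<le> w x} = {}" by (auto simp: not_le)
    then show ?thesis by blast
  qed
  have int: "(\<integral>\<^sup>+x. ennreal (w x) * indicator S x \<partial>?L) = emeasure (gauss_d d) (S \<inter> ball_d d R)"
    if [measurable]: "S \<in> sets ?L" for S
    unfolding gauss_d_density w_def
    by (subst emeasure_density) (auto intro!: nn_integral_cong simp: indicator_def)
  have "emeasure (gauss_d d) (dir_cone d A \<inter> ball_d d R) * emeasure ?L (dir_cone d (sphere_d d) \<inter> ball_d d 1)
    = emeasure (gauss_d d) (dir_cone d (sphere_d d) \<inter> ball_d d R) * emeasure ?L (dir_cone d A \<inter> ball_d d 1)"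
    unfolding int[OF Sm, symmetric] int[OF Tm, symmetric]
  proof (rule cone_radial_integral[OF d Sm Tm _ _ wm])
    show "0 \<le> w x" for x by (simp add: w_def gauss_density_d_eq)
  qed (use lev in \<open>auto simp: dir_cone_scale\<close>)
  then have proportional: "emeasure (gauss_d d) (dir_cone d A \<inter> ball_d d R) * emeasure ?L (ball_d d 1)
    = emeasure (gauss_d d) (dir_cone d (sphere_d d) \<inter> ball_d d R) * emeasure ?L (cone_d d A)"
    unfolding cone_d_eq_dir_cone[OF sub, symmetric] cone_d_eq_dir_cone[OF subset_refl, symmetric]
      emeasure_cone_sphere[OF d] .
  have "emeasure (gauss_d d) (dir_cone d A \<inter> ball_d d R)
    = emeasure (gauss_d d) (dir_cone d A \<inter> ball_d d R) * emeasure ?L (ball_d d 1) / emeasure ?L (ball_d d 1)"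
    using emeasure_unit_ball_bounds[OF d] by (intro ennreal_mult_divide_eq[symmetric]) auto
  then have "emeasure (gauss_d d) (dir_cone d A \<inter> ball_d d R)
    = emeasure (gauss_d d) (dir_cone d (sphere_d d) \<inter> ball_d d R) * emeasure (sphere_measure d) A"
    unfolding emeasure_sphere_measure[OF A] emeasure_cone_sphere[OF d] proportional
    by (simp add: ennreal_times_divide)
  moreover have large: "ennreal (2/3) \<le> emeasure (gauss_d d) (dir_cone d (sphere_d d) \<inter> ball_d d R)"
  proof -
    have "AE x in ?L. norm_d d x \<noteq> 0"
      using AE_not_in[OF null_origin[OF d]] by (rule AE_mp) (intro AE_I2, auto)
    then have "AE x in gauss_d d. norm_d d x \<noteq> 0"
      unfolding gauss_d_density by (subst AE_density) auto
    then have "AE x in gauss_d d. (x \<in> ball_d d R) = (x \<in> dir_cone d (sphere_d d) \<inter> ball_d d R)"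
      unfolding T by eventually_elim (use norm_d_nonneg[of d] in \<open>auto simp: ball_d_def less_le\<close>)
    then have "emeasure (gauss_d d) (ball_d d R) = emeasure (gauss_d d) (dir_cone d (sphere_d d) \<inter> ball_d d R)"
      by (rule emeasure_eq_AE) (auto simp: sets_gauss_d sets_lebesgue_d[symmetric])
    then show ?thesis using gauss_ball[OF d] by (simp add: R_def)
  qed
  moreover have "emeasure (gauss_d d) (dir_cone d A \<inter> ball_d d R) \<le> ennreal (2 * (t * R) / sqrt (2 * pi))"
  proof (rule order_trans[OF emeasure_mono gauss_slab[OF \<theta>]])
    show "dir_cone d A \<inter> ball_d d R \<subseteq> {x \<in> space (gauss_d d). \<bar>inner_d d \<theta> x\<bar> \<le> t * R}"
      unfolding S using t by (auto simp: space_gauss_d ball_d_def intro: order_trans mult_left_mono)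
    have "{x \<in> space ?L. \<bar>inner_d d \<theta> x\<bar> \<le> t * R} \<in> sets ?L" by measurable
    then show "{x \<in> space (gauss_d d). \<bar>inner_d d \<theta> x\<bar> \<le> t * R} \<in> sets (gauss_d d)"
      by (simp add: sets_gauss_d sets_lebesgue_d space_gauss_d)
    show "t * R \<ge> 0" using t R by simp
  qed
  ultimately have "ennreal (2/3) * emeasure (sphere_measure d) A \<le> ennreal (2 * (t * R) / sqrt (2 * pi))"
    using mult_right_mono[OF large, of "emeasure (sphere_measure d) A"] by (auto intro: order_trans)
  then have le: "2/3 * Sp.prob A \<le> 2 * (t * R) / sqrt (2 * pi)"
    using t R by (simp add: Sp.emeasure_eq_measure ennreal_mult[symmetric])
  \<comment> \<open>This is 3/2, the inverse of the mass bound 2/3, times the slab bound 2 R / sqrt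
    (2 pi). With R = sqrt (3 d) the constant is 3 sqrt 3 / sqrt (2 pi), about 2.073.\<close>
  have "3 * R / sqrt (2 * pi) \<le> (52/25) * sqrt (real d)"
  proof -
    have "(3 * sqrt 3)\<^sup>2 \<le> ((52/25) * sqrt (2 * pi))\<^sup>2"
      using pi_approx by (simp add: power_mult_distrib power_divide)
    then have "3 * sqrt 3 \<le> (52/25) * sqrt (2 * pi)"
      by (rule power2_le_imp_le) simp
    then have "3 * sqrt 3 / sqrt (2 * pi) \<le> (52/25)" by (simp add: pos_divide_le_eq)
    then have "3 * sqrt 3 / sqrt (2 * pi) * sqrt (real d) \<le> (52/25) * sqrt (real d)"
      by (rule mult_right_mono) simp
    then show ?thesis by (simp add: R_def real_sqrt_mult)
  qed
  from mult_right_mono[OF this t] have "3 * R / sqrt (2 * pi) * t \<le> (52/25) * sqrt (real d) * t" .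
  moreover have "2 * (t * R) / sqrt (2 * pi) = 2/3 * (3 * R / sqrt (2 * pi) * t)" by simp
  ultimately have "Sp.prob A \<le> (52/25) * sqrt (real d) * t" using le by linarith
  then show ?thesis by (simp add: A_def Sp.emeasure_eq_measure ennreal_leI)
qed

lemma sphere_small_ball:
  assumes d: "d \<ge> 1" and v: "norm_d d v > 0" and m: "m \<ge> 0"
  shows "emeasure (sphere_measure d) {\<phi> \<in> sphere_d d. \<bar>inner_d d v \<phi>\<bar> \<le> m} \<le> ennreal ((52/25) * sqrt (real d) * m / norm_d d v)"
proof -
  have "{\<phi> \<in> sphere_d d. \<bar>inner_d d v \<phi>\<bar> \<le> m}
      = {\<phi> \<in> sphere_d d. \<bar>inner_d d (scale_d d (1 / norm_d d v) v) \<phi>\<bar> \<le> m / norm_d d v}"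
    using v by (auto simp: inner_scale_d_left abs_mult divide_le_cancel)
  with sphere_small_ball_unit[OF d, of "scale_d d (1 / norm_d d v) v" "m / norm_d d v"] v m
  show ?thesis by (simp add: norm_scale_d)
qed

text \<open>On the ball of radius sqrt d the Gaussian density is at least (2 pi e)^(-d/2), and its
  total mass is 1. So this ball has volume at most (2 pi e)^(d/2), and homogeneity gives the other
  radii; 827/200 is just above sqrt (2 pi e).\<close>

lemma emeasure_ball_d_le:
  assumes d: "d \<ge> 1" and R: "R \<ge> 0"
  shows "emeasure (lebesgue_d d) (ball_d d R) \<le> ennreal (((827/200) * R / sqrt (real d)) ^ d)"
proof -
  interpret G: prob_space "gauss_d d" by (rule prob_space_gauss_d)
  let ?B = "ball_d d (sqrt (real d))"
  define c where "c = (1 / (sqrt (2 * pi) * exp (1/2))) ^ d"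
  have c: "c > 0" by (simp add: c_def)
  have "ennreal c * emeasure (lebesgue_d d) ?B = (\<integral>\<^sup>+x. ennreal c * indicator ?B x \<partial>lebesgue_d d)"
    by (subst nn_integral_cmult_indicator) auto
  also have "\<dots> \<le> (\<integral>\<^sup>+x. ennreal (gauss_density_d d x) * indicator ?B x \<partial>lebesgue_d d)"
  proof (intro nn_integral_mono)
    fix x assume "x \<in> space (lebesgue_d d)"
    show "ennreal c * indicator ?B x \<le> ennreal (gauss_density_d d x) * indicator ?B x"
    proof (cases "x \<in> ?B")
      case True
      then have "(norm_d d x)\<^sup>2 \<le> real d"
        using real_sqrt_le_iff[of "(norm_d d x)\<^sup>2" "real d"] by (simp add: ball_d_def)
      then have "exp (- real d / 2) \<le> exp (- (norm_d d x)\<^sup>2 / 2)" by simp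
      moreover have "c = (1 / sqrt (2 * pi)) ^ d * exp (- real d / 2)"
        by (simp add: c_def power_mult_distrib power_divide exp_of_nat_mult[symmetric] exp_minus field_simps)
      ultimately have "c \<le> gauss_density_d d x"
        unfolding gauss_density_d_eq by (simp add: mult_left_mono divide_right_mono)
      then show ?thesis by (simp add: ennreal_leI mult_right_mono)
    qed simp
  qed
  also have "\<dots> = emeasure (gauss_d d) ?B"
    unfolding gauss_d_density by (subst emeasure_density) auto
  also have "\<dots> \<le> 1" by (rule G.emeasure_le_1)
  finally have le: "ennreal c * emeasure (lebesgue_d d) ?B \<le> 1" .
  have c2: "1 / c \<le> (827/200) ^ d"
  proof -
    have "(sqrt (2 * pi) * exp (1/2))\<^sup>2 = 2 * pi * exp 1"
      by (simp add: power_mult_distrib exp_double[symmetric])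
    also have "\<dots> \<le> 2 * (31415927/10000000) * (68/25)"
      using pi_approx e_less_272 by (intro mult_mono) auto
    also have "\<dots> \<le> (827/200)\<^sup>2" by (simp add: power2_eq_square)
    finally have "sqrt (2 * pi) * exp (1/2) \<le> ((827/200)::real)" by (rule power2_le_imp_le) simp
    then have "(sqrt (2 * pi) * exp (1/2)) ^ d \<le> (827/200) ^ d" by (rule power_mono) simp
    then show ?thesis by (simp add: c_def power_divide)
  qed
  have "emeasure (lebesgue_d d) ?B = ennreal (1 / c) * (ennreal c * emeasure (lebesgue_d d) ?B)"
    using c by (simp add: mult.assoc[symmetric] ennreal_mult[symmetric])
  also have "\<dots> \<le> ennreal (1 / c) * 1" using le by (rule mult_left_mono) simp
  also have "\<dots> \<le> ennreal ((827/200) ^ d)" using c2 by (simp add: ennreal_leI)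
  finally have B: "emeasure (lebesgue_d d) ?B \<le> ennreal ((827/200) ^ d)" .
  have "emeasure (lebesgue_d d) (ball_d d R) = ennreal (R ^ d) * emeasure (lebesgue_d d) (ball_d d 1)"
    by (rule emeasure_ball_d[OF d R])
  also have "\<dots> = ennreal ((R / sqrt (real d)) ^ d) * (ennreal (sqrt (real d) ^ d) * emeasure (lebesgue_d d) (ball_d d 1))"
    using d R by (simp add: mult.assoc[symmetric] ennreal_mult[symmetric] power_mult_distrib[symmetric])
  also have "ennreal (sqrt (real d) ^ d) * emeasure (lebesgue_d d) (ball_d d 1) = emeasure (lebesgue_d d) ?B"
    by (rule emeasure_ball_d[OF d, symmetric]) simp
  also have "ennreal ((R / sqrt (real d)) ^ d) * \<dots> \<le> ennreal ((R / sqrt (real d)) ^ d) * ennreal ((827/200) ^ d)"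
    by (rule mult_left_mono[OF B]) simp
  also have "\<dots> = ennreal (((827/200) * R / sqrt (real d)) ^ d)"
    using R by (simp add: ennreal_mult[symmetric] power_mult_distrib[symmetric] mult.commute)
  finally show ?thesis .
qed

section \<open>First moment bounds for the random polytope\<close>

lemma inner_d_commute: "inner_d d u v = inner_d d v u"
  by (simp add: inner_d_def mult.commute)

lemma sets_noise_measure [measurable_cong]: "sets (noise_measure \<delta>) = sets borel"
  by (simp add: noise_measure_def)

lemma space_noise_measure [simp]: "space (noise_measure \<delta>) = UNIV"
  by (simp add: noise_measure_def)

lemma prob_space_noise_measure: "\<delta> > 0 \<Longrightarrow> prob_space (noise_measure \<delta>)"
  unfolding noise_measure_def by (rule prob_space_uniform_measure) auto

lemma nn_integral_noise_measure:
  assumes "\<delta> > 0" and [measurable]: "f \<in> borel_measurable borel"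
  shows "(\<integral>\<^sup>+e. f e \<partial>noise_measure \<delta>) = (\<integral>\<^sup>+e. f e * indicator {-\<delta>..\<delta>} e \<partial>lborel) / ennreal (2 * \<delta>)"
  unfolding noise_measure_def using assms by (subst nn_integral_uniform_measure) auto

lemma AE_noise_measure: "AE e in noise_measure \<delta>. \<bar>e\<bar> \<le> \<delta>"
  unfolding noise_measure_def by (rule AE_uniform_measureI) auto

text \<open>\<open>joint_measure\<close> keeps all directions in one factor and all noises in the
  other. The noise integral is therefore factored first, for fixed directions, and the direction
  integral afterwards.\<close>

lemma nn_integral_joint_prod:
  assumes d: "d \<ge> 1" and \<delta>: "\<delta> > 0"
    and G: "(\<lambda>(\<phi>, e). G \<phi> e) \<in> borel_measurable (sphere_measure d \<Otimes>\<^sub>M borel)"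
  shows "(\<integral>\<^sup>+\<omega>. (\<Prod>n<N. G (fst \<omega> n) (snd \<omega> n)) \<partial>joint_measure d N \<delta>)
    = (\<integral>\<^sup>+\<phi>. \<integral>\<^sup>+e. G \<phi> e \<partial>noise_measure \<delta> \<partial>sphere_measure d) ^ N"
proof -
  interpret S: prob_space "sphere_measure d" by (rule prob_space_sphere_measure[OF d])
  interpret E: prob_space "noise_measure \<delta>" by (rule prob_space_noise_measure[OF \<delta>])
  interpret PS: product_prob_space "\<lambda>_::nat. sphere_measure d" by (rule product_prob_spaceI) (rule S.prob_space_axioms)
  interpret PE: product_prob_space "\<lambda>_::nat. noise_measure \<delta>" by (rule product_prob_spaceI) (rule E.prob_space_axioms)
  let ?S = "PiM {..<N} (\<lambda>_. sphere_measure d)" and ?E = "PiM {..<N} (\<lambda>_. noise_measure \<delta>)"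
  interpret pE: prob_space ?E by (rule prob_space_PiM) (rule E.prob_space_axioms)
  have G' [measurable]: "(\<lambda>(\<phi>, e). G \<phi> e) \<in> borel_measurable (sphere_measure d \<Otimes>\<^sub>M noise_measure \<delta>)"
    using G by (simp cong: measurable_cong_sets)
  have [measurable]: "(\<lambda>\<omega>. G (fst \<omega> n) (snd \<omega> n)) \<in> borel_measurable (?S \<Otimes>\<^sub>M ?E)" if n: "n < N" for n
  proof -
    have "(\<lambda>\<omega>. (fst \<omega> n, snd \<omega> n)) \<in> measurable (?S \<Otimes>\<^sub>M ?E) (sphere_measure d \<Otimes>\<^sub>M noise_measure \<delta>)"
      using n by (intro measurable_Pair measurable_compose[OF measurable_fst measurable_component_singleton]
          measurable_compose[OF measurable_snd measurable_component_singleton]) auto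
    from measurable_compose[OF this G'] show ?thesis by simp
  qed
  have "(\<integral>\<^sup>+\<omega>. (\<Prod>n<N. G (fst \<omega> n) (snd \<omega> n)) \<partial>joint_measure d N \<delta>)
    = (\<integral>\<^sup>+x. \<integral>\<^sup>+y. (\<Prod>n<N. G (x n) (y n)) \<partial>?E \<partial>?S)"
    unfolding joint_measure_def by (subst pE.nn_integral_fst[symmetric]) auto
  also have "\<dots> = (\<integral>\<^sup>+x. (\<Prod>n<N. \<integral>\<^sup>+e. G (x n) e \<partial>noise_measure \<delta>) \<partial>?S)"
  proof (rule nn_integral_cong)
    fix x assume x: "x \<in> space ?S"
    show "(\<integral>\<^sup>+y. (\<Prod>n<N. G (x n) (y n)) \<partial>?E) = (\<Prod>n<N. \<integral>\<^sup>+e. G (x n) e \<partial>noise_measure \<delta>)"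
    proof (rule PE.product_nn_integral_prod)
      fix n assume "n \<in> {..<N}"
      then have xn: "x n \<in> space (sphere_measure d)" using x by (auto simp: space_PiM PiE_def Pi_def)
      from measurable_Pair2[OF G' this] show "G (x n) \<in> borel_measurable (noise_measure \<delta>)"
        by (simp add: fun_eq_iff)
    qed simp
  qed
  also have "\<dots> = (\<Prod>n<N. \<integral>\<^sup>+\<phi>. \<integral>\<^sup>+e. G \<phi> e \<partial>noise_measure \<delta> \<partial>sphere_measure d)"
    by (rule PS.product_nn_integral_prod) measurable
  finally show ?thesis by simp
qed

lemma prob_space_joint_measure:
  assumes d: "d \<ge> 1" and \<delta>: "\<delta> > 0"
  shows "prob_space (joint_measure d N \<delta>)"
proof -
  interpret S: prob_space "PiM {..<N} (\<lambda>_. sphere_measure d)"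
    by (intro prob_space_PiM prob_space_sphere_measure d)
  interpret E: prob_space "PiM {..<N} (\<lambda>_. noise_measure \<delta>)"
    by (intro prob_space_PiM prob_space_noise_measure \<delta>)
  interpret SE: pair_prob_space "PiM {..<N} (\<lambda>_. sphere_measure d)" "PiM {..<N} (\<lambda>_. noise_measure \<delta>)" ..
  show ?thesis unfolding joint_measure_def by (rule SE.P.prob_space_axioms)
qed

text \<open>W is not known to be measurable, so its tail is bounded through a measurable majorant of the
  indicator function of the event that W exceeds l.\<close>

definition tail_bound :: "nat \<Rightarrow> nat \<Rightarrow> real \<Rightarrow> real \<Rightarrow> ennreal \<Rightarrow> bool" where
  "tail_bound d N \<delta> l p \<longleftrightarrow> (\<exists>F\<in>borel_measurable (joint_measure d N \<delta>).
     (AE \<omega> in joint_measure d N \<delta>. ennreal l < W d N \<delta> \<omega> \<longrightarrow> 1 \<le> F \<omega>) \<and>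
     (\<integral>\<^sup>+\<omega>. F \<omega> \<partial>joint_measure d N \<delta>) \<le> p)"

lemma tail_bound_mono: "tail_bound d N \<delta> l p \<Longrightarrow> p \<le> p' \<Longrightarrow> tail_bound d N \<delta> l p'"
  unfolding tail_bound_def by (meson order_trans)

text \<open>Directions lie on the sphere surely, but the noise lives on the whole line and is
  bounded by \<delta> only almost surely.\<close>

lemma AE_joint_measure:
  assumes d: "d \<ge> 1" and \<delta>: "\<delta> > 0"
  shows "AE \<omega> in joint_measure d N \<delta>. \<forall>n<N. fst \<omega> n \<in> sphere_d d \<and> \<bar>snd \<omega> n\<bar> \<le> \<delta>"
proof -
  interpret S: prob_space "PiM {..<N} (\<lambda>_. sphere_measure d)"
    by (intro prob_space_PiM prob_space_sphere_measure d)
  interpret E: prob_space "PiM {..<N} (\<lambda>_. noise_measure \<delta>)"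
    by (intro prob_space_PiM prob_space_noise_measure \<delta>)
  interpret pair_prob_space "PiM {..<N} (\<lambda>_. sphere_measure d)" "PiM {..<N} (\<lambda>_. noise_measure \<delta>)" ..
  have "AE \<omega> in joint_measure d N \<delta>. \<bar>snd \<omega> n\<bar> \<le> \<delta>" if n: "n < N" for n
  proof -
    have "AE y in PiM {..<N} (\<lambda>_. noise_measure \<delta>). \<bar>y n\<bar> \<le> \<delta>"
      using n by (intro AE_PiM_component[where P = "\<lambda>e. \<bar>e\<bar> \<le> \<delta>"] prob_space_noise_measure AE_noise_measure \<delta>) auto
    then have "AE x in PiM {..<N} (\<lambda>_. sphere_measure d). AE y in PiM {..<N} (\<lambda>_. noise_measure \<delta>). \<bar>snd (x, y) n\<bar> \<le> \<delta>"
      by simp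
    moreover have m: "(\<lambda>\<omega>. snd \<omega> n) \<in> borel_measurable (PiM {..<N} (\<lambda>_. sphere_measure d) \<Otimes>\<^sub>M PiM {..<N} (\<lambda>_. noise_measure \<delta>))"
      using n measurable_compose[OF measurable_snd measurable_component_singleton, of n "{..<N}" _ "\<lambda>_. noise_measure \<delta>"]
      by (simp cong: measurable_cong_sets)
    ultimately show ?thesis
      unfolding joint_measure_def
      by (intro AE_pair_measure borel_measurable_le borel_measurable_abs m borel_measurable_const)
  qed
  then have "AE \<omega> in joint_measure d N \<delta>. \<forall>n\<in>{..<N}. \<bar>snd \<omega> n\<bar> \<le> \<delta>"
    by (intro AE_ball_countable[THEN iffD2]) auto
  moreover have "AE \<omega> in joint_measure d N \<delta>. \<forall>n<N. fst \<omega> n \<in> sphere_d d"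
    by (rule AE_I2) (auto simp: joint_measure_def space_pair_measure space_PiM PiE_def Pi_def)
  ultimately show ?thesis by eventually_elim auto
qed

text \<open>Bounded noise makes 0 feasible, and a convex set containing 0 is star-shaped. A far
  feasible point can thus be pulled back to norm exactly l, so that only one radius has to be
  examined per level.\<close>

lemma P_set_at_level:
  assumes W: "ennreal l < W d N \<delta> \<omega>" and l: "l \<ge> 0" and e: "\<And>n. n < N \<Longrightarrow> \<bar>snd \<omega> n\<bar> \<le> \<delta>"
  shows "\<exists>u\<in>P_set d N \<delta> (fst \<omega>) (snd \<omega>). norm_d d u = l"
proof -
  from W obtain u where u: "u \<in> P_set d N \<delta> (fst \<omega>) (snd \<omega>)" "ennreal l < ennreal (norm_d d u)"
    unfolding W_def less_SUP_iff by blast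
  then have less: "l < norm_d d u" by (simp add: ennreal_less_iff l)
  define t where "t = l / norm_d d u"
  have t: "0 \<le> t" "t \<le> 1" using less l by (auto simp: t_def)
  have "\<bar>inner_d d (scale_d d t u) (fst \<omega> n) - snd \<omega> n\<bar> \<le> \<delta>" if n: "n < N" for n
  proof -
    have "inner_d d (scale_d d t u) (fst \<omega> n) - snd \<omega> n
        = t * (inner_d d u (fst \<omega> n) - snd \<omega> n) + (1 - t) * (- snd \<omega> n)"
      by (simp add: inner_scale_d_left algebra_simps)
    also have "\<bar>\<dots>\<bar> \<le> t * \<bar>inner_d d u (fst \<omega> n) - snd \<omega> n\<bar> + (1 - t) * \<bar>snd \<omega> n\<bar>"
      using t by (intro order_trans[OF abs_triangle_ineq]) (simp add: abs_mult)
    also have "\<dots> \<le> t * \<delta> + (1 - t) * \<delta>"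
      using u(1) e[OF n] n t by (intro add_mono mult_left_mono) (auto simp: P_set_def)
    finally show ?thesis by (simp add: algebra_simps)
  qed
  then have "scale_d d t u \<in> P_set d N \<delta> (fst \<omega>) (snd \<omega>)" by (simp add: P_set_def)
  moreover have "norm_d d (scale_d d t u) = l"
    using less l t by (simp add: norm_scale_d t_def)
  ultimately show ?thesis by blast
qed

text \<open>A first moment argument instead of a union bound over a net: Markov's inequality is applied to the
  random mass that G gives to B, which a single bad point u already forces to be at least Z.\<close>

lemma tail_boundI:
  fixes G :: "(nat \<Rightarrow> real) \<Rightarrow> (nat \<Rightarrow> real) \<Rightarrow> real \<Rightarrow> ennreal"
  assumes d: "d \<ge> 1" and \<delta>: "\<delta> > 0" and l: "l \<ge> 0" and Z: "Z > 0"
    and B [measurable]: "B \<in> sets (lebesgue_d d)"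
    and G: "(\<lambda>(v, \<phi>, e). G v \<phi> e) \<in> borel_measurable (lebesgue_d d \<Otimes>\<^sub>M (sphere_measure d \<Otimes>\<^sub>M borel))"
    and q: "\<And>v. v \<in> B \<Longrightarrow> (\<integral>\<^sup>+\<phi>. \<integral>\<^sup>+e. G v \<phi> e \<partial>noise_measure \<delta> \<partial>sphere_measure d) \<le> q"
    and low: "\<And>\<phi> e u. (\<And>n. n < N \<Longrightarrow> \<phi> n \<in> sphere_d d) \<Longrightarrow> (\<And>n. n < N \<Longrightarrow> \<bar>e n\<bar> \<le> \<delta>) \<Longrightarrow>
       u \<in> P_set d N \<delta> \<phi> e \<Longrightarrow> norm_d d u = l \<Longrightarrow>
       ennreal Z \<le> (\<integral>\<^sup>+v. indicator B v * (\<Prod>n<N. G v (\<phi> n) (e n)) \<partial>lebesgue_d d)"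
  shows "tail_bound d N \<delta> l (ennreal (1 / Z) * (emeasure (lebesgue_d d) B * q ^ N))"
proof -
  let ?J = "joint_measure d N \<delta>" and ?L = "lebesgue_d d"
  interpret J: prob_space ?J by (rule prob_space_joint_measure[OF d \<delta>])
  interpret L: sigma_finite_measure ?L by (rule sigma_finite_lebesgue_d)
  interpret JL: pair_sigma_finite ?J ?L ..
  have Gn [measurable]: "(\<lambda>(\<omega>, v). G v (fst \<omega> n) (snd \<omega> n)) \<in> borel_measurable (?J \<Otimes>\<^sub>M ?L)" if n: "n < N" for n
  proof -
    have "(\<lambda>p. fst (fst p) n) \<in> measurable (?J \<Otimes>\<^sub>M ?L) (sphere_measure d)"
      unfolding joint_measure_def using n
      by (intro measurable_compose[OF measurable_fst] measurable_compose[OF measurable_fst measurable_component_singleton]) auto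
    moreover have "(\<lambda>p. snd (fst p) n) \<in> measurable (?J \<Otimes>\<^sub>M ?L) (noise_measure \<delta>)"
      unfolding joint_measure_def using n
      by (intro measurable_compose[OF measurable_fst] measurable_compose[OF measurable_snd measurable_component_singleton]) auto
    then have "(\<lambda>p. snd (fst p) n) \<in> measurable (?J \<Otimes>\<^sub>M ?L) borel"
      unfolding measurable_cong_sets[OF refl sets_noise_measure] .
    ultimately have "(\<lambda>p. (snd p, fst (fst p) n, snd (fst p) n)) \<in> measurable (?J \<Otimes>\<^sub>M ?L) (?L \<Otimes>\<^sub>M (sphere_measure d \<Otimes>\<^sub>M borel))"
      by (intro measurable_Pair measurable_snd)
    from measurable_compose[OF this G] show ?thesis by (simp add: case_prod_unfold)
  qed
  define H where "H \<omega> v = indicator B v * (\<Prod>n<N. G v (fst \<omega> n) (snd \<omega> n))" for \<omega> v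
  have H [measurable]: "(\<lambda>(\<omega>, v). H \<omega> v) \<in> borel_measurable (?J \<Otimes>\<^sub>M ?L)"
    unfolding H_def using Gn by (auto simp: case_prod_unfold intro!: borel_measurable_times_ennreal borel_measurable_prod_ennreal)
  define F where "F \<omega> = ennreal (1 / Z) * (\<integral>\<^sup>+v. H \<omega> v \<partial>?L)" for \<omega>
  have F: "F \<in> borel_measurable ?J" unfolding F_def by measurable
  have "AE \<omega> in ?J. ennreal l < W d N \<delta> \<omega> \<longrightarrow> 1 \<le> F \<omega>"
    using AE_joint_measure[OF d \<delta>]
  proof eventually_elim
    case (elim \<omega>)
    show ?case
    proof
      assume "ennreal l < W d N \<delta> \<omega>"
      from P_set_at_level[OF this l] elim obtain u
        where u: "u \<in> P_set d N \<delta> (fst \<omega>) (snd \<omega>)" "norm_d d u = l" by blast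
      have "ennreal Z \<le> (\<integral>\<^sup>+v. H \<omega> v \<partial>?L)"
        unfolding H_def using elim u by (intro low) auto
      then have "ennreal (1 / Z) * ennreal Z \<le> F \<omega>"
        unfolding F_def by (intro mult_left_mono) auto
      then show "1 \<le> F \<omega>" using Z by (simp add: ennreal_mult[symmetric])
    qed
  qed
  moreover have "(\<integral>\<^sup>+\<omega>. F \<omega> \<partial>?J) \<le> ennreal (1 / Z) * (emeasure ?L B * q ^ N)"
  proof -
    have "(\<integral>\<^sup>+\<omega>. F \<omega> \<partial>?J) = ennreal (1 / Z) * (\<integral>\<^sup>+\<omega>. \<integral>\<^sup>+v. H \<omega> v \<partial>?L \<partial>?J)"
      unfolding F_def by (rule nn_integral_cmult) measurable
    \<comment> \<open>Tonelli moves the expectation inside the integral over v; for fixed v the N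
      measurements are independent, which yields the N-th power.\<close>
    moreover have "(\<integral>\<^sup>+\<omega>. \<integral>\<^sup>+v. H \<omega> v \<partial>?L \<partial>?J) = (\<integral>\<^sup>+v. \<integral>\<^sup>+\<omega>. H \<omega> v \<partial>?J \<partial>?L)"
      by (rule JL.Fubini'[symmetric]) measurable
    moreover have "\<dots> \<le> (\<integral>\<^sup>+v. q ^ N * indicator B v \<partial>?L)"
    proof (rule nn_integral_mono)
      fix v assume v: "v \<in> space ?L"
      have Gv: "(\<lambda>(\<phi>, e). G v \<phi> e) \<in> borel_measurable (sphere_measure d \<Otimes>\<^sub>M borel)"
        using measurable_Pair2[OF G v] by simp
      show "(\<integral>\<^sup>+\<omega>. H \<omega> v \<partial>?J) \<le> q ^ N * indicator B v"
      proof (cases "v \<in> B")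
        case True
        then have "(\<integral>\<^sup>+\<omega>. H \<omega> v \<partial>?J) = (\<integral>\<^sup>+\<phi>. \<integral>\<^sup>+e. G v \<phi> e \<partial>noise_measure \<delta> \<partial>sphere_measure d) ^ N"
          unfolding H_def using nn_integral_joint_prod[OF d \<delta> Gv] by simp
        also have "\<dots> \<le> q ^ N" by (rule power_mono[OF q[OF True]]) simp
        finally show ?thesis using True by simp
      qed (simp add: H_def)
    qed
    moreover have "\<dots> = q ^ N * emeasure ?L B" by (rule nn_integral_cmult_indicator[OF B])
    ultimately have "(\<integral>\<^sup>+\<omega>. F \<omega> \<partial>?J) \<le> ennreal (1 / Z) * (q ^ N * emeasure ?L B)"
      by (simp only: mult_left_mono zero_le)
    then show ?thesis by (simp only: mult.commute)
  qed
  ultimately show ?thesis unfolding tail_bound_def using F by blast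
qed

text \<open>A cube instead of a ball: its uniform law has independent coordinates, so its volume and
  second moments are explicit.\<close>

definition box_d :: "nat \<Rightarrow> (nat \<Rightarrow> real) \<Rightarrow> real \<Rightarrow> (nat \<Rightarrow> real) set" where
  "box_d d u s = Pi\<^sub>E {..<d} (\<lambda>i. {u i - s..u i + s})"

lemma sets_box_d [measurable]: "box_d d u s \<in> sets (lebesgue_d d)"
  unfolding lebesgue_d_def box_d_def by (intro sets_PiM_I_finite) auto

lemma emeasure_box_d: "s \<ge> 0 \<Longrightarrow> emeasure (lebesgue_d d) (box_d d u s) = ennreal ((2 * s) ^ d)"
  unfolding box_d_def by (subst emeasure_lebesgue_d_box) (auto simp: ennreal_power)

lemma box_d_norm:
  assumes v: "v \<in> box_d d u s" and s: "s \<ge> 0"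
  shows "v \<in> space (lebesgue_d d)" "norm_d d (\<lambda>i. v i - u i) \<le> sqrt (real d) * s"
    "norm_d d v \<le> norm_d d u + sqrt (real d) * s" "norm_d d u - sqrt (real d) * s \<le> norm_d d v"
proof -
  show "v \<in> space (lebesgue_d d)" using v by (auto simp: box_d_def space_lebesgue_d)
  have "(v i - u i)\<^sup>2 \<le> s\<^sup>2" if "i < d" for i
    using v that s by (intro abs_le_square_iff[THEN iffD1]) (auto simp: box_d_def PiE_def Pi_def abs_le_iff)
  then have "(\<Sum>i<d. (v i - u i)\<^sup>2) \<le> (\<Sum>i<d. s\<^sup>2)" by (intro sum_mono) simp
  then have "norm_d d (\<lambda>i. v i - u i) \<le> sqrt (real d * s\<^sup>2)" unfolding norm_d_def by simp
  also have "\<dots> = sqrt (real d) * s" using s by (simp add: real_sqrt_mult)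
  finally show n: "norm_d d (\<lambda>i. v i - u i) \<le> sqrt (real d) * s" .
  have "norm_d d v \<le> norm_d d u + norm_d d (\<lambda>i. v i - u i)"
    using L2_set_triangle_ineq[of u "\<lambda>i. v i - u i" "{..<d}"] by (simp add: norm_d_L2_set)
  with n show "norm_d d v \<le> norm_d d u + sqrt (real d) * s" by simp
  have "norm_d d u \<le> norm_d d v + norm_d d (\<lambda>i. u i - v i)"
    using L2_set_triangle_ineq[of v "\<lambda>i. u i - v i" "{..<d}"] by (simp add: norm_d_L2_set)
  moreover have "norm_d d (\<lambda>i. u i - v i) = norm_d d (\<lambda>i. v i - u i)"
    by (simp add: norm_d_def power2_commute)
  ultimately show "norm_d d u - sqrt (real d) * s \<le> norm_d d v" using n by simp
qed

lemma inner_d_diff: "inner_d d v \<phi> - inner_d d u \<phi> = inner_d d (\<lambda>i. v i - u i) \<phi>"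
  by (simp add: inner_d_def sum_subtractf left_diff_distrib)

section \<open>Moments of the uniform law on a box\<close>

lemma uniform_moments:
  fixes a s :: real
  assumes s: "s > 0"
  defines "U \<equiv> density lborel (\<lambda>x. ennreal (indicator {a - s..a + s} x / (2 * s)))"
  shows "prob_space U" "integrable U (\<lambda>x. x - a)" "integrable U (\<lambda>x. (x - a)\<^sup>2)"
    "(\<integral>x. x - a \<partial>U) = 0" "(\<integral>x. (x - a)\<^sup>2 \<partial>U) = s\<^sup>2 / 3"
proof -
  have "U = uniform_measure lborel {a - s..a + s}"
    unfolding U_def uniform_measure_def using s
    by (intro density_cong) (auto simp: indicator_def divide_ennreal ennreal_1[symmetric] simp del: ennreal_1)
  then show U: "prob_space U" using s by (simp add: prob_space_uniform_measure)
  interpret U: prob_space U by fact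
  have [simp]: "sets U = sets borel" "space U = UNIV" by (auto simp: U_def)
  have dist: "distributed U lborel (\<lambda>x. x) (\<lambda>x. indicator {a - s..a + s} x / measure lborel {a - s..a + s})"
    unfolding distributed_def using s
    by (auto simp: U_def distr_id2)
  have E: "U.expectation (\<lambda>x. x) = a"
    using U.uniform_distributed_expectation[OF dist] by simp
  have ae: "AE x in U. x \<in> {a - s..a + s}"
    unfolding U_def using s by (subst AE_density) (auto simp: indicator_def)
  have m [measurable]: "(\<lambda>x. x) \<in> borel_measurable U" by (rule measurable_ident_sets) simp
  have int1: "integrable U (\<lambda>x. x)"
  proof (rule U.integrable_const_bound[where B = "\<bar>a\<bar> + s"])
    show "AE x in U. norm x \<le> \<bar>a\<bar> + s" using ae by eventually_elim auto
  qed (rule m)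
  then show "integrable U (\<lambda>x. x - a)" by simp
  show "integrable U (\<lambda>x. (x - a)\<^sup>2)"
  proof (rule U.integrable_const_bound[where B = "s\<^sup>2"])
    show "AE x in U. norm ((x - a)\<^sup>2) \<le> s\<^sup>2"
      using ae by eventually_elim (use s in \<open>auto intro!: abs_le_square_iff[THEN iffD1] simp: abs_le_iff\<close>)
  qed measurable
  show "(\<integral>x. x - a \<partial>U) = 0" using int1 E U.prob_space by simp
  show "(\<integral>x. (x - a)\<^sup>2 \<partial>U) = s\<^sup>2 / 3"
    using U.uniform_distributed_variance[OF dist] by (simp add: E power_mult_distrib)
qed

text \<open>The coordinates of v - u are independent and centred with variance s^2/3, hence so is
  the variance in every unit direction. Cauchy-Schwarz would only give s^2 d; avoiding this factor d
  allows a side proportional to l / sqrt d in the near range.\<close>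

lemma box_second_moment:
  assumes s: "s > 0" and \<phi>: "norm_d d \<phi> = 1"
  shows "(\<integral>\<^sup>+v. indicator (box_d d u s) v * ennreal ((inner_d d v \<phi> - inner_d d u \<phi>)\<^sup>2) \<partial>lebesgue_d d)
    = ennreal ((2 * s) ^ d * (s\<^sup>2 / 3))"
proof -
  define f where "f i x = ennreal (indicator {u i - s..u i + s} x / (2 * s))" for i :: nat and x :: real
  have [measurable]: "\<And>i. f i \<in> borel_measurable borel" unfolding f_def by measurable
  define U where "U i = density lborel (f i)" for i
  note mom = uniform_moments[OF s, of "u i" for i, folded f_def, folded U_def]
  interpret product_prob_space U by (rule product_prob_spaceI) (rule mom)
  interpret fin: finite_product_prob_space U "{..<d}" by standard simp
  let ?Q = "PiM {..<d} U"
  have Q: "density (lebesgue_d d) (\<lambda>x. \<Prod>i<d. f i (x i)) = ?Q"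
    unfolding U_def using mom(1) by (intro density_lebesgue_d) (auto simp: U_def)
  have EX: "integrable ?Q (\<lambda>x. (x i - u i) * (x j - u j)) \<and>
     (\<integral>x. (x i - u i) * (x j - u j) \<partial>?Q) = (if i = j then s\<^sup>2 / 3 else 0)" if i: "i < d" and j: "j < d" for i j
  proof -
    \<comment> \<open>The product of two coordinates is written as a product over all coordinates
      with trivial factors, so that the integral factors; for i = j both conditions hit the same k
      and produce the square.\<close>
    define g where "g k x = (if k = i then x - u i else 1) * (if k = j then x - u j else 1)" for k and x :: real
    have gi: "integrable (U k) (g k)" for k
    proof -
      interpret Uk: prob_space "U k" by (rule mom)
      show ?thesis
        using mom(2,3)[of k] unfolding g_def
        by (cases "k = i"; cases "k = j") (auto simp: power2_eq_square)
    qed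
    have eq: "(\<Prod>k<d. g k (x k)) = (x i - u i) * (x j - u j)" for x
      unfolding g_def prod.distrib using i j by (simp add: prod.delta)
    have "(\<integral>x. (\<Prod>k<d. g k (x k)) \<partial>?Q) = (\<Prod>k<d. \<integral>x. g k x \<partial>U k)"
      by (rule product_integral_prod) (auto intro: gi)
    also have "\<dots> = (if i = j then s\<^sup>2 / 3 else 0)"
    proof (cases "i = j")
      case True
      have "(\<integral>x. g k x \<partial>U k) = (if k = i then s\<^sup>2 / 3 else 1)" for k
      proof -
        interpret Uk: prob_space "U k" by (rule mom)
        show ?thesis using True mom(5)[of i] by (auto simp: g_def power2_eq_square prob_space.prob_space[OF mom(1)])
      qed
      with True i show ?thesis by (simp add: prod.delta)
    next
      case False
      have "(\<integral>x. g i x \<partial>U i) = 0" using False mom(4)[of i] by (simp add: g_def)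
      with False i show ?thesis by (auto intro!: prod_zero)
    qed
    finally have "(\<integral>x. (\<Prod>k<d. g k (x k)) \<partial>?Q) = (if i = j then s\<^sup>2 / 3 else 0)" .
    moreover have "integrable ?Q (\<lambda>x. \<Prod>k<d. g k (x k))"
      by (rule product_integrable_prod) (auto intro: gi)
    ultimately show ?thesis unfolding eq by simp
  qed
  have expand: "(inner_d d v \<phi> - inner_d d u \<phi>)\<^sup>2 = (\<Sum>i<d. \<Sum>j<d. (\<phi> i * \<phi> j) * ((v i - u i) * (v j - u j)))" for v
    unfolding inner_d_diff unfolding inner_d_def power2_eq_square sum_product
    by (intro sum.cong) (auto simp: mult_ac)
  have int: "integrable ?Q (\<lambda>v. (inner_d d v \<phi> - inner_d d u \<phi>)\<^sup>2)"
    unfolding expand using EX by (intro Bochner_Integration.integrable_sum integrable_mult_right) auto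
  have "(\<integral>v. (inner_d d v \<phi> - inner_d d u \<phi>)\<^sup>2 \<partial>?Q) = (\<Sum>i<d. \<Sum>j<d. (\<phi> i * \<phi> j) * (if i = j then s\<^sup>2 / 3 else 0))"
    unfolding expand using EX
    by (subst Bochner_Integration.integral_sum; (intro Bochner_Integration.integrable_sum integrable_mult_right)?; simp?)
  also have "\<dots> = (\<Sum>i<d. (\<phi> i)\<^sup>2) * (s\<^sup>2 / 3)"
    by (simp add: sum_distrib_right power2_eq_square if_distrib cong: if_cong)
  also have "\<dots> = s\<^sup>2 / 3" using norm_d_power2[of d \<phi>] \<phi> by simp
  finally have E: "(\<integral>\<^sup>+v. ennreal ((inner_d d v \<phi> - inner_d d u \<phi>)\<^sup>2) \<partial>?Q) = ennreal (s\<^sup>2 / 3)"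
    using int by (subst nn_integral_eq_integral) auto
  \<comment> \<open>The product density is the normalized indicator of the box; the normalization
    accounts for the factor (2 s)^d in the claim.\<close>
  have prodf: "(\<Prod>i<d. f i (x i)) = ennreal (1 / (2 * s) ^ d) * indicator (box_d d u s) x"
    if "x \<in> space (lebesgue_d d)" for x
  proof -
    have "(\<Prod>i<d. f i (x i)) = ennreal (\<Prod>i<d. indicator {u i - s..u i + s} (x i) / (2 * s))"
      unfolding f_def using s by (intro prod_ennreal) auto
    also have "(\<Prod>i<d. indicator {u i - s..u i + s} (x i) / (2 * s)) = indicator (box_d d u s) x / (2 * s) ^ d"
      using that by (auto simp: prod_dividef box_d_def indicator_def space_lebesgue_d PiE_def Pi_def prod_zero_iff split: if_splits)
    finally show ?thesis by (auto simp: indicator_def)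
  qed
  have [measurable]: "\<And>i. i < d \<Longrightarrow> (\<lambda>x. f i (x i)) \<in> borel_measurable (lebesgue_d d)"
    by (auto intro!: measurable_compose[of _ _ borel "f i" for i] measurable_component_borel)
  have mv [measurable]: "(\<lambda>v. inner_d d v \<phi>) \<in> borel_measurable (lebesgue_d d)"
    unfolding inner_d_commute[of d _ \<phi>] by measurable
  have "ennreal (s\<^sup>2 / 3) = (\<integral>\<^sup>+v. (\<Prod>i<d. f i (v i)) * ennreal ((inner_d d v \<phi> - inner_d d u \<phi>)\<^sup>2) \<partial>lebesgue_d d)"
    unfolding E[symmetric] Q[symmetric] by (rule nn_integral_density) auto
  also have "\<dots> = (\<integral>\<^sup>+v. ennreal (1 / (2 * s) ^ d) * (indicator (box_d d u s) v * ennreal ((inner_d d v \<phi> - inner_d d u \<phi>)\<^sup>2)) \<partial>lebesgue_d d)"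
    by (intro nn_integral_cong) (simp add: prodf mult.assoc)
  also have "\<dots> = ennreal (1 / (2 * s) ^ d) * (\<integral>\<^sup>+v. indicator (box_d d u s) v * ennreal ((inner_d d v \<phi> - inner_d d u \<phi>)\<^sup>2) \<partial>lebesgue_d d)"
    by (rule nn_integral_cmult) measurable
  finally have "ennreal ((2 * s) ^ d) * ennreal (s\<^sup>2 / 3) = ennreal ((2 * s) ^ d) * (ennreal (1 / (2 * s) ^ d) *
      (\<integral>\<^sup>+v. indicator (box_d d u s) v * ennreal ((inner_d d v \<phi> - inner_d d u \<phi>)\<^sup>2) \<partial>lebesgue_d d))"
    by simp
  then show ?thesis using s by (simp add: mult.assoc[symmetric] ennreal_mult[symmetric])
qed

section \<open>Tail bounds\<close>

lemma measurable_inner_sphere [measurable]: "(\<lambda>\<phi>. inner_d d v \<phi>) \<in> borel_measurable (sphere_measure d)"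
  using measurable_inner_d_const[OF measurable_id_sphere] .

lemma measurable_inner_triple:
  "(\<lambda>p. inner_d d (fst p) (fst (snd p))) \<in> borel_measurable (lebesgue_d d \<Otimes>\<^sub>M (sphere_measure d \<Otimes>\<^sub>M borel))"
proof (rule measurable_inner_d)
  show "fst \<in> measurable (lebesgue_d d \<Otimes>\<^sub>M (sphere_measure d \<Otimes>\<^sub>M borel)) (PiM {..<d} (\<lambda>_. borel))"
    by measurable
  show "(\<lambda>p. fst (snd p)) \<in> measurable (lebesgue_d d \<Otimes>\<^sub>M (sphere_measure d \<Otimes>\<^sub>M borel)) (PiM {..<d} (\<lambda>_. borel))"
    by (intro measurable_compose[OF _ measurable_id_sphere] measurable_compose[OF measurable_snd measurable_fst])
qed

lemma sets_sphere_slab: "{\<phi> \<in> sphere_d d. \<bar>inner_d d v \<phi>\<bar> \<le> m} \<in> sets (sphere_measure d)"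
proof -
  have "{\<phi> \<in> space (sphere_measure d). \<bar>inner_d d v \<phi>\<bar> \<le> m} \<in> sets (sphere_measure d)" by measurable
  then show ?thesis by simp
qed

section \<open>Far regime\<close>

lemma emeasure_annulus_le:
  assumes d: "d \<ge> 1" and \<delta>: "0 < \<delta>" "\<delta> < l"
  shows "emeasure (lebesgue_d d) {v \<in> space (lebesgue_d d). l - \<delta> < norm_d d v \<and> norm_d d v \<le> l + \<delta>}
    \<le> ennreal (((827/200) * (l + \<delta>) / sqrt (real d)) ^ d * (2 * \<delta> * real d / (l + \<delta>)))"
proof -
  let ?L = "lebesgue_d d"
  obtain V where V: "emeasure ?L (ball_d d 1) = ennreal V" "V \<ge> 0"
    using emeasure_unit_ball_bounds(2)[OF d] by (cases "emeasure ?L (ball_d d 1)") auto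
  have vol: "emeasure ?L (ball_d d R) = ennreal (R ^ d * V)" if "R \<ge> 0" for R
    using emeasure_ball_d[OF d that] V that by (simp add: ennreal_mult)
  have VR: "(l + \<delta>) ^ d * V \<le> ((827/200) * (l + \<delta>) / sqrt (real d)) ^ d"
    using emeasure_ball_d_le[OF d, of "l + \<delta>"] vol[of "l + \<delta>"] \<delta> by simp
  have "{v \<in> space ?L. l - \<delta> < norm_d d v \<and> norm_d d v \<le> l + \<delta>} = ball_d d (l + \<delta>) - ball_d d (l - \<delta>)"
    by (auto simp: ball_d_def)
  also have "emeasure ?L \<dots> = emeasure ?L (ball_d d (l + \<delta>)) - emeasure ?L (ball_d d (l - \<delta>))"
    using \<delta> by (intro emeasure_Diff) (auto simp: vol, auto simp: ball_d_def)
  also have "\<dots> = ennreal (((l + \<delta>) ^ d - (l - \<delta>) ^ d) * V)"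
    using \<delta> V by (simp add: vol ennreal_minus left_diff_distrib)
  also have "\<dots> \<le> ennreal (((827/200) * (l + \<delta>) / sqrt (real d)) ^ d * (2 * \<delta> * real d / (l + \<delta>)))"
  proof (rule ennreal_leI)
    \<comment> \<open>Bernoulli's inequality for ((l - \<delta>) / (l + \<delta>))^d: removing the
      inner ball leaves at most the share 2 \<delta> d / (l + \<delta>) of the outer one.\<close>
    have "1 + real d * (- (2 * \<delta> / (l + \<delta>))) \<le> (1 + - (2 * \<delta> / (l + \<delta>))) ^ d"
      using \<delta> by (intro Bernoulli_inequality) (simp add: field_simps)
    also have "1 + - (2 * \<delta> / (l + \<delta>)) = (l - \<delta>) / (l + \<delta>)"
      using \<delta> by (simp add: field_simps)
    finally have "(1 - real d * (2 * \<delta> / (l + \<delta>))) * (l + \<delta>) ^ d \<le> (l - \<delta>) ^ d"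
      using \<delta> by (simp add: power_divide pos_le_divide_eq)
    moreover have eq: "real d * (2 * \<delta> / (l + \<delta>)) = 2 * \<delta> * real d / (l + \<delta>)" by simp
    moreover have alg: "P - Q \<le> c * P" if "(1 - c) * P \<le> Q" for P Q c :: real
      using that by (simp add: left_diff_distrib)
    ultimately have "(l + \<delta>) ^ d - (l - \<delta>) ^ d \<le> (2 * \<delta> * real d / (l + \<delta>)) * (l + \<delta>) ^ d"
      by (intro alg) (simp only:)
    then have "((l + \<delta>) ^ d - (l - \<delta>) ^ d) * V \<le> (2 * \<delta> * real d / (l + \<delta>)) * (l + \<delta>) ^ d * V"
      using V(2) by (rule mult_right_mono)
    also have "\<dots> \<le> (2 * \<delta> * real d / (l + \<delta>)) * ((827/200) * (l + \<delta>) / sqrt (real d)) ^ d"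
      unfolding mult.assoc[of "2 * \<delta> * real d / (l + \<delta>)"] using \<delta> VR by (intro mult_left_mono) auto
    finally show "((l + \<delta>) ^ d - (l - \<delta>) ^ d) * V \<le> ((827/200) * (l + \<delta>) / sqrt (real d)) ^ d * (2 * \<delta> * real d / (l + \<delta>))"
      by (simp only: mult.commute)
  qed
  finally show ?thesis .
qed

text \<open>Points of the box around u have distance less than \<delta> from u, which turns the bound 2 \<delta> on the
  measurements of u into 3 \<delta>. The annulus (not the whole ball) saves the factor 1/l that makes the second moment
  finite already for N = d + 2.\<close>

lemma far_tail_bound:
  assumes d: "d \<ge> 1" and \<delta>: "0 < \<delta>" "\<delta> < l"
  shows "tail_bound d N \<delta> l (ennreal (((5221/2500) * (l + \<delta>) / \<delta>) ^ d * (2 * \<delta> * real d / (l + \<delta>)) * ((156/25) * sqrt (real d) * \<delta> / (l - \<delta>)) ^ N))"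
proof -
  let ?L = "lebesgue_d d"
  \<comment> \<open>The factor 99/100 keeps the box off the inner boundary of B, where the
    inequality is strict.\<close>
  define s where "s = (99/100) * \<delta> / sqrt (real d)"
  have rd: "sqrt (real d) > 0" using d by simp
  have s: "s > 0" using \<delta> rd by (simp add: s_def)
  have ss: "sqrt (real d) * s = (99/100) * \<delta>" using rd by (simp add: s_def)
  define B where "B = {v \<in> space ?L. l - \<delta> < norm_d d v \<and> norm_d d v \<le> l + \<delta>}"
  define G where "G v \<phi> e = (if \<bar>inner_d d v \<phi>\<bar> \<le> 3 * \<delta> then 1 else 0 :: ennreal)" for v \<phi> and e :: real
  \<comment> \<open>Three times the small ball constant 52/25, with the smallest norm in B as
    denominator.\<close>
  define q where "q = (156/25) * sqrt (real d) * \<delta> / (l - \<delta>)"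
  have q0: "q \<ge> 0" using \<delta> by (simp add: q_def)
  have B: "B \<in> sets ?L" unfolding B_def by measurable
  have tb: "tail_bound d N \<delta> l (ennreal (1 / (2 * s) ^ d) * (emeasure ?L B * ennreal q ^ N))"
  proof (rule tail_boundI[where G = G])
    have [measurable]: "(\<lambda>p. inner_d d (fst p) (fst (snd p))) \<in> borel_measurable (?L \<Otimes>\<^sub>M (sphere_measure d \<Otimes>\<^sub>M borel))"
      by (rule measurable_inner_triple)
    show "(\<lambda>(v, \<phi>, e). G v \<phi> e) \<in> borel_measurable (?L \<Otimes>\<^sub>M (sphere_measure d \<Otimes>\<^sub>M borel))"
      unfolding G_def case_prod_unfold by measurable
  next
    fix v assume "v \<in> B"
    then have v: "norm_d d v > l - \<delta>" by (simp add: B_def)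
    interpret E: prob_space "noise_measure \<delta>" by (rule prob_space_noise_measure[OF \<delta>(1)])
    have "(\<integral>\<^sup>+\<phi>. \<integral>\<^sup>+e. G v \<phi> e \<partial>noise_measure \<delta> \<partial>sphere_measure d)
      = (\<integral>\<^sup>+\<phi>. indicator {\<phi> \<in> sphere_d d. \<bar>inner_d d v \<phi>\<bar> \<le> 3 * \<delta>} \<phi> \<partial>sphere_measure d)"
      unfolding G_def nn_integral_const E.emeasure_space_1 by (intro nn_integral_cong) (auto simp: indicator_def)
    also have "\<dots> = emeasure (sphere_measure d) {\<phi> \<in> sphere_d d. \<bar>inner_d d v \<phi>\<bar> \<le> 3 * \<delta>}"
      by (rule nn_integral_indicator[OF sets_sphere_slab])
    also have "\<dots> \<le> ennreal ((52/25) * sqrt (real d) * (3 * \<delta>) / norm_d d v)"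
      using v \<delta> by (intro sphere_small_ball[OF d]) auto
    also have "\<dots> \<le> ennreal q"
      unfolding q_def using v \<delta> by (intro ennreal_leI frac_le) auto
    finally show "(\<integral>\<^sup>+\<phi>. \<integral>\<^sup>+e. G v \<phi> e \<partial>noise_measure \<delta> \<partial>sphere_measure d) \<le> ennreal q" .
  next
    fix \<phi> :: "nat \<Rightarrow> nat \<Rightarrow> real" and e :: "nat \<Rightarrow> real" and u
    assume \<phi>: "\<And>n. n < N \<Longrightarrow> \<phi> n \<in> sphere_d d" and e: "\<And>n. n < N \<Longrightarrow> \<bar>e n\<bar> \<le> \<delta>"
      and u: "u \<in> P_set d N \<delta> \<phi> e" "norm_d d u = l"
    have "ennreal ((2 * s) ^ d) = (\<integral>\<^sup>+v. indicator (box_d d u s) v \<partial>?L)"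
      using s by (simp add: emeasure_box_d)
    also have "\<dots> \<le> (\<integral>\<^sup>+v. indicator B v * (\<Prod>n<N. G v (\<phi> n) (e n)) \<partial>?L)"
    proof (rule nn_integral_mono)
      fix v
      show "indicator (box_d d u s) v \<le> indicator B v * (\<Prod>n<N. G v (\<phi> n) (e n))"
      proof (cases "v \<in> box_d d u s")
        case True
        note bn = box_d_norm[OF True less_imp_le[OF s], unfolded ss]
        have "v \<in> B" using bn u(2) \<delta> by (simp add: B_def)
        moreover have "G v (\<phi> n) (e n) = 1" if n: "n < N" for n
        proof -
          have "\<bar>inner_d d v (\<phi> n) - inner_d d u (\<phi> n)\<bar> \<le> norm_d d (\<lambda>i. v i - u i) * norm_d d (\<phi> n)"
            unfolding inner_d_diff by (rule abs_inner_d_le)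
          also have "\<dots> \<le> (99/100) * \<delta>" using bn(2) \<phi>[OF n] by (simp add: sphere_d_def)
          also have "\<dots> \<le> \<delta>" using \<delta> by simp
          finally have "\<bar>inner_d d v (\<phi> n) - inner_d d u (\<phi> n)\<bar> \<le> \<delta>" .
          moreover have "\<bar>inner_d d u (\<phi> n) - e n\<bar> \<le> \<delta>" using u(1) n by (simp add: P_set_def)
          ultimately have "\<bar>inner_d d v (\<phi> n)\<bar> \<le> 3 * \<delta>" using e[OF n] \<delta> by linarith
          then show ?thesis by (simp add: G_def)
        qed
        ultimately show ?thesis by (simp add: indicator_def)
      qed simp
    qed
    finally show "ennreal ((2 * s) ^ d) \<le> (\<integral>\<^sup>+v. indicator B v * (\<Prod>n<N. G v (\<phi> n) (e n)) \<partial>?L)" .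
  qed (use d \<delta> s B in auto)
  have "ennreal (1 / (2 * s) ^ d) * (emeasure ?L B * ennreal q ^ N)
      \<le> ennreal (1 / (2 * s) ^ d) * (ennreal (((827/200) * (l + \<delta>) / sqrt (real d)) ^ d * (2 * \<delta> * real d / (l + \<delta>))) * ennreal q ^ N)"
    unfolding B_def by (intro mult_left_mono mult_right_mono emeasure_annulus_le d \<delta>) auto
  also have "\<dots> = ennreal (1 / (2 * s) ^ d * (((827/200) * (l + \<delta>) / sqrt (real d)) ^ d * (2 * \<delta> * real d / (l + \<delta>)) * q ^ N))"
    using s \<delta> q0 by (simp add: ennreal_mult[symmetric] ennreal_power)
  also have "1 / (2 * s) ^ d * (((827/200) * (l + \<delta>) / sqrt (real d)) ^ d * (2 * \<delta> * real d / (l + \<delta>)) * q ^ N)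
      = ((827/200) * (l + \<delta>) / sqrt (real d) / (2 * s)) ^ d * (2 * \<delta> * real d / (l + \<delta>)) * q ^ N"
    unfolding power_divide by simp
  also have "\<dots> \<le> ennreal (((5221/2500) * (l + \<delta>) / \<delta>) ^ d * (2 * \<delta> * real d / (l + \<delta>)) * q ^ N)"
  proof (intro ennreal_leI mult_right_mono power_mono)
    \<comment> \<open>The volume constant of the ball over the side constant of the box: 4.135 /
      1.98 is just below 5221/2500.\<close>
    have "(827/200) * (l + \<delta>) / sqrt (real d) / (2 * s) = (827/200) / (99/50) * (l + \<delta>) / \<delta>"
      using rd \<delta> by (simp add: s_def field_simps)
    also have "\<dots> \<le> (5221/2500) * (l + \<delta>) / \<delta>" using \<delta> by (intro divide_right_mono mult_right_mono) auto
    finally show "(827/200) * (l + \<delta>) / sqrt (real d) / (2 * s) \<le> (5221/2500) * (l + \<delta>) / \<delta>" .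
  qed (use \<delta> s q0 in auto)
  finally show ?thesis using tail_bound_mono[OF tb] by (simp add: q_def)
qed

section \<open>Near regime\<close>

lemma noise_integral_le:
  fixes g :: "real \<Rightarrow> ennreal"
  assumes \<delta>: "\<delta> > 0" and t: "0 \<le> t" "t \<le> \<delta>" and ab: "0 \<le> a" "0 \<le> b"
    and g [measurable]: "g \<in> borel_measurable borel"
    and mid: "\<And>e. \<bar>e\<bar> < \<delta> - t \<Longrightarrow> g e \<le> 1"
    and neg: "\<And>e. e \<le> - (\<delta> - t) \<Longrightarrow> g e \<le> ennreal a"
    and pos: "\<And>e. e \<ge> \<delta> - t \<Longrightarrow> g e \<le> ennreal b"
  shows "(\<integral>\<^sup>+e. g e \<partial>noise_measure \<delta>) \<le> ennreal ((2 * (\<delta> - t) + t * (a + b)) / (2 * \<delta>))"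
proof -
  have "(\<integral>\<^sup>+e. g e * indicator {-\<delta>..\<delta>} e \<partial>lborel)
    \<le> (\<integral>\<^sup>+e. (indicator {-(\<delta> - t)..\<delta> - t} e + ennreal a * indicator {-\<delta>..-(\<delta> - t)} e) + ennreal b * indicator {\<delta> - t..\<delta>} e \<partial>lborel)"
  proof (rule nn_integral_mono)
    fix e :: real
    \<comment> \<open>One middle piece of length 2 (\<delta> - t) and two end pieces of length t.
      The ends carry separate bounds a and b because the sign of the inner product decides which end
      is penalised. Overlapping endpoints only enlarge the majorant.\<close>
    consider "\<bar>e\<bar> < \<delta> - t" | "e \<le> - (\<delta> - t)" | "e \<ge> \<delta> - t" by linarith
    then show "g e * indicator {-\<delta>..\<delta>} e \<le> (indicator {-(\<delta> - t)..\<delta> - t} e + ennreal a * indicator {-\<delta>..-(\<delta> - t)} e) + ennreal b * indicator {\<delta> - t..\<delta>} e"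
    proof cases
      case 1
      with mid[OF 1] t show ?thesis by (auto simp: indicator_def intro: add_increasing2)
    next
      case 2
      have "g e * indicator {-\<delta>..\<delta>} e \<le> ennreal a * indicator {-\<delta>..-(\<delta> - t)} e"
        using neg[OF 2] 2 t by (auto simp: indicator_def)
      then show ?thesis by (rule order_trans) (rule add_increasing2[OF zero_le add_increasing[OF zero_le order_refl]])
    next
      case 3
      have "g e * indicator {-\<delta>..\<delta>} e \<le> ennreal b * indicator {\<delta> - t..\<delta>} e"
        using pos[OF 3] 3 t by (auto simp: indicator_def)
      then show ?thesis by (rule order_trans) (rule add_increasing[OF zero_le order_refl])
    qed
  qed
  also have "\<dots> = ennreal (2 * (\<delta> - t) + t * (a + b))"
    using t ab by (simp add: nn_integral_add nn_integral_cmult ennreal_mult[symmetric] ennreal_plus[symmetric] algebra_simps del: ennreal_plus)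
  finally have "(\<integral>\<^sup>+e. g e * indicator {-\<delta>..\<delta>} e \<partial>lborel) / ennreal (2 * \<delta>) \<le> ennreal (2 * (\<delta> - t) + t * (a + b)) / ennreal (2 * \<delta>)"
    by (rule divide_right_mono_ennreal)
  then show ?thesis
    using \<delta> t ab by (simp add: nn_integral_noise_measure divide_ennreal del: ennreal_plus)
qed

text \<open>Only constraints whose noise lies within t of the boundary of [-\<delta>, \<delta>] count; each pays 4/t times
  the amount by which v violates it, and the constant 77/1000 compensates the average violation near a
  point of the polytope.\<close>

definition tilt :: "nat \<Rightarrow> real \<Rightarrow> real \<Rightarrow> (nat \<Rightarrow> real) \<Rightarrow> (nat \<Rightarrow> real) \<Rightarrow> real \<Rightarrow> real" where
  "tilt d \<delta> t v \<phi> e = (if \<delta> - t \<le> \<bar>e\<bar> then (77/1000) - 4 * max 0 (\<bar>inner_d d v \<phi> - e\<bar> - \<delta>) / t else 0)"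

text \<open>These follow from 1 + x \<le> exp x, which gives 1 / (1 - 77/1000), and from exp 1 \<ge>
  27/10, whose inverse square is below 343/2500.\<close>

lemma exp_numeric:
  "exp ((77/1000)::real) \<le> (108343/100000)" "exp ((77/1000) - 2 :: real) \<le> (343/2500) * exp (77/1000)" "exp (1::real) \<ge> (27/10)"
proof -
  have "(1::real) + - (77/1000) \<le> exp (- (77/1000))" by (rule exp_ge_add_one_self)
  then have "exp ((77/1000)::real) \<le> 1 / (923/1000)" by (simp add: exp_minus field_simps)
  then show "exp ((77/1000)::real) \<le> (108343/100000)" by simp
  show e: "exp (1::real) \<ge> (27/10)" using e_approx_32 unfolding abs_le_iff by simp
  have "((27/10)::real)\<^sup>2 \<le> (exp 1)\<^sup>2" using e by (intro power_mono) auto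
  also have "(exp (1::real))\<^sup>2 = exp 2" by (simp add: exp_double[symmetric])
  finally have e2: "1 / exp 2 \<le> ((343/2500)::real)" by (simp add: power2_eq_square pos_divide_le_eq)
  show "exp ((77/1000) - 2 :: real) \<le> (343/2500) * exp (77/1000)"
    unfolding exp_diff using mult_left_mono[OF e2, of "exp (77/1000)"] by simp
qed

text \<open>With probability at least 1 - 11759/25000 the inner product exceeds 3t/2 in absolute value, and then
  the half of the relevant noise values with the opposite sign is violated by at least t/2.\<close>

lemma tilt_expectation:
  assumes d: "d \<ge> 1" and l: "l > 0" and \<delta>: "\<delta> > 0"
    and t: "t = (3/20) * l / sqrt (real d)" "t \<le> \<delta>" and v: "norm_d d v \<ge> (199/200) * l"
  shows "(\<integral>\<^sup>+\<phi>. \<integral>\<^sup>+e. ennreal (exp (tilt d \<delta> t v \<phi> e)) \<partial>noise_measure \<delta> \<partial>sphere_measure d) \<le> ennreal (1 - (4/25) * t / \<delta>)"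
proof -
  interpret S: prob_space "sphere_measure d" by (rule prob_space_sphere_measure[OF d])
  have rd: "sqrt (real d) > 0" using d by simp
  have t0: "t > 0" using l rd t by simp
  \<comment> \<open>A is the factor of a relevant constraint that v satisfies. C belongs to a
    violation by t/2, for which the penalty is (4/t) (t/2) = 2.\<close>
  define A where "A = exp ((77/1000)::real)"
  define C where "C = exp ((77/1000) - 2 :: real)"
  have AC: "0 < A" "0 < C" "C \<le> A" "A \<le> (108343/100000)" "C \<le> (343/2500) * A"
    using exp_numeric by (auto simp: A_def C_def)
  define D where "D = {\<phi> \<in> sphere_d d. \<bar>inner_d d v \<phi>\<bar> \<le> (3/2) * t}"
  \<comment> \<open>g is the noise average if one end is known to pay, and h is the surplus if
    neither is, which concerns only directions in D.\<close>
  define g where "g = (2 * (\<delta> - t) + t * (A + C)) / (2 * \<delta>)"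
  define h where "h = t * (A - C) / (2 * \<delta>)"
  have gh: "g \<ge> 0" "h \<ge> 0"
    unfolding g_def h_def using t(2) t0 \<delta> AC
    by (auto intro!: divide_nonneg_pos add_nonneg_nonneg mult_nonneg_nonneg)
  have meas [measurable]: "(\<lambda>e. ennreal (exp (tilt d \<delta> t v \<phi> e))) \<in> borel_measurable borel" for \<phi>
    unfolding tilt_def by measurable
  have A_bound: "ennreal (exp (tilt d \<delta> t v \<phi> e)) \<le> ennreal A" for \<phi> e
    using t0 by (auto simp: tilt_def A_def intro!: ennreal_leI)
  have mid: "ennreal (exp (tilt d \<delta> t v \<phi> e)) \<le> 1" if "\<bar>e\<bar> < \<delta> - t" for \<phi> e
    using that by (simp add: tilt_def)
  have C_bound: "ennreal (exp (tilt d \<delta> t v \<phi> e)) \<le> ennreal C"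
    if "\<delta> - t \<le> \<bar>e\<bar>" "\<delta> + t / 2 \<le> \<bar>inner_d d v \<phi> - e\<bar>" for \<phi> e
  proof -
    have "2 \<le> 4 * max 0 (\<bar>inner_d d v \<phi> - e\<bar> - \<delta>) / t"
      using that t0 by (simp add: pos_le_divide_eq)
    moreover have "tilt d \<delta> t v \<phi> e = (77/1000) - 4 * max 0 (\<bar>inner_d d v \<phi> - e\<bar> - \<delta>) / t"
      using that(1) by (simp only: tilt_def if_True)
    ultimately have "tilt d \<delta> t v \<phi> e \<le> (77/1000) - 2" by linarith
    then show ?thesis by (simp only: C_def ennreal_leI exp_le_cancel_iff)
  qed
  have step: "(\<integral>\<^sup>+e. ennreal (exp (tilt d \<delta> t v \<phi> e)) \<partial>noise_measure \<delta>) \<le> ennreal g + ennreal h * indicator D \<phi>"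
    if \<phi>: "\<phi> \<in> space (sphere_measure d)" for \<phi>
  proof (cases "\<phi> \<in> D")
    case True
    have "(\<integral>\<^sup>+e. ennreal (exp (tilt d \<delta> t v \<phi> e)) \<partial>noise_measure \<delta>) \<le> ennreal ((2 * (\<delta> - t) + t * (A + A)) / (2 * \<delta>))"
      by (intro noise_integral_le \<delta> less_imp_le[OF t0] t(2) less_imp_le[OF AC(1)] meas mid A_bound)
    also have "(2 * (\<delta> - t) + t * (A + A)) / (2 * \<delta>) = g + h"
      by (simp add: g_def h_def add_divide_distrib[symmetric] algebra_simps)
    finally show ?thesis using True gh by simp
  next
    case False
    then have big: "\<bar>inner_d d v \<phi>\<bar> > t + t / 2" using \<phi> by (simp add: D_def)
    show ?thesis
    proof (cases "inner_d d v \<phi> \<ge> 0")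
      \<comment> \<open>For an inner product above 3t/2, a noise value at most - (\<delta> - t)
        gives a difference of at least 3t/2 + \<delta> - t = \<delta> + t/2; the negative case
        mirrors this at the other end.\<close>
      case pos: True
      have "(\<integral>\<^sup>+e. ennreal (exp (tilt d \<delta> t v \<phi> e)) \<partial>noise_measure \<delta>) \<le> ennreal ((2 * (\<delta> - t) + t * (C + A)) / (2 * \<delta>))"
      proof (rule noise_integral_le)
        fix e assume e: "e \<le> - (\<delta> - t)"
        show "ennreal (exp (tilt d \<delta> t v \<phi> e)) \<le> ennreal C"
          by (rule C_bound) (use e big pos t(2) in linarith)+
      qed (intro \<delta> less_imp_le[OF t0] t(2) less_imp_le[OF AC(1)] less_imp_le[OF AC(2)] meas mid A_bound; assumption?)+
      then show ?thesis using False by (simp add: g_def add.commute)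
    next
      case neg: False
      have "(\<integral>\<^sup>+e. ennreal (exp (tilt d \<delta> t v \<phi> e)) \<partial>noise_measure \<delta>) \<le> ennreal ((2 * (\<delta> - t) + t * (A + C)) / (2 * \<delta>))"
      proof (rule noise_integral_le)
        fix e assume e: "e \<ge> \<delta> - t"
        show "ennreal (exp (tilt d \<delta> t v \<phi> e)) \<le> ennreal C"
          by (rule C_bound) (use e big neg t(2) in linarith)+
      qed (intro \<delta> less_imp_le[OF t0] t(2) less_imp_le[OF AC(1)] less_imp_le[OF AC(2)] meas mid A_bound; assumption?)+
      then show ?thesis using False by (simp add: g_def)
    qed
  qed
  have Dm: "D \<in> sets (sphere_measure d)" unfolding D_def by (rule sets_sphere_slab)
  have D: "emeasure (sphere_measure d) D \<le> ennreal (11759/25000)"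
  proof -
    have nv: "norm_d d v > 0" using v l by linarith
    have "emeasure (sphere_measure d) D \<le> ennreal ((52/25) * sqrt (real d) * ((3/2) * t) / norm_d d v)"
      unfolding D_def using nv t0 by (intro sphere_small_ball d) auto
    also have "\<dots> \<le> ennreal (11759/25000)"
    proof (rule ennreal_leI)
      \<comment> \<open>(52/25) (3/2) (3/20) = 117/250; dividing by 199/200 gives slightly less than
        11759/25000.\<close>
      have "(52/25) * sqrt (real d) * ((3/2) * t) = (117/250) * l" using rd by (simp add: t(1))
      also have "\<dots> \<le> (11759/25000) * norm_d d v" using v l by linarith
      finally show "(52/25) * sqrt (real d) * ((3/2) * t) / norm_d d v \<le> (11759/25000)"
        using nv by (simp add: pos_divide_le_eq)
    qed
    finally show ?thesis .
  qed
  have "(\<integral>\<^sup>+\<phi>. \<integral>\<^sup>+e. ennreal (exp (tilt d \<delta> t v \<phi> e)) \<partial>noise_measure \<delta> \<partial>sphere_measure d)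
      \<le> (\<integral>\<^sup>+\<phi>. ennreal g + ennreal h * indicator D \<phi> \<partial>sphere_measure d)"
    by (rule nn_integral_mono) (rule step)
  also have "\<dots> = ennreal g + ennreal h * emeasure (sphere_measure d) D"
    using Dm by (simp add: nn_integral_add nn_integral_cmult S.emeasure_space_1[simplified])
  also have "\<dots> \<le> ennreal g + ennreal h * ennreal (11759/25000)"
    by (intro add_left_mono mult_left_mono D) simp
  also have "\<dots> = ennreal (g + h * (11759/25000))"
    using gh by (simp add: ennreal_mult[symmetric] ennreal_plus[symmetric] del: ennreal_plus)
  also have "\<dots> \<le> ennreal (1 - (4/25) * t / \<delta>)"
  proof (rule ennreal_leI)
    \<comment> \<open>36759/25000 and 13241/25000 are 1 + p and 1 - p for p = 11759/25000. The gap 2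
      - 42/25 = 8/25, divided by 2 \<delta>, produces the rate 4/25.\<close>
    have "A * (36759 / 25000) + C * (13241 / 25000) \<le> 42 / 25" using AC by linarith
    then have "A * (1 + (11759/25000)) + C * (1 - (11759/25000)) \<le> (42/25)" by simp
    then have H: "t * (A * (1 + (11759/25000)) + C * (1 - (11759/25000))) \<le> t * (42/25)"
      using t0 by (intro mult_left_mono) auto
    have eq: "2 * (\<delta> - t) + t * (A + C) + t * (A - C) * r = 2 * \<delta> - 2 * t + t * (A * (1 + r) + C * (1 - r))" for r
      by (simp add: algebra_simps)
    have "2 * (\<delta> - t) + t * (A + C) + t * (A - C) * (11759/25000) \<le> 2 * \<delta> - (8/25) * t"
      unfolding eq using H by linarith
    moreover have "g + h * (11759/25000) = (2 * (\<delta> - t) + t * (A + C) + t * (A - C) * (11759/25000)) / (2 * \<delta>)"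
      by (simp add: g_def h_def add_divide_distrib)
    moreover have "(2 * \<delta> - (8/25) * t) / (2 * \<delta>) = 1 - (4/25) * t / \<delta>"
      using \<delta> by (simp add: field_simps)
    ultimately show "g + h * (11759/25000) \<le> 1 - (4/25) * t / \<delta>"
      using \<delta> by (metis divide_right_mono less_imp_le mult_pos_pos zero_less_numeral)
  qed
  finally show ?thesis .
qed

text \<open>A violation at v is at most the absolute inner product of v - u with the measurement vector, whose
  mean square over the box is s^2/3. Jensen's inequality appears as the tangent line of the exponential.
  The value of k is a rational substitute for s / sqrt 3.\<close>

lemma tilt_lower:
  assumes s: "s > 0" and t: "t = 30 * s"
    and \<phi>: "\<And>n. n < N \<Longrightarrow> \<phi> n \<in> sphere_d d" and u: "u \<in> P_set d N \<delta> \<phi> e"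
  shows "ennreal ((2 * s) ^ d) \<le> (\<integral>\<^sup>+v. indicator (box_d d u s) v * ennreal (exp (\<Sum>n<N. tilt d \<delta> t v (\<phi> n) (e n))) \<partial>lebesgue_d d)"
proof -
  let ?L = "lebesgue_d d"
  define k where "k = (577/1000) * s"
  \<comment> \<open>From |y| \<le> (y^2 / k + k) / 2: a is the resulting coefficient of y^2 in the
    penalty 4 |y| / t, and b is what the constant part leaves of 77/1000.\<close>
  define a where "a = 4 / t / (2 * k)"
  define b where "b = (77/1000) - 4 / t * k / 2"
  define I where "I = {n \<in> {..<N}. \<delta> - t \<le> \<bar>e n\<bar>}"
  define m where "m = real (card I)"
  define y where "y n v = inner_d d v (\<phi> n) - inner_d d u (\<phi> n)" for n v
  have I: "finite I" by (simp add: I_def)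
  have k0: "k > 0" and t0: "t > 0" using s t by (auto simp: k_def)
  have a0: "a > 0" using k0 t0 by (simp add: a_def)
  \<comment> \<open>This inequality fixes 77/1000: for t = 30 s the penalty at the root mean square
    is (4/30) / sqrt 3, about 0.07698, so the averaged tilt is still nonnegative.\<close>
  have b: "a * (s\<^sup>2 / 3) \<le> b"
    using s unfolding a_def b_def k_def t by (simp add: field_simps power2_eq_square)
  have b0: "b \<ge> 0" using a0 b by (meson divide_nonneg_nonneg less_imp_le mult_nonneg_nonneg order_trans zero_le_numeral zero_le_power2)
  have point: "1 + m * b \<le> exp (\<Sum>n<N. tilt d \<delta> t v (\<phi> n) (e n)) + (\<Sum>n\<in>I. a * (y n v)\<^sup>2)" for v
  proof -
    have ge: "b - a * (y n v)\<^sup>2 \<le> tilt d \<delta> t v (\<phi> n) (e n)" if n: "n \<in> I" for n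
    proof -
      have "\<bar>inner_d d u (\<phi> n) - e n\<bar> \<le> \<delta>" using u n by (simp add: P_set_def I_def)
      then have "max 0 (\<bar>inner_d d v (\<phi> n) - e n\<bar> - \<delta>) \<le> \<bar>y n v\<bar>" by (simp add: y_def)
      also have "\<bar>y n v\<bar> \<le> ((y n v)\<^sup>2 / k + k) / 2"
      proof -
        have "0 \<le> (\<bar>y n v\<bar> - k)\<^sup>2 / k" using k0 by simp
        also have "(\<bar>y n v\<bar> - k)\<^sup>2 = (y n v)\<^sup>2 + k * k - 2 * \<bar>y n v\<bar> * k"
          by (simp add: power2_eq_square algebra_simps)
        also have "\<dots> / k = (y n v)\<^sup>2 / k + k - 2 * \<bar>y n v\<bar>"
          using k0 by (simp add: add_divide_distrib diff_divide_distrib)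
        finally show ?thesis by simp
      qed
      finally have "4 / t * max 0 (\<bar>inner_d d v (\<phi> n) - e n\<bar> - \<delta>) \<le> 4 / t * (((y n v)\<^sup>2 / k + k) / 2)"
        using t0 by (intro mult_left_mono) auto
      moreover have "4 / t * (((y n v)\<^sup>2 / k + k) / 2) = a * (y n v)\<^sup>2 + 4 / t * k / 2"
        using k0 t0 by (simp add: a_def field_simps power2_eq_square)
      ultimately show ?thesis using n by (simp add: tilt_def I_def b_def)
    qed
    have "m * b - (\<Sum>n\<in>I. a * (y n v)\<^sup>2) = (\<Sum>n\<in>I. b - a * (y n v)\<^sup>2)"
      by (simp add: sum_subtractf m_def)
    also have "\<dots> \<le> (\<Sum>n\<in>I. tilt d \<delta> t v (\<phi> n) (e n))" by (rule sum_mono) (rule ge)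
    also have "\<dots> = (\<Sum>n<N. tilt d \<delta> t v (\<phi> n) (e n))"
      by (rule sum.mono_neutral_left) (auto simp: I_def tilt_def)
    finally show ?thesis using exp_ge_add_one_self[of "\<Sum>n<N. tilt d \<delta> t v (\<phi> n) (e n)"] by linarith
  qed
  have mv: "(\<lambda>v. inner_d d v x) \<in> borel_measurable ?L" for x
    unfolding inner_d_commute[of d _ x] by measurable
  note mv[measurable]
  have ym [measurable]: "y n \<in> borel_measurable ?L" for n unfolding y_def by measurable
  have tm [measurable]: "(\<lambda>v. tilt d \<delta> t v (\<phi> n) (e n)) \<in> borel_measurable ?L" for n
    unfolding tilt_def by measurable
  let ?X = "\<integral>\<^sup>+v. indicator (box_d d u s) v * ennreal (exp (\<Sum>n<N. tilt d \<delta> t v (\<phi> n) (e n))) \<partial>?L"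
  \<comment> \<open>The box integral of the quadratic terms. It is added to both sides since
    \<open>ennreal\<close> has no negative numbers to carry the lower bound directly.\<close>
  define K where "K = m * (a * ((2 * s) ^ d * (s\<^sup>2 / 3)))"
  have K0: "K \<ge> 0" using a0 s by (simp add: K_def m_def)
  have "ennreal ((2 * s) ^ d + K) \<le> ennreal ((1 + m * b) * (2 * s) ^ d)"
  proof (rule ennreal_leI)
    have "K = m * (a * (s\<^sup>2 / 3)) * (2 * s) ^ d" by (simp add: K_def mult_ac)
    also have "\<dots> \<le> m * b * (2 * s) ^ d"
      using b s by (intro mult_right_mono mult_left_mono) (auto simp: m_def)
    finally show "(2 * s) ^ d + K \<le> (1 + m * b) * (2 * s) ^ d" by (simp add: distrib_right)
  qed
  also have "\<dots> = (\<integral>\<^sup>+v. ennreal (1 + m * b) * indicator (box_d d u s) v \<partial>?L)"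
    using s b0 by (subst nn_integral_cmult_indicator) (auto simp: emeasure_box_d ennreal_mult m_def)
  also have "\<dots> \<le> (\<integral>\<^sup>+v. indicator (box_d d u s) v * ennreal (exp (\<Sum>n<N. tilt d \<delta> t v (\<phi> n) (e n)))
      + (\<Sum>n\<in>I. ennreal a * (indicator (box_d d u s) v * ennreal ((y n v)\<^sup>2))) \<partial>?L)"
  proof (rule nn_integral_mono)
    fix v
    have "ennreal (1 + m * b) \<le> ennreal (exp (\<Sum>n<N. tilt d \<delta> t v (\<phi> n) (e n)) + (\<Sum>n\<in>I. a * (y n v)\<^sup>2))"
      by (rule ennreal_leI[OF point])
    also have "\<dots> = ennreal (exp (\<Sum>n<N. tilt d \<delta> t v (\<phi> n) (e n))) + (\<Sum>n\<in>I. ennreal a * ennreal ((y n v)\<^sup>2))"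
      using a0 by (simp add: sum_nonneg ennreal_mult[symmetric] sum_ennreal)
    finally show "ennreal (1 + m * b) * indicator (box_d d u s) v \<le> indicator (box_d d u s) v * ennreal (exp (\<Sum>n<N. tilt d \<delta> t v (\<phi> n) (e n)))
      + (\<Sum>n\<in>I. ennreal a * (indicator (box_d d u s) v * ennreal ((y n v)\<^sup>2)))"
      by (simp add: indicator_def)
  qed
  also have "\<dots> = ?X + (\<integral>\<^sup>+v. (\<Sum>n\<in>I. ennreal a * (indicator (box_d d u s) v * ennreal ((y n v)\<^sup>2))) \<partial>?L)"
    by (rule nn_integral_add) measurable
  also have "(\<integral>\<^sup>+v. (\<Sum>n\<in>I. ennreal a * (indicator (box_d d u s) v * ennreal ((y n v)\<^sup>2))) \<partial>?L)
      = (\<Sum>n\<in>I. \<integral>\<^sup>+v. ennreal a * (indicator (box_d d u s) v * ennreal ((y n v)\<^sup>2)) \<partial>?L)"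
    by (rule nn_integral_sum) measurable
  also have "\<dots> = (\<Sum>n\<in>I. ennreal (a * ((2 * s) ^ d * (s\<^sup>2 / 3))))"
  proof (rule sum.cong[OF refl])
    fix n assume "n \<in> I"
    then have n: "norm_d d (\<phi> n) = 1" using \<phi> by (simp add: I_def sphere_d_def)
    have "(\<integral>\<^sup>+v. ennreal a * (indicator (box_d d u s) v * ennreal ((y n v)\<^sup>2)) \<partial>?L)
      = ennreal a * (\<integral>\<^sup>+v. indicator (box_d d u s) v * ennreal ((y n v)\<^sup>2) \<partial>?L)"
      by (rule nn_integral_cmult) measurable
    also have "\<dots> = ennreal (a * ((2 * s) ^ d * (s\<^sup>2 / 3)))"
      unfolding y_def box_second_moment[OF s n] using a0 s by (simp add: ennreal_mult[symmetric])
    finally show "(\<integral>\<^sup>+v. ennreal a * (indicator (box_d d u s) v * ennreal ((y n v)\<^sup>2)) \<partial>?L)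
      = ennreal (a * ((2 * s) ^ d * (s\<^sup>2 / 3)))" .
  qed
  also have "\<dots> = ennreal K"
    using a0 s by (simp add: K_def m_def ennreal_of_nat_eq_real_of_nat ennreal_mult[symmetric])
  \<comment> \<open>K is finite, so it may be cancelled.\<close>
  finally have "ennreal K + ennreal ((2 * s) ^ d) \<le> ennreal K + ?X"
    using K0 s by (simp add: add.commute)
  then show ?thesis by (simp add: ennreal_add_left_cancel_le)
qed

text \<open>The hypothesis lets the two noise bands of width \<tau> fit into [-\<delta>, \<delta>],
  which limits l to (20/3) \<delta> sqrt d. The rate is (4/25) (3/20) = 3/125.\<close>

lemma near_tail_bound:
  assumes d: "d \<ge> 1" and \<delta>: "\<delta> > 0" and l: "l > 0" and t: "(3/20) * l / sqrt (real d) \<le> \<delta>"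
  shows "tail_bound d N \<delta> l (ennreal (416 ^ d * (1 - (3/125) * l / (sqrt (real d) * \<delta>)) ^ N))"
proof -
  let ?L = "lebesgue_d d"
  define \<tau> where "\<tau> = (3/20) * l / sqrt (real d)"
  \<comment> \<open>This is \<tau>/30, the ratio that \<open>tilt_lower\<close> asks for; the box
    then stays within l/200 of its centre, which gives the shell B.\<close>
  define s where "s = l / (200 * sqrt (real d))"
  have rd: "sqrt (real d) > 0" using d by simp
  have s: "s > 0" and \<tau>s: "\<tau> = 30 * s" using l rd by (auto simp: s_def \<tau>_def)
  have ss: "sqrt (real d) * s = (1/200) * l" using rd by (simp add: s_def)
  have \<tau>: "\<tau> \<le> \<delta>" using t by (simp add: \<tau>_def)
  define B where "B = {v \<in> space ?L. (199/200) * l \<le> norm_d d v \<and> norm_d d v \<le> (201/200) * l}"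
  define q where "q = 1 - (4/25) * \<tau> / \<delta>"
  have "(4/25) * \<tau> / \<delta> \<le> 1" using \<tau> \<delta> by (simp add: pos_divide_le_eq)
  then have q0: "q \<ge> 0" by (simp add: q_def)
  have B: "B \<in> sets ?L" unfolding B_def by measurable
  have tb: "tail_bound d N \<delta> l (ennreal (1 / (2 * s) ^ d) * (emeasure ?L B * ennreal q ^ N))"
  proof (rule tail_boundI[where G = "\<lambda>v \<phi> e. ennreal (exp (tilt d \<delta> \<tau> v \<phi> e))"])
    have [measurable]: "(\<lambda>p. inner_d d (fst p) (fst (snd p))) \<in> borel_measurable (?L \<Otimes>\<^sub>M (sphere_measure d \<Otimes>\<^sub>M borel))"
      by (rule measurable_inner_triple)
    show "(\<lambda>(v, \<phi>, e). ennreal (exp (tilt d \<delta> \<tau> v \<phi> e))) \<in> borel_measurable (?L \<Otimes>\<^sub>M (sphere_measure d \<Otimes>\<^sub>M borel))"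
      unfolding tilt_def case_prod_unfold by measurable
  next
    fix v assume "v \<in> B"
    then have "norm_d d v \<ge> (199/200) * l" by (simp add: B_def)
    then show "(\<integral>\<^sup>+\<phi>. \<integral>\<^sup>+e. ennreal (exp (tilt d \<delta> \<tau> v \<phi> e)) \<partial>noise_measure \<delta> \<partial>sphere_measure d) \<le> ennreal q"
      unfolding q_def by (intro tilt_expectation[OF d l \<delta> \<tau>_def \<tau>])
  next
    fix \<phi> :: "nat \<Rightarrow> nat \<Rightarrow> real" and e :: "nat \<Rightarrow> real" and u
    assume \<phi>: "\<And>n. n < N \<Longrightarrow> \<phi> n \<in> sphere_d d" and u: "u \<in> P_set d N \<delta> \<phi> e" "norm_d d u = l"
    have "ennreal ((2 * s) ^ d) \<le> (\<integral>\<^sup>+v. indicator (box_d d u s) v * ennreal (exp (\<Sum>n<N. tilt d \<delta> \<tau> v (\<phi> n) (e n))) \<partial>?L)"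
      by (rule tilt_lower[OF s \<tau>s \<phi> u(1)])
    also have "\<dots> \<le> (\<integral>\<^sup>+v. indicator B v * (\<Prod>n<N. ennreal (exp (tilt d \<delta> \<tau> v (\<phi> n) (e n)))) \<partial>?L)"
    proof (rule nn_integral_mono)
      fix v
      have "v \<in> B" if "v \<in> box_d d u s"
        using box_d_norm[OF that less_imp_le[OF s], unfolded ss] u(2) by (simp add: B_def)
      then show "indicator (box_d d u s) v * ennreal (exp (\<Sum>n<N. tilt d \<delta> \<tau> v (\<phi> n) (e n)))
          \<le> indicator B v * (\<Prod>n<N. ennreal (exp (tilt d \<delta> \<tau> v (\<phi> n) (e n))))"
        by (auto simp: prod_ennreal exp_sum indicator_def)
    qed
    finally show "ennreal ((2 * s) ^ d) \<le> (\<integral>\<^sup>+v. indicator B v * (\<Prod>n<N. ennreal (exp (tilt d \<delta> \<tau> v (\<phi> n) (e n)))) \<partial>?L)" .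
  qed (use d \<delta> l s B in auto)
  have "emeasure ?L B \<le> emeasure ?L (ball_d d ((201/200) * l))"
    by (intro emeasure_mono sets_ball_d) (auto simp: B_def ball_d_def)
  also have "\<dots> \<le> ennreal (((827/200) * ((201/200) * l) / sqrt (real d)) ^ d)"
    using l by (intro emeasure_ball_d_le d) simp
  finally have LB: "emeasure ?L B \<le> ennreal (((827/200) * ((201/200) * l) / sqrt (real d)) ^ d)" .
  have "ennreal (1 / (2 * s) ^ d) * (emeasure ?L B * ennreal q ^ N)
      \<le> ennreal (1 / (2 * s) ^ d) * (ennreal (((827/200) * ((201/200) * l) / sqrt (real d)) ^ d) * ennreal q ^ N)"
    by (intro mult_left_mono mult_right_mono LB) auto
  also have "\<dots> = ennreal (1 / (2 * s) ^ d * (((827/200) * ((201/200) * l) / sqrt (real d)) ^ d * q ^ N))"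
    using s l q0 by (simp add: ennreal_mult[symmetric] ennreal_power)
  also have "1 / (2 * s) ^ d * (((827/200) * ((201/200) * l) / sqrt (real d)) ^ d * q ^ N) = ((827/200) * ((201/200) * l) / sqrt (real d) / (2 * s)) ^ d * q ^ N"
    unfolding power_divide by simp
  also have "\<dots> \<le> ennreal (416 ^ d * q ^ N)"
  proof (intro ennreal_leI mult_right_mono power_mono)
    \<comment> \<open>Ball to box, l cancels: 4.135 * 1.005 * 100 is about 415.6. This is the C of
      the bound C^d.\<close>
    have eq: "(827/200) * ((201/200) * l) / sqrt (real d) / (2 * s) = (827/200) * (201/200) * 100"
      using rd l by (simp add: s_def field_simps)
    show "(827/200) * ((201/200) * l) / sqrt (real d) / (2 * s) \<le> 416" unfolding eq by simp
  qed (use l s q0 in auto)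
  finally have "tail_bound d N \<delta> l (ennreal (416 ^ d * q ^ N))" by (rule tail_bound_mono[OF tb])
  moreover have "q = 1 - (3/125) * l / (sqrt (real d) * \<delta>)" by (simp add: q_def \<tau>_def)
  ultimately show ?thesis by (simp only:)
qed

section \<open>Dyadic summation\<close>

text \<open>Telescoping: passing from level c 2^j to the next one raises the square by 3 c^2 4^j.
  Countably many levels thus replace the integral over all l.\<close>

lemma dyadic_square_bound:
  fixes x :: ennreal
  assumes c: "c > 0"
  shows "x\<^sup>2 \<le> ennreal (c\<^sup>2) + (\<Sum>j. ennreal (3 * c\<^sup>2 * 4 ^ j) * (if ennreal (c * 2 ^ j) < x then 1 else 0))"
proof (cases x)
  case top
  \<comment> \<open>At x = \<infinity> every level is exceeded and the series diverges.\<close>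
  have "(\<Sum>j::nat. ennreal (3 * c\<^sup>2)) \<le> (\<Sum>j. ennreal (3 * c\<^sup>2 * 4 ^ j) * (if ennreal (c * 2 ^ j) < x then 1 else 0))"
  proof (rule suminf_le)
    fix j :: nat
    have "3 * c\<^sup>2 * 1 \<le> 3 * c\<^sup>2 * 4 ^ j" by (intro mult_left_mono) auto
    then show "ennreal (3 * c\<^sup>2) \<le> ennreal (3 * c\<^sup>2 * 4 ^ j) * (if ennreal (c * 2 ^ j) < x then 1 else 0)"
      using top by (simp add: ennreal_leI)
  qed auto
  moreover have "(\<Sum>j::nat. ennreal (3 * c\<^sup>2)) = top"
    using c nn_integral_count_space_nat[of "\<lambda>_. ennreal (3 * c\<^sup>2)"] by (simp add: ennreal_mult_top)
  ultimately show ?thesis by (simp add: top_unique)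
next
  case (real y)
  \<comment> \<open>Truncating y at c 2^n makes an induction over the levels possible; once c 2^n
    exceeds y, the truncation disappears.\<close>
  have fin: "(min y (c * 2 ^ n))\<^sup>2 \<le> c\<^sup>2 + (\<Sum>j<n. 3 * c\<^sup>2 * 4 ^ j * (if c * 2 ^ j < y then 1 else 0))" for n
  proof (induction n)
    case 0
    have "(min y c)\<^sup>2 \<le> c\<^sup>2" using real c by (intro power_mono) auto
    then show ?case by simp
  next
    case (Suc n)
    show ?case
    proof (cases "c * 2 ^ n < y")
      case True
      have "(min y (c * 2 ^ Suc n))\<^sup>2 \<le> (c * 2 ^ Suc n)\<^sup>2" using real c by (intro power_mono) auto
      also have "\<dots> = (min y (c * 2 ^ n))\<^sup>2 + 3 * c\<^sup>2 * 4 ^ n"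
      proof -
        have "min y (c * 2 ^ n) = c * 2 ^ n" using True by simp
        moreover have "(4::real) ^ n = 2 ^ n * 2 ^ n" unfolding power_mult_distrib[symmetric] by simp
        ultimately show ?thesis by (simp add: power2_eq_square)
      qed
      finally show ?thesis using Suc True by simp
    next
      case False
      then have "y \<le> c * 2 ^ n" by simp
      also have "c * 2 ^ n \<le> c * 2 ^ Suc n" using c by simp
      finally have "min y (c * 2 ^ Suc n) = min y (c * 2 ^ n)" using False by simp
      then show ?thesis using Suc False by simp
    qed
  qed
  obtain n where "y / c < 2 ^ n" using real_arch_pow[of 2 "y / c"] by auto
  then have "y \<le> c * 2 ^ n" using c by (simp add: pos_divide_less_eq mult.commute)
  then have "y\<^sup>2 \<le> c\<^sup>2 + (\<Sum>j<n. 3 * c\<^sup>2 * 4 ^ j * (if c * 2 ^ j < y then 1 else 0))"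
    using fin[of n] by simp
  then have "ennreal (y\<^sup>2) \<le> ennreal (c\<^sup>2 + (\<Sum>j<n. 3 * c\<^sup>2 * 4 ^ j * (if c * 2 ^ j < y then 1 else 0)))"
    by (rule ennreal_leI)
  also have "\<dots> = ennreal (c\<^sup>2) + (\<Sum>j<n. ennreal (3 * c\<^sup>2 * 4 ^ j) * (if ennreal (c * 2 ^ j) < x then 1 else 0))"
  proof (subst ennreal_plus)
    have "ennreal (\<Sum>j<n. 3 * c\<^sup>2 * 4 ^ j * (if c * 2 ^ j < y then 1 else 0))
        = (\<Sum>j<n. ennreal (3 * c\<^sup>2 * 4 ^ j * (if c * 2 ^ j < y then 1 else 0)))"
      by (rule sum_ennreal[symmetric]) simp
    also have "\<dots> = (\<Sum>j<n. ennreal (3 * c\<^sup>2 * 4 ^ j) * (if ennreal (c * 2 ^ j) < x then 1 else 0))"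
      using c real by (intro sum.cong) (auto simp: ennreal_less_iff)
    finally show "ennreal (c\<^sup>2) + ennreal (\<Sum>j<n. 3 * c\<^sup>2 * 4 ^ j * (if c * 2 ^ j < y then 1 else 0))
      = ennreal (c\<^sup>2) + (\<Sum>j<n. ennreal (3 * c\<^sup>2 * 4 ^ j) * (if ennreal (c * 2 ^ j) < x then 1 else 0))"
      by simp
  qed (auto intro: sum_nonneg)
  also have "\<dots> \<le> ennreal (c\<^sup>2) + (\<Sum>j. ennreal (3 * c\<^sup>2 * 4 ^ j) * (if ennreal (c * 2 ^ j) < x then 1 else 0))"
    by (intro add_left_mono sum_le_suminf) auto
  finally show ?thesis using real by (simp add: ennreal_power)
qed

text \<open>Each level indicator is replaced by its measurable majorant. X is left general because
  the chain is applied both to W and to W capped at m.\<close>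

lemma dyadic_chain:
  fixes X :: "'a \<Rightarrow> ennreal"
  assumes c: "c > 0"
    and tb: "\<And>j. \<exists>F\<in>borel_measurable M. (AE \<omega> in M. ennreal (c * 2 ^ j) < X \<omega> \<longrightarrow> 1 \<le> F \<omega>) \<and> (\<integral>\<^sup>+\<omega>. F \<omega> \<partial>M) \<le> p j"
  shows "\<exists>H\<in>borel_measurable M. (AE \<omega> in M. (X \<omega>)\<^sup>2 \<le> ennreal (c\<^sup>2) + H \<omega>) \<and>
    (\<integral>\<^sup>+\<omega>. H \<omega> \<partial>M) \<le> (\<Sum>j. ennreal (3 * c\<^sup>2 * 4 ^ j) * p j)"
proof -
  from tb obtain F where F [measurable]: "\<And>j. F j \<in> borel_measurable M"
    and ae: "\<And>j. AE \<omega> in M. ennreal (c * 2 ^ j) < X \<omega> \<longrightarrow> 1 \<le> F j \<omega>"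
    and int: "\<And>j. (\<integral>\<^sup>+\<omega>. F j \<omega> \<partial>M) \<le> p j" by metis
  define H where "H \<omega> = (\<Sum>j. ennreal (3 * c\<^sup>2 * 4 ^ j) * F j \<omega>)" for \<omega>
  have "H \<in> borel_measurable M" unfolding H_def by measurable
  moreover have "AE \<omega> in M. (X \<omega>)\<^sup>2 \<le> ennreal (c\<^sup>2) + H \<omega>"
  proof -
    have "AE \<omega> in M. \<forall>j. ennreal (c * 2 ^ j) < X \<omega> \<longrightarrow> 1 \<le> F j \<omega>"
      using ae by (simp add: AE_all_countable)
    then show ?thesis
    proof eventually_elim
      case (elim \<omega>)
      have "(\<Sum>j. ennreal (3 * c\<^sup>2 * 4 ^ j) * (if ennreal (c * 2 ^ j) < X \<omega> then 1 else 0)) \<le> H \<omega>"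
        unfolding H_def using elim by (intro suminf_le mult_left_mono) auto
      with dyadic_square_bound[OF c, of "X \<omega>"] show ?case
        by (meson add_left_mono order_trans)
    qed
  qed
  moreover have "(\<integral>\<^sup>+\<omega>. H \<omega> \<partial>M) \<le> (\<Sum>j. ennreal (3 * c\<^sup>2 * 4 ^ j) * p j)"
  proof -
    have "(\<integral>\<^sup>+\<omega>. H \<omega> \<partial>M) = (\<Sum>j. \<integral>\<^sup>+\<omega>. ennreal (3 * c\<^sup>2 * 4 ^ j) * F j \<omega> \<partial>M)"
      unfolding H_def by (rule nn_integral_suminf) measurable
    also have "\<dots> = (\<Sum>j. ennreal (3 * c\<^sup>2 * 4 ^ j) * (\<integral>\<^sup>+\<omega>. F j \<omega> \<partial>M))"
      by (intro suminf_cong nn_integral_cmult) measurable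
    also have "\<dots> \<le> (\<Sum>j. ennreal (3 * c\<^sup>2 * 4 ^ j) * p j)"
      by (intro suminf_le mult_left_mono int) auto
    finally show ?thesis .
  qed
  ultimately show ?thesis by blast
qed

lemma EW2_le_one_chain:
  assumes d: "d \<ge> 1" and \<delta>: "\<delta> > 0" and c: "c > 0"
    and tb: "\<And>j. tail_bound d N \<delta> (c * 2 ^ j) (p j)"
  shows "EW2 d N \<delta> \<le> ennreal (c\<^sup>2) + (\<Sum>j. ennreal (3 * c\<^sup>2 * 4 ^ j) * p j)"
proof -
  let ?J = "joint_measure d N \<delta>"
  interpret J: prob_space ?J by (rule prob_space_joint_measure[OF d \<delta>])
  from dyadic_chain[OF c tb[unfolded tail_bound_def]] obtain H where H: "H \<in> borel_measurable ?J"
    "AE \<omega> in ?J. (W d N \<delta> \<omega>)\<^sup>2 \<le> ennreal (c\<^sup>2) + H \<omega>"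
    "(\<integral>\<^sup>+\<omega>. H \<omega> \<partial>?J) \<le> (\<Sum>j. ennreal (3 * c\<^sup>2 * 4 ^ j) * p j)" by blast
  have "EW2 d N \<delta> \<le> (\<integral>\<^sup>+\<omega>. ennreal (c\<^sup>2) + H \<omega> \<partial>?J)"
    unfolding EW2_def using H(2) by (rule nn_integral_mono_AE)
  also have "\<dots> = ennreal (c\<^sup>2) + (\<integral>\<^sup>+\<omega>. H \<omega> \<partial>?J)"
    using H(1) by (subst nn_integral_add) (auto simp: J.emeasure_space_1)
  finally show ?thesis using H(3) by (meson add_left_mono order_trans)
qed

text \<open>Where W \<le> m, W equals its cap at m, whose chain needs only the levels below m. Where
  W > m, the far chain applies, and its base cost b^2 is charged only to this event, whence the
  factor r.\<close>

lemma EW2_le_two_chains: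
  assumes d: "d \<ge> 1" and \<delta>: "\<delta> > 0" and c: "c > 0" and b: "b > 0"
    and near: "\<And>j. c * 2 ^ j < m \<Longrightarrow> tail_bound d N \<delta> (c * 2 ^ j) (p j)"
    and mid: "tail_bound d N \<delta> m r"
    and far: "\<And>j. tail_bound d N \<delta> (b * 2 ^ j) (q j)"
  shows "EW2 d N \<delta> \<le> ennreal (c\<^sup>2) + (\<Sum>j. ennreal (3 * c\<^sup>2 * 4 ^ j) * p j)
     + ennreal (b\<^sup>2) * r + (\<Sum>j. ennreal (3 * b\<^sup>2 * 4 ^ j) * q j)"
proof -
  let ?J = "joint_measure d N \<delta>"
  interpret J: prob_space ?J by (rule prob_space_joint_measure[OF d \<delta>])
  have "\<exists>F\<in>borel_measurable ?J. (AE \<omega> in ?J. ennreal (c * 2 ^ j) < min (W d N \<delta> \<omega>) (ennreal m) \<longrightarrow> 1 \<le> F \<omega>)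
      \<and> (\<integral>\<^sup>+\<omega>. F \<omega> \<partial>?J) \<le> p j" for j
  proof (cases "c * 2 ^ j < m")
    case True
    from near[OF this] show ?thesis unfolding tail_bound_def
      by (elim bexE conjE) (auto elim!: eventually_mono intro!: bexI)
  next
    case False
    \<comment> \<open>The capped variable never exceeds a level from m on, so 0 is a majorant
      there.\<close>
    then have "\<not> ennreal (c * 2 ^ j) < ennreal m" by (simp add: ennreal_leI not_less)
    then show ?thesis by (intro bexI[where x = "\<lambda>_. 0"]) auto
  qed
  from dyadic_chain[OF c this] obtain H where H: "H \<in> borel_measurable ?J"
    "AE \<omega> in ?J. (min (W d N \<delta> \<omega>) (ennreal m))\<^sup>2 \<le> ennreal (c\<^sup>2) + H \<omega>"
    "(\<integral>\<^sup>+\<omega>. H \<omega> \<partial>?J) \<le> (\<Sum>j. ennreal (3 * c\<^sup>2 * 4 ^ j) * p j)" by blast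
  from dyadic_chain[OF b far[unfolded tail_bound_def]] obtain K where K: "K \<in> borel_measurable ?J"
    "AE \<omega> in ?J. (W d N \<delta> \<omega>)\<^sup>2 \<le> ennreal (b\<^sup>2) + K \<omega>"
    "(\<integral>\<^sup>+\<omega>. K \<omega> \<partial>?J) \<le> (\<Sum>j. ennreal (3 * b\<^sup>2 * 4 ^ j) * q j)" by blast
  from mid obtain F where F: "F \<in> borel_measurable ?J"
    "AE \<omega> in ?J. ennreal m < W d N \<delta> \<omega> \<longrightarrow> 1 \<le> F \<omega>" "(\<integral>\<^sup>+\<omega>. F \<omega> \<partial>?J) \<le> r"
    unfolding tail_bound_def by blast
  note [measurable] = H(1) K(1) F(1)
  have "EW2 d N \<delta> \<le> (\<integral>\<^sup>+\<omega>. ennreal (c\<^sup>2) + H \<omega> + ennreal (b\<^sup>2) * F \<omega> + K \<omega> \<partial>?J)"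
    unfolding EW2_def
  proof (rule nn_integral_mono_AE)
    show "AE \<omega> in ?J. (W d N \<delta> \<omega>)\<^sup>2 \<le> ennreal (c\<^sup>2) + H \<omega> + ennreal (b\<^sup>2) * F \<omega> + K \<omega>"
      using H(2) K(2) F(2)
    proof eventually_elim
      case (elim \<omega>)
      show ?case
      proof (cases "ennreal m < W d N \<delta> \<omega>")
        case True
        with elim have "ennreal (b\<^sup>2) * 1 \<le> ennreal (b\<^sup>2) * F \<omega>" by (intro mult_left_mono) auto
        then have "ennreal (b\<^sup>2) + K \<omega> \<le> (ennreal (c\<^sup>2) + H \<omega> + ennreal (b\<^sup>2) * F \<omega>) + K \<omega>"
          by (intro add_right_mono add_increasing) auto
        with elim(2) show ?thesis by (rule order_trans)
      next
        case False
        with elim(1) have "(W d N \<delta> \<omega>)\<^sup>2 \<le> ennreal (c\<^sup>2) + H \<omega>" by (simp add: min_def not_less)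
        then show ?thesis by (rule order_trans) (intro add_increasing2 zero_le order_refl)
      qed
    qed
  qed
  also have "\<dots> = ennreal (c\<^sup>2) + (\<integral>\<^sup>+\<omega>. H \<omega> \<partial>?J) + ennreal (b\<^sup>2) * (\<integral>\<^sup>+\<omega>. F \<omega> \<partial>?J) + (\<integral>\<^sup>+\<omega>. K \<omega> \<partial>?J)"
    by (simp add: nn_integral_add nn_integral_cmult J.emeasure_space_1)
  also have "\<dots> \<le> ennreal (c\<^sup>2) + (\<Sum>j. ennreal (3 * c\<^sup>2 * 4 ^ j) * p j)
     + ennreal (b\<^sup>2) * r + (\<Sum>j. ennreal (3 * b\<^sup>2 * 4 ^ j) * q j)"
    by (intro add_mono mult_left_mono H(3) K(3) F(3)) auto
  finally show ?thesis .
qed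

lemma suminf_ennreal_half:
  assumes "M \<ge> 0"
  shows "(\<Sum>j. ennreal (M * (1/2) ^ j)) = ennreal (2 * M)"
proof (rule suminf_ennreal_eq)
  show "(\<lambda>j. M * (1/2) ^ j) sums (2 * M)"
    using sums_mult[OF geometric_sums[of "1/2::real"], of M] by (simp add: mult.commute)
qed (use assms in auto)

text \<open>At l = 14 \<delta> w 2^j, l + \<delta> and l - \<delta> are bounded by 15 and 13 times
  \<delta> w 2^j. This produces 32 from 15 * 5221/2500 and 12/25 from (156/25) / 13.\<close>

lemma far_sum:
  assumes d: "d \<ge> 1" and \<delta>: "\<delta> > 0" and N: "N \<ge> d + 2"
  defines "b \<equiv> 14 * \<delta> * sqrt (real d)"
  shows "\<exists>q. (\<forall>j. tail_bound d N \<delta> (b * 2 ^ j) (q j)) \<and>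
    (\<Sum>j. ennreal (3 * b\<^sup>2 * 4 ^ j) * q j)
      \<le> ennreal (168 * \<delta>\<^sup>2 * real d * sqrt (real d) * (32 * sqrt (real d)) ^ d * (12/25) ^ N)"
proof -
  define w where "w = sqrt (real d)"
  have w: "w \<ge> 1" and ww: "w\<^sup>2 = real d" using d by (auto simp: w_def)
  define Q where "Q j = (32 * w * 2 ^ j) ^ d * (w / (7 * 2 ^ j)) * (12/25 / 2 ^ j) ^ N" for j :: nat
  define M where "M = 84 * \<delta>\<^sup>2 * real d * w * (32 * w) ^ d * (12/25) ^ N"
  have M: "M \<ge> 0" using w by (simp add: M_def)
  have Q0: "Q j \<ge> 0" for j using w by (simp add: Q_def)
  have "tail_bound d N \<delta> (b * 2 ^ j) (ennreal (Q j))" for j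
  proof -
    define l where "l = b * 2 ^ j"
    have two: "(2::real) ^ j \<ge> 1" by simp
    have wj: "w * 2 ^ j \<ge> 1" using mult_mono[OF w two] w by simp
    have l: "l = 14 * (\<delta> * (w * 2 ^ j))" by (simp add: l_def b_def w_def)
    have dl: "\<delta> \<le> \<delta> * (w * 2 ^ j)" using mult_left_mono[OF wj, of \<delta>] \<delta> by simp
    have \<delta>l: "\<delta> < l" using dl \<delta> l by linarith
    have "tail_bound d N \<delta> l (ennreal (((5221/2500) * (l + \<delta>) / \<delta>) ^ d * (2 * \<delta> * real d / (l + \<delta>)) * ((156/25) * w * \<delta> / (l - \<delta>)) ^ N))"
      using far_tail_bound[OF d \<delta> \<delta>l] by (simp add: w_def)
    moreover have "((5221/2500) * (l + \<delta>) / \<delta>) ^ d * (2 * \<delta> * real d / (l + \<delta>)) * ((156/25) * w * \<delta> / (l - \<delta>)) ^ N \<le> Q j"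
      unfolding Q_def
    proof (intro mult_mono power_mono)
      have "l + \<delta> \<le> 15 * (\<delta> * (w * 2 ^ j))" using dl l by linarith
      then have "(l + \<delta>) / \<delta> \<le> 15 * (w * 2 ^ j)" using \<delta> by (simp add: pos_divide_le_eq mult_ac)
      then have "(5221/2500) * ((l + \<delta>) / \<delta>) \<le> (5221/2500) * (15 * (w * 2 ^ j))"
        by (intro mult_left_mono) auto
      also have "\<dots> \<le> 32 * (w * 2 ^ j)" using wj by simp
      finally show "(5221/2500) * (l + \<delta>) / \<delta> \<le> 32 * w * 2 ^ j"
        by (simp only: mult.assoc times_divide_eq_right)
      have "2 * \<delta> * real d / (l + \<delta>) \<le> 2 * \<delta> * real d / l"
        using \<delta> \<delta>l by (intro divide_left_mono) auto
      also have "\<dots> = w / (7 * 2 ^ j)"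
        using \<delta> w by (simp add: l ww[symmetric] power2_eq_square field_simps)
      finally show "2 * \<delta> * real d / (l + \<delta>) \<le> w / (7 * 2 ^ j)" .
      have "13 * (\<delta> * (w * 2 ^ j)) \<le> l - \<delta>" using dl l by linarith
      then have "(156/25) * w * \<delta> / (l - \<delta>) \<le> (156/25) * w * \<delta> / (13 * (\<delta> * (w * 2 ^ j)))"
        using \<delta> w \<delta>l by (intro divide_left_mono) auto
      also have "\<dots> = 12/25 / 2 ^ j" using \<delta> w by (simp add: field_simps)
      finally show "(156/25) * w * \<delta> / (l - \<delta>) \<le> 12/25 / 2 ^ j" .
    qed (use \<delta> \<delta>l w in auto)
    ultimately show ?thesis
      unfolding l_def[symmetric] by (auto intro: tail_bound_mono ennreal_leI)
  qed
  moreover have "(\<Sum>j. ennreal (3 * b\<^sup>2 * 4 ^ j) * ennreal (Q j)) \<le> (\<Sum>j. ennreal (M * (1/2) ^ j))"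
  proof (intro suminf_le)
    fix j :: nat
    have four: "(4::real) ^ j = 2 ^ j * 2 ^ j" unfolding power_mult_distrib[symmetric] by simp
    define z where "z = (2::real) ^ j"
    have z: "z \<ge> 1" by (simp add: z_def)
    have b2: "3 * b\<^sup>2 = 588 * \<delta>\<^sup>2 * real d" by (simp add: b_def power_mult_distrib)
    \<comment> \<open>The powers of 2^j add up to 2 + d - 1 - N; the condition N \<ge> d + 2 makes
      this at most -1, so the terms decay like (1/2)^j.\<close>
    have zN: "z ^ d * z * z \<le> z ^ N"
      using power_increasing[OF N z] by (simp add: power2_eq_square power_add mult_ac)
    have "3 * b\<^sup>2 * 4 ^ j * Q j = M * (z ^ d * z / z ^ N)"
      unfolding b2 four Q_def M_def z_def[symmetric] using z by (simp add: power_mult_distrib power_divide field_simps)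
    also have "z ^ d * z / z ^ N \<le> 1 / z"
      using zN z by (simp add: pos_divide_le_eq pos_le_divide_eq)
    also have "1 / z = (1/2) ^ j" by (simp add: z_def power_one_over)
    finally have "3 * b\<^sup>2 * 4 ^ j * Q j \<le> M * (1/2) ^ j" using M by (simp add: mult_left_mono)
    then show "ennreal (3 * b\<^sup>2 * 4 ^ j) * ennreal (Q j) \<le> ennreal (M * (1/2) ^ j)"
      using Q0 by (simp add: ennreal_mult[symmetric] ennreal_leI)
  qed auto
  moreover have "(\<Sum>j. ennreal (M * (1/2) ^ j))
      = ennreal (168 * \<delta>\<^sup>2 * real d * sqrt (real d) * (32 * sqrt (real d)) ^ d * (12/25) ^ N)"
    unfolding suminf_ennreal_half[OF M] by (simp add: M_def w_def)
  ultimately show ?thesis by (intro exI[where x = "\<lambda>j. ennreal (Q j)"]) auto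
qed

text \<open>The factor 400 in c makes the exponent at level j equal to (3/125) 400 d 2^j = (48/5) d
  2^j, enough to beat 416^d already at j = 0. All higher levels together then add at most
  c^2/3.\<close>

lemma near_sum:
  assumes d: "d \<ge> 1" and \<delta>: "\<delta> > 0" and N: "N \<ge> 1"
  defines "c \<equiv> 400 * \<delta> * real d * sqrt (real d) / real N"
  shows "\<exists>p. (\<forall>j. c * 2 ^ j < 20/3 * \<delta> * sqrt (real d) \<longrightarrow> tail_bound d N \<delta> (c * 2 ^ j) (p j)) \<and>
    ennreal (c\<^sup>2) + (\<Sum>j. ennreal (3 * c\<^sup>2 * 4 ^ j) * p j) \<le> ennreal (4/3 * c\<^sup>2)"
proof -
  define w where "w = sqrt (real d)"
  have w: "w \<ge> 1" using d by (auto simp: w_def)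
  \<comment> \<open>1/7600 bounds exp (-9). For the further levels the much weaker ratio 1/8
    suffices, since 4^j / 8^j is summable.\<close>
  define P where "P j = 416 * ((1/7600) * (1/8) ^ j :: real)" for j :: nat
  have P0: "P j \<ge> 0" for j by (simp add: P_def)
  have "tail_bound d N \<delta> (c * 2 ^ j) (ennreal (P j))" if j: "c * 2 ^ j < 20/3 * \<delta> * sqrt (real d)" for j
  proof -
    define l where "l = c * 2 ^ j"
    define y where "y = 3/125 * l / (w * \<delta>)"
    have N0: "real N > 0" using N by simp
    have l0: "l > 0" using \<delta> d w N0 by (simp add: l_def c_def w_def[symmetric])
    have t: "(3/20) * l / sqrt (real d) \<le> \<delta>"
      using j w unfolding l_def[symmetric] w_def[symmetric] by (simp add: pos_divide_le_eq)
    have tb: "tail_bound d N \<delta> l (ennreal (416 ^ d * (1 - y) ^ N))"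
      using near_tail_bound[OF d \<delta> l0 t] by (simp add: y_def w_def)
    have "l \<le> 20/3 * \<delta> * w" using j by (simp add: l_def w_def)
    moreover have "0 \<le> \<delta> * w" using \<delta> w by simp
    ultimately have "3/125 * l \<le> w * \<delta>" unfolding mult.commute[of w] by linarith
    then have y1: "y \<le> 1" using \<delta> w by (simp add: y_def pos_divide_le_eq)
    have yN: "y * real N = 48/5 * real d * 2 ^ j"
      using w \<delta> N0 by (simp add: y_def l_def c_def w_def[symmetric] field_simps)
    have e9: "exp (- 9 :: real) \<le> 1 / 7600"
    proof -
      have "(27/10::real) ^ 9 \<le> exp 1 ^ 9" using exp_numeric(3) by (intro power_mono) auto
      also have "exp 1 ^ 9 = exp (9::real)" by (simp add: exp_of_nat_mult[symmetric])
      finally have "7600 \<le> exp (9::real)" by (simp add: power_divide)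
      then show ?thesis by (simp add: exp_minus field_simps)
    qed
    have "(1 - y) ^ N \<le> exp (- y) ^ N"
      using exp_ge_add_one_self[of "- y"] y1 by (intro power_mono) auto
    also have "\<dots> = exp (- (48/5 * real d * 2 ^ j))"
      unfolding exp_of_nat_mult[symmetric] yN[symmetric] by simp
    \<comment> \<open>2^j \<ge> j + 1 makes the exponent linear in j, so the bound becomes
      geometric.\<close>
    also have "\<dots> \<le> exp (real d * (- 9 * real (Suc j)))"
    proof -
      have "real (Suc j) \<le> 2 ^ j" using less_exp[of j] by (metis Suc_leI of_nat_le_iff of_nat_numeral of_nat_power)
      then have "9 * real (Suc j) \<le> 48/5 * 2 ^ j" by simp
      then have "real d * (9 * real (Suc j)) \<le> real d * (48/5 * 2 ^ j)" by (intro mult_left_mono) auto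
      then show ?thesis by (simp add: algebra_simps)
    qed
    also have "\<dots> = (exp (- 9) ^ Suc j) ^ d"
      by (simp only: exp_of_nat_mult mult.commute[of "- 9 :: real"])
    finally have "416 ^ d * (1 - y) ^ N \<le> 416 ^ d * (exp (- 9) ^ Suc j) ^ d" by simp
    also have "\<dots> = (416 * exp (- 9) ^ Suc j) ^ d" by (simp add: power_mult_distrib)
    also have "\<dots> \<le> (P j) ^ d"
    proof (rule power_mono)
      have "exp (- 9 :: real) ^ j \<le> (1/8) ^ j" using e9 by (intro power_mono) auto
      with e9 have "exp (- 9) * exp (- 9 :: real) ^ j \<le> (1/7600) * (1/8) ^ j" by (intro mult_mono) auto
      then show "416 * exp (- 9) ^ Suc j \<le> P j" by (simp add: P_def)
    qed simp
    \<comment> \<open>As P j is at most 1, its d-th power is at most P j, which removes the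
      dimension.\<close>
    also have "\<dots> \<le> P j"
    proof -
      have "(1/8::real) ^ j \<le> 1" by (intro power_le_one) auto
      then have "P j \<le> 1" by (simp add: P_def)
      with power_decreasing[OF d P0[of j]] show ?thesis by simp
    qed
    finally show ?thesis using tail_bound_mono[OF tb] unfolding l_def by (simp add: ennreal_leI)
  qed
  moreover have "ennreal (c\<^sup>2) + (\<Sum>j. ennreal (3 * c\<^sup>2 * 4 ^ j) * ennreal (P j)) \<le> ennreal (4/3 * c\<^sup>2)"
  proof -
    \<comment> \<open>1248 = 3 * 416, and the geometric series doubles M; 2 * 1248 / 7600 is below
      1/3.\<close>
    define M where "M = c\<^sup>2 * (1248 / 7600)"
    have M: "M \<ge> 0" by (simp add: M_def)
    have "ennreal (3 * c\<^sup>2 * 4 ^ j) * ennreal (P j) = ennreal (M * (1/2) ^ j)" for j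
    proof -
      have "(4::real) ^ j * (1/8) ^ j = (1/2) ^ j" unfolding power_mult_distrib[symmetric] by simp
      then have "3 * c\<^sup>2 * 4 ^ j * P j = M * (1/2) ^ j" by (simp add: P_def M_def)
      then show ?thesis using P0 by (simp add: ennreal_mult[symmetric])
    qed
    then have "(\<Sum>j. ennreal (3 * c\<^sup>2 * 4 ^ j) * ennreal (P j)) = ennreal (2 * M)"
      using suminf_ennreal_half[OF M] by simp
    then have "ennreal (c\<^sup>2) + (\<Sum>j. ennreal (3 * c\<^sup>2 * 4 ^ j) * ennreal (P j)) = ennreal (c\<^sup>2 + 2 * M)"
      using M by simp
    also have "\<dots> \<le> ennreal (4/3 * c\<^sup>2)" by (intro ennreal_leI) (simp add: M_def)
    finally show ?thesis .
  qed
  ultimately show ?thesis by (intro exI[where x = "\<lambda>j. ennreal (P j)"]) auto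
qed

section \<open>Assembling the explicit bound\<close>

lemma exp_12_ge: "2 * exp (12::real) \<ge> 300000"
proof -
  have "(27/10::real) ^ 12 \<le> exp 1 ^ 12" using exp_numeric(3) by (intro power_mono) auto
  also have "exp 1 ^ 12 = exp (12::real)" by (simp add: exp_of_nat_mult[symmetric])
  finally show ?thesis by (simp add: power_divide)
qed

text \<open>For N at most 37 d the base level b of the far range already fits below the first term. For larger N
  the levels below m are controlled by the near bound, and the range between m and b is absorbed by the
  second term.\<close>

lemma EW2_bound:
  assumes d: "d \<ge> 1" and \<delta>: "\<delta> > 0" and N: "N \<ge> d + 2"
  shows "EW2 d N \<delta> \<le> ennreal (2 * exp 12 * \<delta>\<^sup>2 * real d ^ 3 / ((real N + 1) * (real N + 2))
     + 26 * \<delta>\<^sup>2 * real d * sqrt (real d) * (32 * sqrt (real d)) ^ d * sqrt (11/12) ^ N)"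
proof -
  define w where "w = sqrt (real d)"
  have w: "w \<ge> 1" and ww: "w\<^sup>2 = real d" using d by (auto simp: w_def)
  define r where "r = sqrt (11/12::real)"
  have r: "r \<ge> 957/1000" unfolding r_def by (rule real_le_rsqrt) (simp add: power2_eq_square)
  define S where "S = 26 * \<delta>\<^sup>2 * real d * w * (32 * w) ^ d * r ^ N"
  define F where "F = 2 * exp 12 * \<delta>\<^sup>2 * real d ^ 3 / ((real N + 1) * (real N + 2))"
  define b where "b = 14 * \<delta> * w"
  define T where "T = 168 * \<delta>\<^sup>2 * real d * w * (32 * w) ^ d * (12/25) ^ N"
  have pos: "S \<ge> 0" "T \<ge> 0" "F \<ge> 0" "b > 0" using w r \<delta> by (auto simp: S_def T_def F_def b_def)
  have b2: "b\<^sup>2 = 196 * \<delta>\<^sup>2 * real d" by (simp add: b_def power_mult_distrib ww)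
  have dN: "real N \<ge> real d + 2" using N by linarith
  have d1: "real d \<ge> 1" using d by simp
  from far_sum[OF d \<delta> N] obtain q where q: "\<And>j. tail_bound d N \<delta> (b * 2 ^ j) (q j)"
    "(\<Sum>j. ennreal (3 * b\<^sup>2 * 4 ^ j) * q j) \<le> ennreal T"
    unfolding b_def T_def w_def by blast
  have T_eq: "T = 168/26 * (26 * \<delta>\<^sup>2 * real d * w * (32 * w) ^ d) * (12/25) ^ N" by (simp add: T_def)
  \<comment> \<open>12/25 is smaller than 0.502 * 0.957. The far sum thus decays faster than the
    second term by the factor 251/500 per measurement, which \<open>T_le\<close> spends.\<close>
  have rN: "(12/25) ^ N \<le> (251/500) ^ N * r ^ N"
    unfolding power_mult_distrib[symmetric] using r by (intro power_mono) auto
  have T_le: "T \<le> 168/26 * (251/500) ^ k * S" if k: "k \<le> N" for k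
  proof -
    have "(251/500::real) ^ N \<le> (251/500) ^ k" using k by (intro power_decreasing) auto
    then have "(12/25) ^ N \<le> (251/500) ^ k * r ^ N"
      using rN r by (meson mult_right_mono order_trans zero_le_power le_numeral_extra(3) divide_nonneg_nonneg zero_le_numeral)
    then have "T \<le> 168/26 * (26 * \<delta>\<^sup>2 * real d * w * (32 * w) ^ d) * ((251/500) ^ k * r ^ N)"
      unfolding T_eq using w by (intro mult_left_mono) auto
    also have "\<dots> = 168/26 * (251/500) ^ k * S" by (simp add: S_def mult_ac)
    finally show ?thesis .
  qed
  have "EW2 d N \<delta> \<le> ennreal (F + S)"
  proof (cases "N \<le> 37 * d")
    case True
    have "b\<^sup>2 \<le> F"
    proof -
      have N37: "real N \<le> 37 * real d" using True by (metis of_nat_le_iff of_nat_mult of_nat_numeral)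
      \<comment> \<open>The threshold 37 comes from here: 196 * 38 * 39 is still below 300000, while
        196 * 39 * 40 is not.\<close>
      have "(real N + 1) * (real N + 2) \<le> (38 * real d) * (39 * real d)"
        using N37 d1 by (intro mult_mono) auto
      also have "(38 * real d) * (39 * real d) = 1482 * real d ^ 2" by (simp add: power2_eq_square)
      finally have "196 * ((real N + 1) * (real N + 2)) \<le> 300000 * real d ^ 2"
        using zero_le_power2[of "real d"] by linarith
      also have "\<dots> \<le> 2 * exp 12 * real d ^ 2" using exp_12_ge by (intro mult_right_mono) auto
      finally have "\<delta>\<^sup>2 * real d * (196 * ((real N + 1) * (real N + 2))) \<le> \<delta>\<^sup>2 * real d * (2 * exp 12 * real d ^ 2)"
        by (intro mult_left_mono) auto
      then have "b\<^sup>2 * ((real N + 1) * (real N + 2)) \<le> 2 * exp 12 * \<delta>\<^sup>2 * real d ^ 3"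
        unfolding b2 by (simp add: mult_ac power2_eq_square power3_eq_cube)
      then show ?thesis unfolding F_def by (subst pos_le_divide_eq) auto
    qed
    moreover have "T \<le> S"
    proof -
      have "3 \<le> N" using N d by simp
      from T_le[OF this] have "T \<le> 168/26 * (251/500) ^ 3 * S" .
      also have "\<dots> \<le> 1 * S" using pos by (intro mult_right_mono) (auto simp: power_divide)
      finally show ?thesis by simp
    qed
    ultimately have "b\<^sup>2 + T \<le> F + S" by simp
    have "EW2 d N \<delta> \<le> ennreal (b\<^sup>2) + (\<Sum>j. ennreal (3 * b\<^sup>2 * 4 ^ j) * q j)"
      by (rule EW2_le_one_chain[OF d \<delta> pos(4) q(1)])
    also have "\<dots> \<le> ennreal (b\<^sup>2) + ennreal T" by (intro add_left_mono q(2))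
    also have "\<dots> = ennreal (b\<^sup>2 + T)" using pos by simp
    also have "\<dots> \<le> ennreal (F + S)" using \<open>b\<^sup>2 + T \<le> F + S\<close> by (rule ennreal_leI)
    finally show ?thesis .
  next
    case False
    then have N37: "37 * d \<le> N" by simp
    then have N37': "37 \<le> N" and N37r: "real N \<ge> 37" using d by auto
    define c where "c = 400 * \<delta> * real d * w / real N"
    define m where "m = 20/3 * \<delta> * w"
    define R where "R = 416 ^ d * (21/25::real) ^ N"
    have c0: "c > 0" using \<delta> d w N37r by (simp add: c_def)
    have m0: "m > 0" using \<delta> w by (simp add: m_def)
    from near_sum[OF d \<delta>, of N] N37' obtain p
      where p: "\<And>j. c * 2 ^ j < m \<Longrightarrow> tail_bound d N \<delta> (c * 2 ^ j) (p j)"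
      "ennreal (c\<^sup>2) + (\<Sum>j. ennreal (3 * c\<^sup>2 * 4 ^ j) * p j) \<le> ennreal (4/3 * c\<^sup>2)"
      unfolding c_def m_def w_def by auto
    \<comment> \<open>m is the largest level of the near bound: the noise bands there have width
      exactly \<delta>, and the factor is 1 - (3/125) (20/3) = 21/25.\<close>
    have mid: "tail_bound d N \<delta> m (ennreal R)"
    proof -
      have t: "(3/20) * m / sqrt (real d) \<le> \<delta>" using w by (simp add: m_def w_def[symmetric])
      have eq: "1 - (3/125) * m / (sqrt (real d) * \<delta>) = 21/25"
        using w \<delta> by (simp add: m_def w_def[symmetric])
      show ?thesis using near_tail_bound[OF d \<delta> m0 t, of N] unfolding eq R_def .
    qed
    have cF: "4/3 * c\<^sup>2 \<le> F"
    proof -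
      have NN: "37 * real N \<le> real N * real N" using N37r by (intro mult_right_mono) auto
      have "(real N + 1) * (real N + 2) = real N * real N + 3 * real N + 2" by (simp add: algebra_simps)
      \<comment> \<open>640000/3 is (4/3) 400^2. The distance to 300000 covers the passage from N^2
        to (N + 1) (N + 2) when N \<ge> 37.\<close>
      then have "640000/3 * ((real N + 1) * (real N + 2)) \<le> 300000 * (real N * real N)"
        using NN N37r by linarith
      also have "\<dots> \<le> 2 * exp 12 * (real N * real N)" using exp_12_ge by (intro mult_right_mono) auto
      finally have "640000/3 / (real N * real N) \<le> 2 * exp 12 / ((real N + 1) * (real N + 2))"
        using N37r by (simp add: divide_simps mult_ac)
      then have "640000/3 / (real N * real N) * (\<delta>\<^sup>2 * real d ^ 3) \<le> 2 * exp 12 / ((real N + 1) * (real N + 2)) * (\<delta>\<^sup>2 * real d ^ 3)"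
        by (rule mult_right_mono) simp
      moreover have "4/3 * c\<^sup>2 = 640000/3 / (real N * real N) * (\<delta>\<^sup>2 * real d ^ 3)"
        by (simp add: c_def power_divide power_mult_distrib ww power2_eq_square[of "real N"] power3_eq_cube power2_eq_square[of "real d"])
      ultimately show ?thesis by (simp add: F_def mult_ac)
    qed
    have "b\<^sup>2 * R \<le> 4/5 * S"
    proof -
      \<comment> \<open>21/25 is split as at most 0.8778 * r. The first factor, raised to a power of
        at least 37 d, has to bring 416^d below a small multiple of 32^d; the second is the decay of
        S.\<close>
      have "(21/25) ^ N \<le> (4389/5000) ^ N * r ^ N"
        unfolding power_mult_distrib[symmetric] using r by (intro power_mono) auto
      also have "\<dots> \<le> (4389/5000) ^ (37 * d) * r ^ N"
        using N37 r by (intro mult_right_mono power_decreasing) auto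
      finally have "R \<le> 416 ^ d * ((4389/5000) ^ (37 * d) * r ^ N)" unfolding R_def by simp
      also have "\<dots> = (416 * (4389/5000) ^ 37) ^ d * r ^ N"
        by (simp add: power_mult power_mult_distrib)
      also have "\<dots> \<le> (32 * (106/1000)) ^ d * r ^ N"
        using r by (intro mult_right_mono power_mono) (auto simp: power_divide)
      also have "\<dots> = (106/1000) ^ d * (32 ^ d * r ^ N)" unfolding power_mult_distrib by simp
      also have "\<dots> \<le> (106/1000) * ((32 * w) ^ d * r ^ N)"
      proof (intro mult_mono)
        show "(106/1000::real) ^ d \<le> 106/1000" using power_decreasing[OF d, of "106/1000::real"] by simp
        show "32 ^ d \<le> (32 * w) ^ d" using w by (intro power_mono) auto
      qed (use r w in auto)
      finally have "b\<^sup>2 * R \<le> b\<^sup>2 * ((106/1000) * ((32 * w) ^ d * r ^ N))" by (intro mult_left_mono) auto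
      \<comment> \<open>b^2 is of order d while S carries d^(3/2); the missing w is at least
        1.\<close>
      also have "\<dots> \<le> b\<^sup>2 * ((106/1000) * ((32 * w) ^ d * r ^ N)) * w"
        using mult_left_mono[OF w, of "b\<^sup>2 * ((106/1000) * ((32 * w) ^ d * r ^ N))"] r w by simp
      also have "\<dots> = 20776/26000 * S" by (simp add: b2 S_def)
      also have "\<dots> \<le> 4/5 * S" using pos by (intro mult_right_mono) auto
      finally show ?thesis .
    qed
    moreover have "T \<le> 1/5 * S"
    proof -
      have "T \<le> 168/26 * (251/500) ^ 10 * S" using N37' by (intro T_le) simp
      also have "\<dots> \<le> 1/5 * S" using pos by (intro mult_right_mono) (auto simp: power_divide)
      finally show ?thesis .
    qed
    ultimately have le: "4/3 * c\<^sup>2 + b\<^sup>2 * R + T \<le> F + S" using cF by linarith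
    have R0: "R \<ge> 0" by (simp add: R_def)
    have "EW2 d N \<delta> \<le> ennreal (c\<^sup>2) + (\<Sum>j. ennreal (3 * c\<^sup>2 * 4 ^ j) * p j)
       + ennreal (b\<^sup>2) * ennreal R + (\<Sum>j. ennreal (3 * b\<^sup>2 * 4 ^ j) * q j)"
      by (rule EW2_le_two_chains[OF d \<delta> c0 pos(4) p(1) mid q(1)])
    also have "\<dots> \<le> ennreal (4/3 * c\<^sup>2) + ennreal (b\<^sup>2) * ennreal R + ennreal T"
      by (intro add_mono p(2) q(2) order_refl)
    also have "\<dots> = ennreal (4/3 * c\<^sup>2 + b\<^sup>2 * R + T)"
      using pos R0 by (simp add: ennreal_mult[symmetric] ennreal_plus[symmetric] del: ennreal_plus)
    also have "\<dots> \<le> ennreal (F + S)" using le by (rule ennreal_leI)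
    finally show ?thesis .
  qed
  then show ?thesis by (simp add: F_def S_def w_def r_def)
qed

section \<open>Closed form of the second term and limits in the dimension\<close>

lemma second_term_eq:
  assumes d: "d \<ge> 1"
  shows "26 * \<delta>\<^sup>2 * real d powr (3/2) * (11/12) powr (real N / 2) * exp (real d * ln (1024 * real d) / 2)
    = 26 * \<delta>\<^sup>2 * real d * sqrt (real d) * (32 * sqrt (real d)) ^ d * sqrt (11/12) ^ N"
proof -
  have d0: "real d > 0" using d by simp
  have 1: "real d powr (3/2) = real d * sqrt (real d)"
    using powr_add[of "real d" 1 "1/2"] d0 by (simp add: powr_half_sqrt)
  have "(11/12::real) powr (real N / 2) = ((11/12) powr (1/2)) powr real N" by (simp add: powr_powr)
  then have 2: "(11/12::real) powr (real N / 2) = sqrt (11/12) ^ N"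
    by (simp add: powr_half_sqrt powr_realpow)
  have "exp (real d * ln (1024 * real d) / 2) = exp (ln (1024 * real d) / 2) ^ d"
    by (simp add: exp_of_nat_mult[symmetric])
  also have "exp (ln (1024 * real d) / 2) = sqrt (1024 * real d)"
    using d0 by (simp add: powr_half_sqrt[symmetric] powr_def)
  also have "sqrt (1024 * real d) = 32 * sqrt (real d)"
    by (simp add: real_sqrt_mult real_sqrt_unique)
  finally show ?thesis unfolding 1 2 by simp
qed

text \<open>Both terms decrease in N, so the ceiling may be replaced by x d itself, which leaves
  limits of smooth expressions. The dominating f serves the upper limit and the vanishing limit
  alike.\<close>

lemma limit_bound:
  fixes x :: "nat \<Rightarrow> real"
  assumes \<delta>: "\<delta> > 0" and x: "eventually (\<lambda>d. x d \<ge> real d + 2) sequentially"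
    and lim1: "(\<lambda>d. real d ^ 3 / ((x d + 1) * (x d + 2))) \<longlonglongrightarrow> L"
    and lim2: "(\<lambda>d. real d powr (3/2) * (11/12) powr (x d / 2) * exp (real d * ln (1024 * real d) / 2)) \<longlonglongrightarrow> 0"
  shows "\<exists>f. eventually (\<lambda>d. EW2 d (nat \<lceil>x d\<rceil>) \<delta> \<le> f d) sequentially \<and> f \<longlonglongrightarrow> ennreal (2 * exp 12 * \<delta>\<^sup>2 * L)"
proof -
  define g where "g d = 2 * exp 12 * \<delta>\<^sup>2 * (real d ^ 3 / ((x d + 1) * (x d + 2)))
    + 26 * \<delta>\<^sup>2 * (real d powr (3/2) * (11/12) powr (x d / 2) * exp (real d * ln (1024 * real d) / 2))" for d
  have "g \<longlonglongrightarrow> 2 * exp 12 * \<delta>\<^sup>2 * L + 26 * \<delta>\<^sup>2 * 0"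
    unfolding g_def by (intro tendsto_add tendsto_mult_left lim1 lim2)
  then have "(\<lambda>d. ennreal (g d)) \<longlonglongrightarrow> ennreal (2 * exp 12 * \<delta>\<^sup>2 * L)"
    by (intro tendsto_ennrealI) simp
  moreover have "eventually (\<lambda>d. EW2 d (nat \<lceil>x d\<rceil>) \<delta> \<le> ennreal (g d)) sequentially"
    using x eventually_ge_at_top[of 1]
  proof eventually_elim
    case (elim d)
    define N where "N = nat \<lceil>x d\<rceil>"
    have xN: "x d \<le> real N" using elim by (simp add: N_def)
    have "real (d + 2) \<le> real N" using xN elim by simp
    then have "N \<ge> d + 2" by linarith
    from EW2_bound[OF elim(2) \<delta> this]
    have "EW2 d N \<delta> \<le> ennreal (2 * exp 12 * \<delta>\<^sup>2 * real d ^ 3 / ((real N + 1) * (real N + 2))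
      + 26 * \<delta>\<^sup>2 * real d powr (3/2) * (11/12) powr (real N / 2) * exp (real d * ln (1024 * real d) / 2))"
      unfolding second_term_eq[OF elim(2)] .
    also have "\<dots> \<le> ennreal (g d)"
    proof (rule ennreal_leI)
      have x0: "x d \<ge> 0" using elim by simp
      have "real d ^ 3 / ((real N + 1) * (real N + 2)) \<le> real d ^ 3 / ((x d + 1) * (x d + 2))"
        using xN x0 by (intro divide_left_mono mult_mono mult_pos_pos) auto
      then have "2 * exp 12 * \<delta>\<^sup>2 * (real d ^ 3 / ((real N + 1) * (real N + 2))) \<le> 2 * exp 12 * \<delta>\<^sup>2 * (real d ^ 3 / ((x d + 1) * (x d + 2)))"
        by (intro mult_left_mono) auto
      moreover have "(11/12) powr (real N / 2) \<le> (11/12::real) powr (x d / 2)"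
        using xN by (intro powr_mono') auto
      then have "26 * \<delta>\<^sup>2 * (real d powr (3/2) * (11/12) powr (real N / 2) * exp (real d * ln (1024 * real d) / 2))
        \<le> 26 * \<delta>\<^sup>2 * (real d powr (3/2) * (11/12) powr (x d / 2) * exp (real d * ln (1024 * real d) / 2))"
        by (intro mult_left_mono mult_right_mono) auto
      ultimately show "2 * exp 12 * \<delta>\<^sup>2 * real d ^ 3 / ((real N + 1) * (real N + 2))
      + 26 * \<delta>\<^sup>2 * real d powr (3/2) * (11/12) powr (real N / 2) * exp (real d * ln (1024 * real d) / 2) \<le> g d"
        unfolding g_def by (simp add: mult.assoc)
    qed
    finally show ?case by (simp add: N_def)
  qed
  ultimately show ?thesis by (intro exI[where x = "\<lambda>d. ennreal (g d)"] conjI)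
qed

theorem theorem6p1:
  fixes \<delta> :: real
  assumes "\<delta> > 0"
  shows "(\<forall>d N. 1 \<le> d \<longrightarrow> d + 2 \<le> N \<longrightarrow>
           EW2 d N \<delta> \<le> ennreal (2 * exp 12 * \<delta>\<^sup>2 * real d ^ 3 / ((real N + 1) * (real N + 2))
              + 26 * \<delta>\<^sup>2 * real d powr (3/2) * (11/12) powr (real N / 2)
                * exp (real d * ln (1024 * real d) / 2)))
       \<and> limsup (\<lambda>d. EW2 d (nat \<lceil>real d powr (3/2)\<rceil>) \<delta>) \<le> ennreal (2 * exp 12 * \<delta>\<^sup>2)
       \<and> (\<lambda>d. EW2 d (nat \<lceil>real d powr (3/2) * ln (real d)\<rceil>) \<delta>) \<longlonglongrightarrow> 0"
proof (intro conjI allI impI)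
  fix d N :: nat assume "1 \<le> d" "d + 2 \<le> N"
  then show "EW2 d N \<delta> \<le> ennreal (2 * exp 12 * \<delta>\<^sup>2 * real d ^ 3 / ((real N + 1) * (real N + 2))
      + 26 * \<delta>\<^sup>2 * real d powr (3/2) * (11/12) powr (real N / 2) * exp (real d * ln (1024 * real d) / 2))"
    unfolding second_term_eq[OF \<open>1 \<le> d\<close>] by (intro EW2_bound assms)
next
  have h1: "eventually (\<lambda>d. real d powr (3/2) \<ge> real d + 2) sequentially"
    by real_asymp
  have h2: "(\<lambda>d. real d ^ 3 / ((real d powr (3/2) + 1) * (real d powr (3/2) + 2))) \<longlonglongrightarrow> 1"
    by real_asymp
  \<comment> \<open>The decay exponent of order d^(3/2) dominates (d / 2) ln (1024 d), which is why
    the second term disappears.\<close>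
  have h3: "(\<lambda>d. real d powr (3/2) * (11/12) powr (real d powr (3/2) / 2) * exp (real d * ln (1024 * real d) / 2)) \<longlonglongrightarrow> 0"
    by real_asymp
  from limit_bound[OF assms h1 h2 h3] obtain f where f: "eventually (\<lambda>d. EW2 d (nat \<lceil>real d powr (3/2)\<rceil>) \<delta> \<le> f d) sequentially"
    "f \<longlonglongrightarrow> ennreal (2 * exp 12 * \<delta>\<^sup>2 * 1)" by blast
  have "limsup (\<lambda>d. EW2 d (nat \<lceil>real d powr (3/2)\<rceil>) \<delta>) \<le> limsup f"
    by (rule Limsup_mono[OF f(1)])
  also have "\<dots> = ennreal (2 * exp 12 * \<delta>\<^sup>2)"
    using lim_imp_Limsup[OF _ f(2)] by simp
  finally show "limsup (\<lambda>d. EW2 d (nat \<lceil>real d powr (3/2)\<rceil>) \<delta>) \<le> ennreal (2 * exp 12 * \<delta>\<^sup>2)" .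
next
  have h1: "eventually (\<lambda>d. real d powr (3/2) * ln (real d) \<ge> real d + 2) sequentially"
    by real_asymp
  \<comment> \<open>The extra logarithm makes the denominator grow like d^3 (ln d)^2, so the first
    term now vanishes as well.\<close>
  have h2: "(\<lambda>d. real d ^ 3 / ((real d powr (3/2) * ln (real d) + 1) * (real d powr (3/2) * ln (real d) + 2))) \<longlonglongrightarrow> 0"
    by real_asymp
  have h3: "(\<lambda>d. real d powr (3/2) * (11/12) powr (real d powr (3/2) * ln (real d) / 2) * exp (real d * ln (1024 * real d) / 2)) \<longlonglongrightarrow> 0"
    by real_asymp
  from limit_bound[OF assms h1 h2 h3] obtain f where f: "eventually (\<lambda>d. EW2 d (nat \<lceil>real d powr (3/2) * ln (real d)\<rceil>) \<delta> \<le> f d) sequentially"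
    "f \<longlonglongrightarrow> ennreal (2 * exp 12 * \<delta>\<^sup>2 * 0)" by blast
  show "(\<lambda>d. EW2 d (nat \<lceil>real d powr (3/2) * ln (real d)\<rceil>) \<delta>) \<longlonglongrightarrow> 0"
    by (rule tendsto_sandwich[OF _ f(1) tendsto_const]) (use f(2) in auto)
qed

end
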